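(* Enum Minimal MC admits a polynomial-delay enumeration kernel with $\mathcal O(k)$ vertices when parameterized by the feedback edge number $k$ of the input graph.
   Context: A feedback edge set of $G$ is a set $S\subseteq E(G)$ such that $G-S$ is a forest; the feedback edge number ${\sf fn}(G)$ is the minimum size of a feedback edge set. The input graph is assumed to be given together with a minimum feedback edge set. A matching cut of $G$ is a (possibly empty) edge set $M$ that is a matching and equals $E(A,B)$ (edges between $A$ and $B$) for some partition $\{A,B\}$ of $V(G)$; it is minimal if no matching cut is a proper subset of it. Enum Minimal MC: list all minimal matching cuts without repetition. For a parameterized enumeration problem (instances $x$, solutions $\mathsf{Sol}(x)$, parameter $\kappa(x)$), a polynomial-delay enumeration kernel is a pair of algorithms $\mathcal A,\mathcal A'$ where $\mathcal A$ computes in time polynomial in $|x|+\kappa(x)$ an instance $y$ with $|y|+\kappa(y)\le f(\kappa(x))$ ($f$ computable), and for each $s\in\mathsf{Sol}(y)$, $\mathcal A'$ enumerates with delay polynomial in $|x|+|y|+\kappa(x)+\kappa(y)$ a set $S_s\subseteq\mathsf{Sol}(x)$ such that $\{S_s\}_{s\in\mathsf{Sol}(y)}$ partitions $\mathsf{Sol}(x)$. *)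

theory Defs
  imports
    "HOL-Library.Landau_Symbols"
    "HOL-Library.Disjoint_Sets"
    "HOL-Computational_Algebra.Polynomial"
begin

section \<open>Model of computation\<close>

text \<open>
  Algorithms are programs of an imperative language over binary trees (N. Jones' WHILE language),
  extended by an output command. Trees are understood to be stored with sharing, so constructing
  and dismantling a pair and copying a variable take constant time. Comparing or outputting trees
  is charged with their sizes. Up to polynomials, time in this model is Turing machine time.
\<close>

datatype tree = Leaf | Node tree tree

datatype expr =
    Var nat
  | Lf
  | Pair expr expr
  | Hd expr
  | Tl expr
  | Eq expr expr

datatype com =
    Assign nat expr
  | Seq com com
  | If expr com com
  | While expr com
  | Out expr

type_synonym state = "nat \<Rightarrow> tree"

fun hd_tree :: "tree \<Rightarrow> tree" where
  "hd_tree Leaf = Leaf"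
| "hd_tree (Node l r) = l"

fun tl_tree :: "tree \<Rightarrow> tree" where
  "tl_tree Leaf = Leaf"
| "tl_tree (Node l r) = r"

fun eval :: "expr \<Rightarrow> state \<Rightarrow> tree" where
  "eval (Var i) \<sigma> = \<sigma> i"
| "eval Lf \<sigma> = Leaf"
| "eval (Pair a b) \<sigma> = Node (eval a \<sigma>) (eval b \<sigma>)"
| "eval (Hd a) \<sigma> = hd_tree (eval a \<sigma>)"
| "eval (Tl a) \<sigma> = tl_tree (eval a \<sigma>)"
| "eval (Eq a b) \<sigma> = (if eval a \<sigma> = eval b \<sigma> then Node Leaf Leaf else Leaf)"

text \<open>The library function \<open>size\<close> counts the inner nodes of a tree.\<close>

fun cost :: "expr \<Rightarrow> state \<Rightarrow> nat" where
  "cost (Var i) \<sigma> = 1"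
| "cost Lf \<sigma> = 1"
| "cost (Pair a b) \<sigma> = cost a \<sigma> + cost b \<sigma> + 1"
| "cost (Hd a) \<sigma> = cost a \<sigma> + 1"
| "cost (Tl a) \<sigma> = cost a \<sigma> + 1"
| "cost (Eq a b) \<sigma> = cost a \<sigma> + cost b \<sigma> + size (eval a \<sigma>) + size (eval b \<sigma>) + 1"

text \<open>
  \<open>exec c \<sigma> tr \<sigma>'\<close>: started in \<open>\<sigma>\<close>, the program \<open>c\<close> halts in \<open>\<sigma>'\<close>. The trace \<open>tr\<close> has one entry per
  unit of time: \<open>Some v\<close> when \<open>v\<close> is output, and \<open>None\<close> otherwise. As a condition, every tree
  except \<open>Leaf\<close> counts as true.
\<close>

inductive exec :: "com \<Rightarrow> state \<Rightarrow> tree option list \<Rightarrow> state \<Rightarrow> bool" where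
  Assign: "exec (Assign i e) \<sigma> (replicate (cost e \<sigma>) None) (\<sigma>(i := eval e \<sigma>))"
| Seq: "exec c \<sigma> tr \<sigma>' \<Longrightarrow> exec d \<sigma>' tr' \<sigma>'' \<Longrightarrow> exec (Seq c d) \<sigma> (tr @ tr') \<sigma>''"
| IfTrue: "eval e \<sigma> \<noteq> Leaf \<Longrightarrow> exec c \<sigma> tr \<sigma>' \<Longrightarrow>
    exec (If e c d) \<sigma> (replicate (cost e \<sigma>) None @ tr) \<sigma>'"
| IfFalse: "eval e \<sigma> = Leaf \<Longrightarrow> exec d \<sigma> tr \<sigma>' \<Longrightarrow>
    exec (If e c d) \<sigma> (replicate (cost e \<sigma>) None @ tr) \<sigma>'"
| WhileTrue: "eval e \<sigma> \<noteq> Leaf \<Longrightarrow> exec c \<sigma> tr \<sigma>' \<Longrightarrow> exec (While e c) \<sigma>' tr' \<sigma>'' \<Longrightarrow>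
    exec (While e c) \<sigma> (replicate (cost e \<sigma>) None @ tr @ tr') \<sigma>''"
| WhileFalse: "eval e \<sigma> = Leaf \<Longrightarrow> exec (While e c) \<sigma> (replicate (cost e \<sigma>) None) \<sigma>"
| Out: "exec (Out e) \<sigma> (replicate (cost e \<sigma> + size (eval e \<sigma>)) None @ [Some (eval e \<sigma>)]) \<sigma>"

lemma exec_deterministic:
  "exec c \<sigma> tr \<sigma>' \<Longrightarrow> exec c \<sigma> tr2 \<sigma>2 \<Longrightarrow> tr = tr2 \<and> \<sigma>' = \<sigma>2"
proof (induction arbitrary: tr2 \<sigma>2 rule: exec.induct)
  case (Seq c \<sigma> tr \<sigma>' d tr' \<sigma>'')
  from Seq.prems show ?case by cases (use Seq.IH in blast)
next
  case (WhileTrue e \<sigma> c tr \<sigma>' tr' \<sigma>'')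
  from WhileTrue.prems show ?case by cases (use WhileTrue in blast)+
qed (erule exec.cases; auto)+

definition init :: "tree list \<Rightarrow> state" where
  "init ts = (\<lambda>i. if i < length ts then ts ! i else Leaf)"

text \<open>A function value is returned in variable 0; the time includes that for writing it down.\<close>

definition computes_in_time :: "com \<Rightarrow> tree list \<Rightarrow> tree \<Rightarrow> nat \<Rightarrow> bool" where
  "computes_in_time c ts r t \<longleftrightarrow>
     (\<exists>tr \<sigma>. exec c (init ts) tr \<sigma> \<and> \<sigma> 0 = r \<and> length tr + size r \<le> t)"

text \<open>
  The maximal number of consecutive silent steps. This covers the time before the first output,
  between consecutive outputs, and from the last output to termination.
\<close>

definition delay_at_most :: "tree option list \<Rightarrow> nat \<Rightarrow> bool" where
  "delay_at_most tr d \<longleftrightarrow> (\<forall>xs m ys. tr = xs @ replicate m None @ ys \<longrightarrow> m \<le> d)"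

definition outputs :: "tree option list \<Rightarrow> tree list" where
  "outputs tr = map the (filter (\<lambda>v. v \<noteq> None) tr)"

text \<open>The elements of \<open>X\<close> are output, encoded by \<open>enc\<close>, without repetition and in any order.\<close>

definition enumerates_with_delay ::
  "com \<Rightarrow> tree list \<Rightarrow> ('s \<Rightarrow> tree) \<Rightarrow> 's set \<Rightarrow> nat \<Rightarrow> bool" where
  "enumerates_with_delay c ts enc X d \<longleftrightarrow>
     (\<exists>tr \<sigma> ms. exec c (init ts) tr \<sigma> \<and> delay_at_most tr d \<and>
        distinct ms \<and> set ms = X \<and> outputs tr = map enc ms)"

fun enc_nat :: "nat \<Rightarrow> tree" where
  "enc_nat 0 = Leaf"
| "enc_nat (Suc n) = Node Leaf (enc_nat n)"

fun enc_list :: "('a \<Rightarrow> tree) \<Rightarrow> 'a list \<Rightarrow> tree" where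
  "enc_list enc [] = Leaf"
| "enc_list enc (x # xs) = Node (enc x) (enc_list enc xs)"

definition computable :: "(nat \<Rightarrow> nat) \<Rightarrow> bool" where
  "computable f \<longleftrightarrow> (\<exists>c. \<forall>n. \<exists>t. computes_in_time c [enc_nat n] (enc_nat (f n)) t)"

section \<open>Parameterized enumeration problems and kernels\<close>

record ('i, 's) enum_problem =
  instances :: "'i set"
  Sol :: "'i \<Rightarrow> 's set"
  param :: "'i \<Rightarrow> nat"
  enc_inst :: "'i \<Rightarrow> tree"
  enc_sol :: "'i \<Rightarrow> 's \<Rightarrow> tree"

definition inst_size :: "('i, 's) enum_problem \<Rightarrow> 'i \<Rightarrow> nat" where
  "inst_size P x = size (enc_inst P x)"

text \<open>
  \<open>A\<close> computes the instance map \<open>K\<close>, and \<open>A'\<close> lifts solutions of \<open>K x\<close> to solutions of \<open>x\<close>.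
  The blocks of a partition are nonempty, and different solutions of \<open>K x\<close> have disjoint blocks.
\<close>

definition pd_enum_kernel ::
  "('i, 's) enum_problem \<Rightarrow> com \<Rightarrow> com \<Rightarrow> ('i \<Rightarrow> 'i) \<Rightarrow> bool" where
  "pd_enum_kernel P A A' K \<longleftrightarrow>
     (\<exists>p :: nat poly. \<forall>x \<in> instances P. K x \<in> instances P \<and>
        computes_in_time A [enc_inst P x] (enc_inst P (K x)) (poly p (inst_size P x + param P x))) \<and>
     (\<exists>f. computable f \<and>
        (\<forall>x \<in> instances P. inst_size P (K x) + param P (K x) \<le> f (param P x))) \<and>
     (\<exists>q :: nat poly. \<forall>x \<in> instances P. \<exists>S.
        (\<forall>s \<in> Sol P (K x). S s \<subseteq> Sol P x \<and> S s \<noteq> {} \<and>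
           enumerates_with_delay A' [enc_inst P x, enc_inst P (K x), enc_sol P (K x) s]
             (enc_sol P x) (S s)
             (poly q (inst_size P x + inst_size P (K x) + param P x + param P (K x)))) \<and>
        disjoint_family_on S (Sol P (K x)) \<and>
        (\<Union>s \<in> Sol P (K x). S s) = Sol P x)"

section \<open>Matching cuts and feedback edge sets\<close>

definition simple_graph :: "'a set \<Rightarrow> 'a set set \<Rightarrow> bool" where
  "simple_graph V E \<longleftrightarrow> finite V \<and> (\<forall>e \<in> E. e \<subseteq> V \<and> card e = 2)"

definition is_cycle :: "'a set set \<Rightarrow> 'a list \<Rightarrow> bool" where
  "is_cycle E vs \<longleftrightarrow> length vs \<ge> 3 \<and> distinct vs \<and>
     (\<forall>i < length vs. {vs ! i, vs ! (Suc i mod length vs)} \<in> E)"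

definition forest :: "'a set set \<Rightarrow> bool" where
  "forest E \<longleftrightarrow> (\<nexists>vs. is_cycle E vs)"

definition feedback_edge_set :: "'a set set \<Rightarrow> 'a set set \<Rightarrow> bool" where
  "feedback_edge_set E S \<longleftrightarrow> S \<subseteq> E \<and> forest (E - S)"

definition feedback_edge_number :: "'a set set \<Rightarrow> nat" where
  "feedback_edge_number E = (LEAST k. \<exists>S. feedback_edge_set E S \<and> card S = k)"

definition edges_between :: "'a set set \<Rightarrow> 'a set \<Rightarrow> 'a set \<Rightarrow> 'a set set" where
  "edges_between E A B = {e \<in> E. \<exists>a \<in> A. \<exists>b \<in> B. e = {a, b}}"

definition matching_cut :: "'a set \<Rightarrow> 'a set set \<Rightarrow> 'a set set \<Rightarrow> bool" where
  "matching_cut V E M \<longleftrightarrow> disjoint M \<and>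
     (\<exists>A B. A \<noteq> {} \<and> B \<noteq> {} \<and> A \<inter> B = {} \<and> A \<union> B = V \<and> M = edges_between E A B)"

definition minimal_matching_cut :: "'a set \<Rightarrow> 'a set set \<Rightarrow> 'a set set \<Rightarrow> bool" where
  "minimal_matching_cut V E M \<longleftrightarrow>
     matching_cut V E M \<and> (\<nexists>M'. matching_cut V E M' \<and> M' \<subset> M)"

section \<open>The enumeration problem\<close>

text \<open>
  An instance \<open>(n, es, fs)\<close> is the graph on the vertices \<open>0, \<dots>, n - 1\<close> with edge list \<open>es\<close>, together
  with a minimum feedback edge set listed by \<open>fs\<close>. Vertices are encoded in unary, which changes
  the size only polynomially, since an encoded graph has size at least the number of its vertices.
\<close>

type_synonym mc_instance = "nat \<times> (nat \<times> nat) list \<times> (nat \<times> nat) list"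

definition verts :: "mc_instance \<Rightarrow> nat set" where
  "verts = (\<lambda>(n, es, fs). {..<n})"

definition edge_set :: "(nat \<times> nat) list \<Rightarrow> nat set set" where
  "edge_set es = (\<lambda>(u, v). {u, v}) ` set es"

definition edges :: "mc_instance \<Rightarrow> nat set set" where
  "edges = (\<lambda>(n, es, fs). edge_set es)"

definition mc_instances :: "mc_instance set" where
  "mc_instances = {(n, es, fs).
     (\<forall>(u, v) \<in> set es. u < v) \<and> distinct es \<and> simple_graph {..<n} (edge_set es) \<and>
     set fs \<subseteq> set es \<and> distinct fs \<and> feedback_edge_set (edge_set es) (edge_set fs) \<and>
     card (edge_set fs) = feedback_edge_number (edge_set es)}"

definition enc_edges :: "(nat \<times> nat) list \<Rightarrow> tree" where
  "enc_edges = enc_list (\<lambda>(u, v). Node (enc_nat u) (enc_nat v))"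

text \<open>For a unique encoding, the edges of a solution are listed in the order of the input.\<close>

definition enum_minimal_mc :: "(mc_instance, nat set set) enum_problem" where
  "enum_minimal_mc = \<lparr>
     instances = mc_instances,
     Sol = (\<lambda>x. {M. minimal_matching_cut (verts x) (edges x) M}),
     param = (\<lambda>x. feedback_edge_number (edges x)),
     enc_inst = (\<lambda>(n, es, fs). Node (enc_nat n) (Node (enc_edges es) (enc_edges fs))),
     enc_sol = (\<lambda>(n, es, fs) M. enc_edges (filter (\<lambda>(u, v). {u, v} \<in> M) es))\<rparr>"

end

theory Submission
  imports Defs
begin

text \<open>
  Let \<open>G\<close> be connected; otherwise the empty cut is the only minimal one, and two isolated vertices
  are a kernel. Exhaustively delete vertices of degree one, and suppress a vertex of degree two
  whose two neighbours have degree two as well, labelling the new edge by the original edges that it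
  stands for. A minimal matching cut with at least three edges contains at most one edge of each
  suppressed path, and exchanging this edge for another one of its label yields a minimal matching
  cut again. So the solutions of the reduced graph lift to disjoint products of labels, and these
  products contain every solution except some with at most two edges. The exceptions can be listed in
  polynomial time; if there are any, they are assigned to the bridge of an additional pendant vertex.
  In the reduced graph every vertex of degree two has a neighbour of larger degree (unless the graph
  is a triangle), so counting degrees bounds the number of vertices linearly in \<open>k\<close>.
\<close>

section \<open>Cuts\<close>

text \<open>The threshold of three edges comes from the rule that suppresses \<open>u\<close>
  between \<open>a\<close> and \<open>v\<close>. Let \<open>g\<close> be the second edge at
  \<open>v\<close>. The cut around the two vertices \<open>u\<close> and \<open>v\<close> consists
  of at most {a,u} and \<open>g\<close>, so by minimality a solution containing both has no third
  edge. In a larger solution the new edge {a,v} can therefore replace {a,u} without meeting another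
  edge of the matching. Losses occur only on this way down: every solution of the reduced graph
  lifts, whatever its size.

  Both reductions remove one vertex and one edge. So |E| - |V| is invariant, and through it
  \<open>k\<close> bounds the reduced graph.

  Blocks must be nonempty, hence the pendant vertex is added only if something is missed. It
  accounts for the step from 8k + 3 to 8k + 4 vertices.

  The kernel is a bare graph without labels, so the lifting program recomputes the labels from the
  original instance. The kernel must also carry a minimum feedback edge set; the complement of a
  spanning tree is one.

  The machine shares subtrees, so short computations can build huge trees. Time bounds are therefore
  accompanied by size bounds throughout.\<close>

definition bd :: "'a set set \<Rightarrow> 'a set \<Rightarrow> 'a set set" where
  "bd E A = {e \<in> E. e \<inter> A \<noteq> {} \<and> \<not> e \<subseteq> A}"

text \<open>Graphs with at most one vertex count as connected, because they have no nonempty proper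
  vertex subset. They have no cut at all.\<close>

definition disconnected :: "'a set \<Rightarrow> 'a set set \<Rightarrow> bool" where
  "disconnected V E \<longleftrightarrow> (\<exists>A. A \<subset> V \<and> A \<noteq> {} \<and> bd E A = {})"

definition sols :: "'a set \<Rightarrow> 'a set set \<Rightarrow> 'a set set set" where
  "sols V E = {M. minimal_matching_cut V E M}"

lemma simple_graph_edge:
  assumes "simple_graph V E" "e \<in> E"
  obtains x y where "e = {x, y}" "x \<noteq> y" "x \<in> V" "y \<in> V"
proof -
  from assms have "card e = 2" "e \<subseteq> V" by (auto simp: simple_graph_def)
  then show ?thesis using that by (auto simp: card_2_iff)
qed

lemma simple_graph_finite: "simple_graph V E \<Longrightarrow> finite V \<and> finite E"
  unfolding simple_graph_def by (meson Pow_iff finite_Pow_iff finite_subset subsetI)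

lemma edges_between_eq_cut:
  assumes "simple_graph V E" "A \<union> B = V" "A \<inter> B = {}"
  shows "edges_between E A B = bd E A"
proof -
  have "(\<exists>a\<in>A. \<exists>b\<in>B. e = {a, b}) \<longleftrightarrow> e \<inter> A \<noteq> {} \<and> \<not> e \<subseteq> A" if eE: "e \<in> E" for e
  proof -
    obtain x y where "e = {x, y}" "x \<noteq> y" "x \<in> V" "y \<in> V"
      using simple_graph_edge[OF assms(1) eE] .
    then show ?thesis using assms(2,3) by (auto simp: doubleton_eq_iff)
  qed
  then show ?thesis by (auto simp: edges_between_def bd_def)
qed

lemma matching_cut_iff:
  assumes "simple_graph V E"
  shows "matching_cut V E M \<longleftrightarrow> disjoint M \<and> (\<exists>A. A \<subset> V \<and> A \<noteq> {} \<and> M = bd E A)"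
proof -
  have "(\<exists>A B. A \<noteq> {} \<and> B \<noteq> {} \<and> A \<inter> B = {} \<and> A \<union> B = V \<and> M = edges_between E A B) \<longleftrightarrow>
      (\<exists>A. A \<subset> V \<and> A \<noteq> {} \<and> M = bd E A)" (is "?L \<longleftrightarrow> ?R")
  proof
    assume ?L
    then obtain A B where "A \<noteq> {}" "B \<noteq> {}" "A \<inter> B = {}" "A \<union> B = V" "M = edges_between E A B" by blast
    then show ?R using edges_between_eq_cut[OF assms, of A B] by (intro exI[of _ A]) auto
  next
    assume ?R
    then obtain A where "A \<subset> V" "A \<noteq> {}" "M = bd E A" by blast
    then show ?L using edges_between_eq_cut[OF assms, of A "V - A"]
      by (intro exI[of _ A] exI[of _ "V - A"]) auto
  qed
  then show ?thesis by (simp add: matching_cut_def)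
qed

text \<open>Minimality is tested against all cuts and not only against matching cuts. This makes no
  difference, since a subset of a matching is a matching, and it removes the matching condition from
  every minimality argument below.\<close>

definition mcut :: "'a set \<Rightarrow> 'a set set \<Rightarrow> 'a set set \<Rightarrow> bool" where
  "mcut V E M \<longleftrightarrow> disjoint M \<and> (\<exists>A. A \<subset> V \<and> A \<noteq> {} \<and> M = bd E A) \<and>
    (\<forall>C. C \<subset> V \<longrightarrow> C \<noteq> {} \<longrightarrow> \<not> bd E C \<subset> M)"

lemma disjoint_subset: "disjoint M \<Longrightarrow> M' \<subseteq> M \<Longrightarrow> disjoint M'"
  unfolding disjoint_def pairwise_def by blast

lemma sols_iff: "simple_graph V E \<Longrightarrow> M \<in> sols V E \<longleftrightarrow> mcut V E M"
  unfolding sols_def minimal_matching_cut_def mem_Collect_eq matching_cut_iff mcut_def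
  using disjoint_subset[of M] psubset_imp_subset by (smt (verit, best))

lemma mcutE:
  assumes "mcut V E M"
  obtains A where "disjoint M" "A \<subset> V" "A \<noteq> {}" "M = bd E A" "\<And>C. C \<subset> V \<Longrightarrow> C \<noteq> {} \<Longrightarrow> \<not> bd E C \<subset> M"
  using assms unfolding mcut_def by blast

lemma mcutI:
  assumes "disjoint M" "A \<subset> V" "A \<noteq> {}" "M = bd E A" "\<And>C. C \<subset> V \<Longrightarrow> C \<noteq> {} \<Longrightarrow> bd E C \<subset> M \<Longrightarrow> False"
  shows "mcut V E M"
  using assms unfolding mcut_def by blast

lemma mcut_subset: "mcut V E M \<Longrightarrow> M \<subseteq> E"
  by (auto simp: mcut_def bd_def)

text \<open>If a cut inside \<open>M\<close> missed an edge \<open>e\<close> of \<open>M\<close>,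
  the graph would stay disconnected when \<open>e\<close> is put back. So every cut inside
  \<open>M\<close> is all of \<open>M\<close>. The criterion needs only connectivity tests and no
  search over vertex sets, which is what makes solutions checkable in polynomial time.\<close>

lemma mcut_iff_disconnected:
  "mcut V E M \<longleftrightarrow> disjoint M \<and> M \<subseteq> E \<and> disconnected V (E - M) \<and> (\<forall>e\<in>M. \<not> disconnected V (E - (M - {e})))"
proof -
  have cut_minus: "bd (E - X) C = {} \<longleftrightarrow> bd E C \<subseteq> X" for X C
    by (auto simp: bd_def)
  show ?thesis
  proof
    assume "mcut V E M"
    then show "disjoint M \<and> M \<subseteq> E \<and> disconnected V (E - M) \<and> (\<forall>e\<in>M. \<not> disconnected V (E - (M - {e})))"
      using mcut_subset[of V E M] unfolding mcut_def disconnected_def cut_minus by blast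
  next
    assume *: "disjoint M \<and> M \<subseteq> E \<and> disconnected V (E - M) \<and> (\<forall>e\<in>M. \<not> disconnected V (E - (M - {e})))"
    have min: "M \<subseteq> bd E C" if "C \<subset> V" "C \<noteq> {}" "bd E C \<subseteq> M" for C
      using * that unfolding disconnected_def cut_minus by blast
    from * obtain A where "A \<subset> V" "A \<noteq> {}" "bd E A \<subseteq> M" unfolding disconnected_def cut_minus by blast
    with min[of A] * min show "mcut V E M" unfolding mcut_def by blast
  qed
qed

lemma empty_mcut_iff: "mcut V E {} \<longleftrightarrow> disconnected V E"
  by (auto simp: mcut_def disconnected_def)

section \<open>Lifting all but the small solutions\<close>

text \<open>
  A solution of the smaller graph is lifted by replacing each of its edges by one of the edges that
  label it. Solutions with at most two edges may be missed; there are only polynomially many.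
\<close>

definition lifts :: "'a set set \<Rightarrow> ('b \<Rightarrow> 'a set) \<Rightarrow> 'b set \<Rightarrow> 'b set set \<Rightarrow> bool" where
  "lifts S l F S' \<longleftrightarrow> disjoint_family_on l F \<and> (\<forall>s\<in>S'. s \<subseteq> F \<and> (\<forall>c\<in>Pi s l. c ` s \<in> S)) \<and>
    (\<forall>M\<in>S. card M \<ge> 3 \<longrightarrow> (\<exists>s\<in>S'. \<exists>c\<in>Pi s l. M = c ` s))"

lemma inj_on_choice:
  assumes "disjoint_family_on l F" "s \<subseteq> F" "c \<in> Pi s l" shows "inj_on c s"
proof (rule inj_onI, rule ccontr)
  fix f g assume fg: "f \<in> s" "g \<in> s" "c f = c g" "f \<noteq> g"
  then have "c f \<in> l f \<inter> l g" using assms(3) by (metis IntI Pi_mem)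
  moreover have "l f \<inter> l g = {}" using fg assms(1,2) by (auto simp: disjoint_family_on_def)
  ultimately show False by simp
qed

lemma liftsD:
  assumes "lifts S l F S'"
  shows "disjoint_family_on l F" "s \<in> S' \<Longrightarrow> s \<subseteq> F" "s \<in> S' \<Longrightarrow> c \<in> Pi s l \<Longrightarrow> c ` s \<in> S"
    "M \<in> S \<Longrightarrow> 3 \<le> card M \<Longrightarrow> \<exists>s\<in>S'. \<exists>c\<in>Pi s l. M = c ` s"
  using assms by (simp_all add: lifts_def)

text \<open>Choices compose: pick a middle edge for each edge of \<open>s\<close>, and an original
  edge for each middle edge. The threshold of three edges does not deteriorate along a chain of
  reductions, because choices from disjoint labels are injective and keep the cardinality.\<close>

lemma lifts_trans:
  assumes l: "lifts S l F S'" and l': "lifts S' l' F' S''" and sub: "\<And>f. f \<in> F' \<Longrightarrow> l' f \<subseteq> F"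
  shows "lifts S (\<lambda>f. \<Union> (l ` l' f)) F' S''"
  unfolding lifts_def
proof (intro conjI ballI impI)
  show "disjoint_family_on (\<lambda>f. \<Union> (l ` l' f)) F'"
    unfolding disjoint_family_on_def
  proof (intro ballI impI equals0I)
    fix f g e assume fg: "f \<in> F'" "g \<in> F'" "f \<noteq> g" and "e \<in> \<Union> (l ` l' f) \<inter> \<Union> (l ` l' g)"
    then obtain x y where xy: "x \<in> l' f" "y \<in> l' g" "e \<in> l x" "e \<in> l y" by blast
    have "l' f \<inter> l' g = {}" using liftsD(1)[OF l'] fg by (simp add: disjoint_family_on_def)
    then have "x \<noteq> y" using xy by blast
    moreover have "x \<in> F" "y \<in> F" using xy sub fg by blast+
    ultimately have "l x \<inter> l y = {}" using liftsD(1)[OF l] by (simp add: disjoint_family_on_def)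
    then show False using xy by blast
  qed
next
  fix s assume S'': "s \<in> S''"
  then show s: "s \<subseteq> F'" by (rule liftsD(2)[OF l'])
  fix c assume "c \<in> Pi s (\<lambda>f. \<Union> (l ` l' f))"
  then have "\<forall>f\<in>s. \<exists>g. g \<in> l' f \<and> c f \<in> l g" by auto
  then obtain d where d: "\<forall>f\<in>s. d f \<in> l' f \<and> c f \<in> l (d f)" using bchoice[of s] by meson
  then have dPi: "d \<in> Pi s l'" by auto
  have ds: "d ` s \<in> S'" by (rule liftsD(3)[OF l' S'' dPi])
  have inj: "inj_on d s" by (rule inj_on_choice[OF liftsD(1)[OF l'] s dPi])
  \<comment> \<open>The given choice \<open>c\<close> is read on the middle edges; \<open>d\<close>
    is injective, so each middle edge belongs to exactly one edge of \<open>s\<close>.\<close>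
  let ?c = "\<lambda>g. c (inv_into s d g)"
  have "?c \<in> Pi (d ` s) l" using d inj by auto
  then have "?c ` d ` s \<in> S" by (rule liftsD(3)[OF l ds])
  moreover have "?c ` d ` s = c ` s" using inj by (auto simp: image_image)
  ultimately show "c ` s \<in> S" by simp
next
  fix M assume M: "M \<in> S" "3 \<le> card M"
  then obtain s c where s: "s \<in> S'" "c \<in> Pi s l" "M = c ` s" using liftsD(4)[OF l] by blast
  have "card M = card s"
    using inj_on_choice[OF liftsD(1)[OF l] liftsD(2)[OF l s(1)] s(2)] s(3) by (simp add: card_image)
  with M obtain t d where t: "t \<in> S''" "d \<in> Pi t l'" "s = d ` t" using liftsD(4)[OF l' s(1)] by auto
  have "d f \<in> l' f \<and> c (d f) \<in> l (d f)" if "f \<in> t" for f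
    using s(2) t(2) that unfolding t(3) by (auto simp: Pi_iff)
  then have "c \<circ> d \<in> Pi t (\<lambda>f. \<Union> (l ` l' f))" unfolding Pi_iff o_def by blast
  moreover have "M = (c \<circ> d) ` t" using s t by auto
  ultimately show "\<exists>s\<in>S''. \<exists>c\<in>Pi s (\<lambda>f. \<Union> (l ` l' f)). M = c ` s" using t(1) by blast
qed

lemma lifts_refl:
  assumes "\<And>s. s \<in> S \<Longrightarrow> s \<subseteq> F" shows "lifts S (\<lambda>f. {f}) F S"
proof -
  have "c ` s = s" if "c \<in> Pi s (\<lambda>f. {f})" for c and s :: "'a set"
  proof -
    have "c ` s = id ` s" by (rule image_cong) (use that in auto)
    then show ?thesis by simp
  qed
  then show ?thesis using assms unfolding lifts_def disjoint_family_on_def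
    by (auto intro!: bexI[of _ id] simp: Pi_def)
qed

text \<open>A disconnected graph has the empty set as a solution, and the only lift of the empty set
  is the empty set.\<close>

lemma lifts_connected:
  assumes "lifts (sols V E) l E' (sols V' E')" "simple_graph V E" "simple_graph V' E'" "\<not> disconnected V E"
  shows "\<not> disconnected V' E'"
proof
  assume "disconnected V' E'"
  then have "{} \<in> sols V' E'" using assms(3) by (simp add: sols_iff empty_mcut_iff)
  then have "{} \<in> sols V E" using assms(1) using liftsD(3)[OF assms(1), of "{}" undefined] by simp
  then show False using assms(2,4) by (simp add: sols_iff empty_mcut_iff)
qed

section \<open>Deleting a leaf\<close>

lemma leaf_cut:
  assumes "\<And>e. e \<in> E \<Longrightarrow> v \<in> e \<Longrightarrow> e = {v, w}" "v \<in> C \<longleftrightarrow> w \<in> C"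
  shows "bd E C = bd (E - {{v, w}}) (C - {v})"
proof -
  have "e \<inter> C \<noteq> {} \<and> \<not> e \<subseteq> C \<longleftrightarrow> e \<noteq> {v, w} \<and> e \<inter> (C - {v}) \<noteq> {} \<and> \<not> e \<subseteq> C - {v}" if "e \<in> E" for e
    using assms(1)[OF that] assms(2) by (cases "v \<in> e") auto
  then show ?thesis by (auto simp: bd_def)
qed

text \<open>A cut that avoids the leaf edge has \<open>v\<close> and \<open>w\<close> on one side,
  so deleting \<open>v\<close> or giving it the side of \<open>w\<close> translates between the cuts
  of the two graphs.\<close>

lemma leaf_mcut_iff:
  assumes vw: "v \<in> V" "w \<in> V" "v \<noteq> w" "{v, w} \<in> E" and leaf: "\<And>e. e \<in> E \<Longrightarrow> v \<in> e \<Longrightarrow> e = {v, w}"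
  shows "mcut V E M \<and> {v, w} \<notin> M \<longleftrightarrow> mcut (V - {v}) (E - {{v, w}}) M"
proof
  have res: "C - {v} \<subset> V - {v} \<and> C - {v} \<noteq> {} \<and> bd E C = bd (E - {{v, w}}) (C - {v})"
    if "C \<subset> V" "C \<noteq> {}" "{v, w} \<notin> bd E C" for C
  proof -
    have *: "v \<in> C \<longleftrightarrow> w \<in> C" using that(3) vw by (auto simp: bd_def)
    show ?thesis using leaf_cut[OF leaf *] that vw * by blast
  qed
  have ext: "\<exists>C\<subset>V. C \<noteq> {} \<and> bd E C = bd (E - {{v, w}}) C'"
    if "C' \<subset> V - {v}" "C' \<noteq> {}" for C'
  proof (cases "w \<in> C'")
    case True
    have "bd E (insert v C') = bd (E - {{v, w}}) (insert v C' - {v})"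
      by (rule leaf_cut[OF leaf]) (use True in auto)
    moreover have "insert v C' - {v} = C'" using that by auto
    moreover have "insert v C' \<subset> V" using that vw by auto
    ultimately show ?thesis by (metis insert_not_empty)
  next
    case False
    have "bd E C' = bd (E - {{v, w}}) (C' - {v})"
      by (rule leaf_cut[OF leaf]) (use False that in auto)
    moreover have "C' - {v} = C'" using that by auto
    ultimately show ?thesis using that by (metis Diff_subset psubset_subset_trans)
  qed
  {
    assume M: "mcut V E M \<and> {v, w} \<notin> M"
    then obtain A where A: "disjoint M" "A \<subset> V" "A \<noteq> {}" "M = bd E A"
      "\<And>C. C \<subset> V \<Longrightarrow> C \<noteq> {} \<Longrightarrow> \<not> bd E C \<subset> M" using mcutE[of V E M] by blast
    show "mcut (V - {v}) (E - {{v, w}}) M"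
    proof (rule mcutI[OF A(1)])
      show "A - {v} \<subset> V - {v}" "A - {v} \<noteq> {}" "M = bd (E - {{v, w}}) (A - {v})"
        using res[OF A(2,3)] A(4) M by auto
      show False if "C \<subset> V - {v}" "C \<noteq> {}" "bd (E - {{v, w}}) C \<subset> M" for C
        using ext[OF that(1,2)] that(3) A(5) by metis
    qed
  }
  {
    assume M: "mcut (V - {v}) (E - {{v, w}}) M"
    then obtain A where A: "disjoint M" "A \<subset> V - {v}" "A \<noteq> {}" "M = bd (E - {{v, w}}) A"
      "\<And>C. C \<subset> V - {v} \<Longrightarrow> C \<noteq> {} \<Longrightarrow> \<not> bd (E - {{v, w}}) C \<subset> M" by (rule mcutE) blast
    have vwM: "{v, w} \<notin> M" using mcut_subset[OF M] by auto
    obtain A' where A': "A' \<subset> V" "A' \<noteq> {}" "bd E A' = M" using ext[OF A(2,3)] A(4) by auto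
    have "mcut V E M"
    proof (rule mcutI[OF A(1) A'(1,2) A'(3)[symmetric]])
      show False if "C \<subset> V" "C \<noteq> {}" "bd E C \<subset> M" for C
        using res[OF that(1,2)] that(3) vwM A(5)[of "C - {v}"] by auto
    qed
    with vwM show "mcut V E M \<and> {v, w} \<notin> M" by simp
  }
qed

text \<open>The leaf edge is a cut by itself. Hence the solutions lost by deleting a leaf have a
  single edge and fall below the threshold.\<close>

lemma leaf_edge_mcut:
  assumes "v \<in> V" "w \<in> V" "v \<noteq> w" "{v, w} \<in> E" "\<And>e. e \<in> E \<Longrightarrow> v \<in> e \<Longrightarrow> e = {v, w}"
    and "mcut V E M" "{v, w} \<in> M"
  shows "M = {{v, w}}"
proof -
  have "bd E {v} \<subseteq> {{v, w}}" using assms(5) by (fastforce simp: bd_def)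
  moreover have "{v, w} \<in> bd E {v}" using assms(3,4) by (simp add: bd_def)
  ultimately have "bd E {v} = {{v, w}}" by blast
  moreover have "\<not> bd E {v} \<subset> M" using assms(1-3,6) unfolding mcut_def by blast
  ultimately show ?thesis using assms(7) by auto
qed

lemma leaf_lifts:
  assumes simple: "simple_graph V E" and vw: "v \<in> V" "w \<in> V" "v \<noteq> w" "{v, w} \<in> E"
    and leaf: "\<And>e. e \<in> E \<Longrightarrow> v \<in> e \<Longrightarrow> e = {v, w}"
  shows "simple_graph (V - {v}) (E - {{v, w}})"
    and "lifts (sols V E) (\<lambda>f. {f}) (E - {{v, w}}) (sols (V - {v}) (E - {{v, w}}))"
proof -
  show simple': "simple_graph (V - {v}) (E - {{v, w}})"
  proof -
    have "v \<notin> e" if "e \<in> E - {{v, w}}" for e using leaf[of e] that by blast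
    then show ?thesis using simple unfolding simple_graph_def by blast
  qed
  have iff: "M \<in> sols V E \<and> {v, w} \<notin> M \<longleftrightarrow> M \<in> sols (V - {v}) (E - {{v, w}})" for M
    using leaf_mcut_iff[OF vw leaf] simple simple' by (simp add: sols_iff)
  have "s \<subseteq> E - {{v, w}}" if "s \<in> sols (V - {v}) (E - {{v, w}})" for s
    using that simple' mcut_subset sols_iff by blast
  then have "lifts (sols (V - {v}) (E - {{v, w}})) (\<lambda>f. {f}) (E - {{v, w}}) (sols (V - {v}) (E - {{v, w}}))"
    by (rule lifts_refl)
  moreover have "{v, w} \<notin> M" if "M \<in> sols V E" "3 \<le> card M" for M
  proof
    assume "{v, w} \<in> M"
    then have "M = {{v, w}}" using leaf_edge_mcut[OF vw leaf] that(1) simple sols_iff by blast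
    then show False using that(2) by simp
  qed
  ultimately show "lifts (sols V E) (\<lambda>f. {f}) (E - {{v, w}}) (sols (V - {v}) (E - {{v, w}}))"
    unfolding lifts_def by (simp add: iff[symmetric])
qed

section \<open>Suppressing a vertex of degree two\<close>

text \<open>Nonadjacency of \<open>a\<close> and \<open>v\<close> keeps the graph simple when {a,v}
  replaces the path. Conditions on the degrees of \<open>a\<close> and \<open>v\<close> enter only
  where solutions are pushed down, in \<open>mcut_down_with\<close>.\<close>

locale suppress =
  fixes V :: "'a set" and E :: "'a set set" and a u v :: 'a
  assumes simple: "simple_graph V E" and au: "{a, u} \<in> E" and uv: "{u, v} \<in> E" and a_v: "a \<noteq> v"
    and av: "{a, v} \<notin> E" and deg_u: "\<And>e. e \<in> E \<Longrightarrow> u \<in> e \<Longrightarrow> e = {a, u} \<or> e = {u, v}"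
begin

definition V' where "V' = V - {u}"
definition E' where "E' = insert {a, v} (E - {{a, u}, {u, v}})"

lemma ne: "a \<noteq> u" "u \<noteq> v" "{a, u} \<noteq> {u, v}" "{a, v} \<noteq> {a, u}" "{a, v} \<noteq> {u, v}"
proof -
  have "card {a, u} = 2" "card {u, v} = 2" using simple au uv unfolding simple_graph_def by blast+
  then show "a \<noteq> u" "u \<noteq> v" by auto
  then show "{a, u} \<noteq> {u, v}" "{a, v} \<noteq> {a, u}" "{a, v} \<noteq> {u, v}"
    using a_v by (auto simp: doubleton_eq_iff)
qed

lemma in_V: "a \<in> V" "u \<in> V" "v \<in> V"
  using simple au uv unfolding simple_graph_def by blast+

lemma E'_u: "e \<in> E' \<Longrightarrow> u \<notin> e"
  using deg_u[of e] ne unfolding E'_def by auto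

lemma simple': "simple_graph V' E'"
proof -
  have "e \<subseteq> V' \<and> card e = 2" if "e \<in> E'" for e
  proof (cases "e = {a, v}")
    case True
    then show ?thesis using in_V ne a_v by (auto simp: V'_def)
  next
    case False
    then show ?thesis using that E'_u[OF that] simple by (auto simp: V'_def E'_def simple_graph_def)
  qed
  moreover have "finite V'" using simple by (auto simp: V'_def simple_graph_def)
  ultimately show ?thesis by (simp add: simple_graph_def)
qed

lemma bd_mem:
  "{a, u} \<in> bd E C \<longleftrightarrow> (a \<in> C) \<noteq> (u \<in> C)" "{u, v} \<in> bd E C \<longleftrightarrow> (u \<in> C) \<noteq> (v \<in> C)"
  "{a, v} \<in> bd E' C \<longleftrightarrow> (a \<in> C) \<noteq> (v \<in> C)"
  using au uv by (auto simp: bd_def E'_def)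

text \<open>Away from the path nothing changes, so all arguments below reduce to tracking the three
  edges {a,u}, {u,v} and {a,v}.\<close>

lemma bd_suppress: "bd E' (C - {u}) - {{a, v}} = bd E C - {{a, u}, {u, v}}"
proof (rule set_eqI)
  fix e
  have *: "e \<in> E' \<and> e \<noteq> {a, v} \<longleftrightarrow> e \<in> E \<and> e \<noteq> {a, u} \<and> e \<noteq> {u, v}"
    using av by (auto simp: E'_def)
  show "e \<in> bd E' (C - {u}) - {{a, v}} \<longleftrightarrow> e \<in> bd E C - {{a, u}, {u, v}}"
  proof (cases "u \<in> e")
    case True
    then show ?thesis using E'_u[of e] deg_u[of e] by (auto simp: bd_def)
  next
    case False
    then have "e \<inter> (C - {u}) \<noteq> {} \<and> \<not> e \<subseteq> C - {u} \<longleftrightarrow> e \<inter> C \<noteq> {} \<and> \<not> e \<subseteq> C" by blast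
    then show ?thesis using * by (simp add: bd_def) blast
  qed
qed

lemma bd_other:
  "e \<noteq> {a, v} \<Longrightarrow> e \<noteq> {a, u} \<Longrightarrow> e \<noteq> {u, v} \<Longrightarrow> e \<in> bd E' (C - {u}) \<longleftrightarrow> e \<in> bd E C"
  using bd_suppress[of C] by (metis Diff_iff insert_iff singletonD)

lemma bd'_mem: "{a, v} \<in> bd E' (C - {u}) \<longleftrightarrow> (a \<in> C) \<noteq> (v \<in> C)"
  using ne bd_mem(3)[of "C - {u}"] by auto

lemma nontrivial_restrict:
  assumes "C \<subset> V" "C \<noteq> {}" "u \<in> C \<longleftrightarrow> v \<in> C"
  shows "C - {u} \<subset> V'" "C - {u} \<noteq> {}"
  using assms in_V ne unfolding V'_def by blast+

text \<open>The side of the suppressed vertex is free when a cut is extended. Placing it with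
  \<open>x\<close> decides which of the two path edges is crossed if \<open>a\<close> and
  \<open>v\<close> are separated.\<close>

lemma nontrivial_extend:
  assumes "C' \<subset> V'" "C' \<noteq> {}" "x \<in> {a, v}"
  obtains C where "C \<subset> V" "C \<noteq> {}" "C - {u} = C'" "u \<in> C \<longleftrightarrow> x \<in> C"
proof (cases "x \<in> C'")
  case True
  show ?thesis
    by (rule that[of "insert u C'"]) (use True assms in_V in \<open>auto simp: V'_def\<close>)
next
  case False
  show ?thesis
    by (rule that[of C']) (use False assms ne in \<open>auto simp: V'_def\<close>)
qed

lemma mcut_up_without:
  assumes "mcut V' E' s" "{a, v} \<notin> s" shows "mcut V E s"
proof -
  from assms(1) obtain A where A: "disjoint s" "A \<subset> V'" "A \<noteq> {}" "s = bd E' A"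
    "\<And>C. C \<subset> V' \<Longrightarrow> C \<noteq> {} \<Longrightarrow> \<not> bd E' C \<subset> s" by (rule mcutE) blast
  obtain C where C: "C \<subset> V" "C \<noteq> {}" "C - {u} = A" "u \<in> C \<longleftrightarrow> v \<in> C"
    using nontrivial_extend[OF A(2,3), of v] by blast
  have s: "s = bd E C"
    using bd_suppress[of C] bd_mem(1,2)[of C] bd'_mem[of C] assms(2) C(3,4) A(4) by auto
  show ?thesis
  proof (rule mcutI[OF A(1) C(1,2) s])
    fix D assume D: "D \<subset> V" "D \<noteq> {}" "bd E D \<subset> s"
    have "{a, u} \<notin> s" "{u, v} \<notin> s" using mcut_subset[OF assms(1)] E'_u by auto
    then have *: "u \<in> D \<longleftrightarrow> v \<in> D" "u \<in> D \<longleftrightarrow> a \<in> D" using D(3) bd_mem(1,2)[of D] by blast+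
    have "bd E' (D - {u}) = bd E D"
      using bd_suppress[of D] bd_mem(1,2)[of D] bd'_mem[of D] * by auto
    then show False using A(5)[OF nontrivial_restrict[OF D(1,2) *(1)]] D(3) by simp
  qed
qed

text \<open>With \<open>u\<close> on the side of \<open>v\<close>, the crossing of {a,v} becomes a
  crossing of {a,u}. The result is a matching: the other edges avoid \<open>a\<close> because {a,v}
  was in the matching, and they avoid \<open>u\<close> because no edge of the small graph contains
  it. The version with {u,v} follows by symmetry.\<close>

lemma mcut_up_with:
  assumes "mcut V' E' s" "{a, v} \<in> s" shows "mcut V E (insert {a, u} (s - {{a, v}}))"
proof -
  from assms(1) obtain A where A: "disjoint s" "A \<subset> V'" "A \<noteq> {}" "s = bd E' A"
    "\<And>C. C \<subset> V' \<Longrightarrow> C \<noteq> {} \<Longrightarrow> \<not> bd E' C \<subset> s" by (rule mcutE) blast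
  have notin: "{a, u} \<notin> s" "{u, v} \<notin> s" using mcut_subset[OF assms(1)] E'_u by auto
  obtain C where C: "C \<subset> V" "C \<noteq> {}" "C - {u} = A" "u \<in> C \<longleftrightarrow> v \<in> C"
    using nontrivial_extend[OF A(2,3), of v] by blast
  have acv: "(a \<in> C) \<noteq> (v \<in> C)" using assms(2) A(4) C(3) bd'_mem[of C] by simp
  have s: "insert {a, u} (s - {{a, v}}) = bd E C"
    using bd_suppress[of C] bd_mem(1,2)[of C] C(3,4) A(4) acv by auto
  show ?thesis
  proof (rule mcutI[OF _ C(1,2) s])
    have "e \<inter> {a, u} = {}" if "e \<in> s - {{a, v}}" for e
    proof -
      have "e \<inter> {a, v} = {}" using A(1) that assms(2) by (auto simp: disjoint_def)
      moreover have "u \<notin> e" using that mcut_subset[OF assms(1)] E'_u by blast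
      ultimately show ?thesis by blast
    qed
    then show "disjoint (insert {a, u} (s - {{a, v}}))"
      using A(1) unfolding disjoint_def by (metis Diff_iff Int_commute insert_iff)
    fix D assume D: "D \<subset> V" "D \<noteq> {}" "bd E D \<subset> insert {a, u} (s - {{a, v}})"
    then have *: "u \<in> D \<longleftrightarrow> v \<in> D" using bd_mem(2)[of D] notin ne by blast
    \<comment> \<open>If \<open>D\<close> does not separate \<open>a\<close> from \<open>v\<close>,
      then {a,v} is an edge of \<open>s\<close> outside the restricted boundary. If it does, {a,u}
      is crossed, so the edge that \<open>D\<close> omits is another one and is still
      omitted.\<close>
    have "bd E' (D - {u}) \<subset> s"
    proof (cases "a \<in> D \<longleftrightarrow> v \<in> D")
      case True
      then have "{a, u} \<notin> bd E D" "{a, v} \<notin> bd E' (D - {u})" using * bd_mem(1)[of D] bd'_mem[of D] by auto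
      then have "bd E' (D - {u}) = bd E D - {{a, u}, {u, v}}" using bd_suppress[of D] by simp
      then have "bd E' (D - {u}) \<subseteq> s - {{a, v}}" using D(3) by blast
      then show ?thesis using assms(2) by blast
    next
      case False
      then have "{a, u} \<in> bd E D" using * bd_mem(1)[of D] by auto
      moreover obtain e where e: "e \<in> insert {a, u} (s - {{a, v}})" "e \<notin> bd E D" using D(3) by blast
      ultimately have e': "e \<in> s" "e \<noteq> {a, v}" "e \<noteq> {a, u}" by auto
      then have "e \<notin> bd E' (D - {u})" using bd_other[of e D] e(2) notin(2) by metis
      moreover have "bd E' (D - {u}) - {{a, v}} \<subseteq> s" unfolding bd_suppress using D(3) by blast
      ultimately show ?thesis using e'(1) assms(2) by blast
    qed
    then show False using A(5)[OF nontrivial_restrict[OF D(1,2) *]] by simp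
  qed
qed

lemma mcut_down_without:
  assumes "mcut V E M" "{a, u} \<notin> M" "{u, v} \<notin> M" shows "mcut V' E' M"
proof -
  from assms(1) obtain A where A: "disjoint M" "A \<subset> V" "A \<noteq> {}" "M = bd E A"
    "\<And>C. C \<subset> V \<Longrightarrow> C \<noteq> {} \<Longrightarrow> \<not> bd E C \<subset> M" by (rule mcutE) blast
  have same: "u \<in> A \<longleftrightarrow> v \<in> A" "a \<in> A \<longleftrightarrow> v \<in> A" using assms(2,3) bd_mem(1,2)[of A] A(4) by blast+
  have "{a, v} \<notin> bd E' (A - {u})" using same bd'_mem[of A] by simp
  then have M: "M = bd E' (A - {u})" using bd_suppress[of A] assms(2,3) A(4) by simp
  show ?thesis
  proof (rule mcutI[OF A(1) nontrivial_restrict[OF A(2,3) same(1)] M])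
    fix C' assume C': "C' \<subset> V'" "C' \<noteq> {}" "bd E' C' \<subset> M"
    obtain C where C: "C \<subset> V" "C \<noteq> {}" "C - {u} = C'" "u \<in> C \<longleftrightarrow> v \<in> C"
      using nontrivial_extend[OF C'(1,2), of v] by blast
    have "{a, v} \<notin> M" using mcut_subset[OF assms(1)] av by blast
    then have "a \<in> C \<longleftrightarrow> v \<in> C" using bd'_mem[of C] C(3) C'(3) by blast
    then have "{a, u} \<notin> bd E C" "{u, v} \<notin> bd E C" using bd_mem(1,2)[of C] C(4) by auto
    then have "bd E C = bd E' C' - {{a, v}}" using bd_suppress[of C] C(3) by simp
    then have "bd E C \<subseteq> bd E' C'" by blast
    then show False using A(5)[OF C(1,2)] C'(3) by blast
  qed
qed

text \<open>This is where three edges are needed. The new edge {a,v} could meet an edge of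
  \<open>M\<close> only at \<open>v\<close>, that is, in {u,v} or \<open>g\<close>. The first is
  excluded by the matching property, the second by minimality.\<close>

lemma mcut_down_with:
  assumes "mcut V E M" "{a, u} \<in> M" "card M \<ge> 3"
    and deg_v: "\<And>e. e \<in> E \<Longrightarrow> v \<in> e \<Longrightarrow> e = {u, v} \<or> e = g"
  shows "mcut V' E' (insert {a, v} (M - {{a, u}}))"
proof -
  from assms(1) obtain A where A: "disjoint M" "A \<subset> V" "A \<noteq> {}" "M = bd E A"
    "\<And>C. C \<subset> V \<Longrightarrow> C \<noteq> {} \<Longrightarrow> \<not> bd E C \<subset> M" by (rule mcutE) blast
  have uvM: "{u, v} \<notin> M"
    using A(1) assms(2) ne(3) unfolding disjoint_def by (metis Int_iff empty_iff insertCI)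
  have gM: "g \<notin> M"
  proof
    assume "g \<in> M"
    \<comment> \<open>The two vertices \<open>u\<close> and \<open>v\<close> are cut off by at most
      two edges, a cut strictly inside \<open>M\<close> if \<open>g\<close> were in
      \<open>M\<close>.\<close>
    have "bd E {u, v} \<subseteq> {{a, u}, g}"
    proof
      fix e assume "e \<in> bd E {u, v}"
      then have "e \<in> E" "u \<in> e \<or> v \<in> e" "e \<noteq> {u, v}" by (auto simp: bd_def)
      then show "e \<in> {{a, u}, g}" using deg_u[of e] deg_v[of e] by blast
    qed
    moreover have "card {{a, u}, g} \<le> 2" by (simp add: card_insert_if)
    then have "{{a, u}, g} \<noteq> M" using assms(3) by auto
    ultimately have "bd E {u, v} \<subset> M" using assms(2) \<open>g \<in> M\<close> by blast
    moreover have "{u, v} \<subset> V" using in_V ne a_v by blast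
    ultimately show False using A(5)[of "{u, v}"] by blast
  qed
  have same: "u \<in> A \<longleftrightarrow> v \<in> A" "a \<in> A \<longleftrightarrow> \<not> v \<in> A"
    using assms(2) uvM bd_mem(1,2)[of A] A(4) by blast+
  have avM: "{a, v} \<notin> M" using mcut_subset[OF assms(1)] av by blast
  have "{a, v} \<in> bd E' (A - {u})" using same bd'_mem[of A] by simp
  then have "insert {a, v} (bd E' (A - {u}) - {{a, v}}) = bd E' (A - {u})" by blast
  then have M: "insert {a, v} (M - {{a, u}}) = bd E' (A - {u})"
  proof -
    have "M - {{a, u}, {u, v}} = M - {{a, u}}" using uvM by blast
    then show ?thesis using \<open>insert {a, v} (bd E' (A - {u}) - {{a, v}}) = bd E' (A - {u})\<close> bd_suppress[of A] A(4)
      by simp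
  qed
  show ?thesis
  proof (rule mcutI[OF _ nontrivial_restrict[OF A(2,3) same(1)] M])
    have "e \<inter> {a, v} = {}" if "e \<in> M - {{a, u}}" for e
    proof -
      have "e \<inter> {a, u} = {}" using A(1) that assms(2) by (auto simp: disjoint_def)
      moreover have "v \<notin> e" using that mcut_subset[OF assms(1)] uvM gM deg_v[of e] by blast
      ultimately show ?thesis by blast
    qed
    then show "disjoint (insert {a, v} (M - {{a, u}}))"
      using A(1) unfolding disjoint_def by (metis Diff_iff Int_commute insert_iff)
    fix C' assume C': "C' \<subset> V'" "C' \<noteq> {}" "bd E' C' \<subset> insert {a, v} (M - {{a, u}})"
    obtain C where C: "C \<subset> V" "C \<noteq> {}" "C - {u} = C'" "u \<in> C \<longleftrightarrow> v \<in> C"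
      using nontrivial_extend[OF C'(1,2), of v] by blast
    have uvC: "{u, v} \<notin> bd E C" using bd_mem(2)[of C] C(4) by simp
    have "bd E C \<subset> M"
    proof (cases "a \<in> C \<longleftrightarrow> v \<in> C")
      case True
      then have "{a, u} \<notin> bd E C" using bd_mem(1)[of C] C(4) by simp
      then have "bd E C = bd E' C' - {{a, v}}" using bd_suppress[of C] C(3) uvC by simp
      then have "bd E C \<subseteq> M - {{a, u}}" using C'(3) by blast
      then show ?thesis using assms(2) by blast
    next
      case False
      then have *: "{a, v} \<in> bd E' C'" using bd'_mem[of C] C(3) by simp
      obtain e where e: "e \<in> insert {a, v} (M - {{a, u}})" "e \<notin> bd E' C'" using C'(3) by blast
      then have e': "e \<noteq> {a, v}" "e \<in> M" "e \<noteq> {a, u}" using * by auto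
      then have "e \<notin> bd E C" using bd_other[of e C] C(3) e(2) uvM by metis
      moreover have "bd E C - {{a, u}, {u, v}} \<subseteq> M" using C'(3) unfolding bd_suppress[symmetric] C(3) by blast
      ultimately show ?thesis using uvC assms(2) e'(2) by blast
    qed
    then show False using A(5)[OF C(1,2)] by blast
  qed
qed

end

text \<open>Reversing the path turns each statement about {a,u} into one about {u,v}.\<close>

lemma suppress_sym: "suppress V E a u v \<Longrightarrow> suppress V E v u a"
  unfolding suppress_def by (metis insert_commute)

context suppress
begin

lemma E'_sym: "suppress.E' E v u a = E'"
  unfolding E'_def suppress.E'_def[OF suppress_sym[OF suppress_axioms]]
  by (auto simp: insert_commute)

definition l where "l f = (if f = {a, v} then {{a, u}, {u, v}} else {f})"

text \<open>Upwards, either path edge may stand for {a,v}. Downwards, the path edge \<open>x\<close>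
  contained in \<open>M\<close> is remembered by the choice \<open>c\<close>, which sends {a,v} back
  to \<open>x\<close>. Both end vertices need degree at most two here, since \<open>x\<close> may
  lie at either end.\<close>

lemma suppress_lifts:
  assumes deg_a: "\<And>e. e \<in> E \<Longrightarrow> a \<in> e \<Longrightarrow> e = {a, u} \<or> e = h"
    and deg_v: "\<And>e. e \<in> E \<Longrightarrow> v \<in> e \<Longrightarrow> e = {u, v} \<or> e = g"
  shows "lifts (sols V E) l E' (sols V' E')"
  unfolding lifts_def
proof (intro conjI ballI impI)
  interpret sym: suppress V E v u a by (rule suppress_sym) (rule suppress_axioms)
  show "disjoint_family_on l E'"
    unfolding disjoint_family_on_def l_def using ne by (auto simp: E'_def)
  fix s assume "s \<in> sols V' E'"
  then have s: "mcut V' E' s" using simple' by (simp add: sols_iff)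
  then show "s \<subseteq> E'" by (rule mcut_subset)
  fix c assume c: "c \<in> Pi s l"
  have id: "c f = f" if "f \<in> s" "f \<noteq> {a, v}" for f using Pi_mem[OF c that(1)] that(2) by (simp add: l_def)
  show "c ` s \<in> sols V E"
  proof (cases "{a, v} \<in> s")
    case False
    then have "c ` s = s" using id by (metis image_cong image_ident)
    then show ?thesis using mcut_up_without[OF s False] simple by (simp add: sols_iff)
  next
    case True
    have "c ` (s - {{a, v}}) = id ` (s - {{a, v}})" by (rule image_cong) (use id in auto)
    moreover have "c ` s = insert (c {a, v}) (c ` (s - {{a, v}}))" using True by blast
    ultimately have cs: "c ` s = insert (c {a, v}) (s - {{a, v}})" by simp
    have "c {a, v} = {a, u} \<or> c {a, v} = {u, v}" using Pi_mem[OF c True] by (simp add: l_def)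
    then have "mcut V E (insert (c {a, v}) (s - {{a, v}}))"
    proof
      assume "c {a, v} = {a, u}"
      then show ?thesis using mcut_up_with[OF s True] by simp
    next
      assume "c {a, v} = {u, v}"
      moreover have "{v, a} \<in> s" using True by (simp add: insert_commute)
      ultimately show ?thesis using sym.mcut_up_with[unfolded E'_sym, OF s]
        by (simp add: insert_commute)
    qed
    then show ?thesis using cs simple by (simp add: sols_iff)
  qed
next
  interpret sym: suppress V E v u a by (rule suppress_sym) (rule suppress_axioms)
  fix M assume M: "M \<in> sols V E" "3 \<le> card M"
  then have mM: "mcut V E M" using simple by (simp add: sols_iff)
  have avM: "{a, v} \<notin> M" using mcut_subset[OF mM] av by blast
  show "\<exists>s\<in>sols V' E'. \<exists>c\<in>Pi s l. M = c ` s"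
  proof (cases "{a, u} \<in> M \<or> {u, v} \<in> M")
    case False
    then have "M \<in> sols V' E'" using mcut_down_without[OF mM] simple' by (simp add: sols_iff)
    moreover have "id \<in> Pi M l" using avM by (auto simp: l_def)
    ultimately show ?thesis by (metis image_id id_apply)
  next
    case True
    then obtain x where x: "x \<in> M" "x \<in> {{a, u}, {u, v}}" by blast
    have m: "mcut V' E' (insert {a, v} (M - {x}))"
    proof (cases "x = {a, u}")
      case True
      then show ?thesis using mcut_down_with[OF mM _ M(2) deg_v] x by blast
    next
      case False
      then have "x = {v, u}" using x by (auto simp: insert_commute)
      moreover have "mcut V' E' (insert {v, a} (M - {{v, u}}))"
      proof (rule sym.mcut_down_with[unfolded E'_sym, OF mM _ M(2)])
        show "{v, u} \<in> M" using x \<open>x = {v, u}\<close> by simp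
        show "e = {u, a} \<or> e = h" if "e \<in> E" "a \<in> e" for e
          using deg_a[OF that] by (auto simp: insert_commute)
      qed
      ultimately show ?thesis by (simp add: insert_commute)
    qed
    define c where "c f = (if f = {a, v} then x else f)" for f
    have "c \<in> Pi (insert {a, v} (M - {x})) l" using x(2) by (auto simp: c_def l_def)
    moreover have "c ` (M - {x}) = id ` (M - {x})" by (rule image_cong) (use avM in \<open>auto simp: c_def\<close>)
    then have "c ` insert {a, v} (M - {x}) = M" using x(1) by (auto simp: c_def)
    moreover have "insert {a, v} (M - {x}) \<in> sols V' E'" using m simple' by (simp add: sols_iff)
    ultimately show ?thesis by metis
  qed
qed

end

section \<open>Forests and connectedness\<close>

lemma connectedD: "\<not> disconnected V E \<Longrightarrow> A \<subseteq> V \<Longrightarrow> A \<noteq> {} \<Longrightarrow> bd E A = {} \<Longrightarrow> A = V"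
  by (auto simp: disconnected_def psubset_eq)

lemma bd_closed:
  assumes "bd E A = {}" "{x, y} \<in> E" shows "x \<in> A \<longleftrightarrow> y \<in> A"
proof -
  have "{x, y} \<notin> bd E A" using assms(1) by simp
  then show ?thesis using assms(2) by (auto simp: bd_def)
qed

definition path :: "'a set set \<Rightarrow> 'a list \<Rightarrow> bool" where
  "path E vs \<longleftrightarrow> vs \<noteq> [] \<and> distinct vs \<and> (\<forall>i. Suc i < length vs \<longrightarrow> {vs ! i, vs ! Suc i} \<in> E)"

lemma path_extend:
  assumes "path E vs" "{last vs, y} \<in> E" "y \<notin> set vs" shows "path E (vs @ [y])"
  unfolding path_def
proof (intro conjI allI impI)
  fix i assume i: "Suc i < length (vs @ [y])"
  show "{(vs @ [y]) ! i, (vs @ [y]) ! Suc i} \<in> E"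
  proof (cases "Suc i < length vs")
    case True
    then show ?thesis using assms(1) by (simp add: path_def nth_append)
  next
    case False
    then have "Suc i = length vs" using i by simp
    then have "i = length vs - 1" "i < length vs" by simp_all
    then have "(vs @ [y]) ! i = last vs" using assms(1) by (simp add: path_def nth_append last_conv_nth)
    moreover have "(vs @ [y]) ! Suc i = y" using \<open>Suc i = length vs\<close> by simp
    ultimately show ?thesis using assms(2) by simp
  qed
qed (use assms in \<open>auto simp: path_def\<close>)

lemma path_take: "path E vs \<Longrightarrow> 0 < n \<Longrightarrow> path E (take n vs)"
  by (auto simp: path_def)

text \<open>Take the vertices reachable from \<open>u\<close> by paths without the edge {u,v}. If
  \<open>v\<close> were among them, such a path together with this edge would be a cycle.\<close>

lemma forest_edge_cut:
  assumes forest: "forest F" and uv: "{u, v} \<in> F" "u \<noteq> v" and card: "\<And>e. e \<in> F \<Longrightarrow> card e = 2"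
  shows "\<exists>A. u \<in> A \<and> v \<notin> A \<and> bd (F - {{u, v}}) A = {}"
proof -
  define F' where "F' = F - {{u, v}}"
  define A where "A = {w. \<exists>vs. path F' vs \<and> hd vs = u \<and> last vs = w}"
  have step: "y \<in> A" if x: "x \<in> A" and e: "{x, y} \<in> F'" for x y
  proof -
    obtain vs where vs: "path F' vs" "hd vs = u" "last vs = x" using x unfolding A_def by blast
    have "vs \<noteq> []" using vs(1) by (simp add: path_def)
    show ?thesis
    proof (cases "y \<in> set vs")
      case True
      then obtain i where i: "i < length vs" "vs ! i = y" by (auto simp: in_set_conv_nth)
      have "path F' (take (Suc i) vs)" using vs(1) by (simp add: path_take)
      moreover have "hd (take (Suc i) vs) = u" using vs(2) by simp
      moreover have "last (take (Suc i) vs) = y" using i by (simp add: take_Suc_conv_app_nth)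
      ultimately show ?thesis unfolding A_def by blast
    next
      case False
      then have "path F' (vs @ [y])" using path_extend[OF vs(1)] e vs(3) by simp
      moreover have "hd (vs @ [y]) = u" using vs(2) \<open>vs \<noteq> []\<close> by simp
      ultimately show ?thesis unfolding A_def by (intro CollectI exI[of _ "vs @ [y]"]) simp
    qed
  qed
  have "path F' [u]" by (simp add: path_def)
  then have "u \<in> A" unfolding A_def by (intro CollectI exI[of _ "[u]"]) simp
  moreover have "bd F' A = {}"
  proof (rule ccontr)
    assume "bd F' A \<noteq> {}"
    then obtain e where e: "e \<in> F'" "e \<inter> A \<noteq> {}" "\<not> e \<subseteq> A" by (auto simp: bd_def)
    then obtain p q where pq: "e = {p, q}" using card[of e] by (auto simp: F'_def card_2_iff)
    have "p \<in> A \<Longrightarrow> q \<in> A" "q \<in> A \<Longrightarrow> p \<in> A"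
      using step[of p q] step[of q p] e(1) pq by (auto simp: insert_commute)
    then show False using e(2,3) pq by blast
  qed
  moreover have "v \<notin> A"
  proof
    assume "v \<in> A"
    then obtain vs where vs: "path F' vs" "hd vs = u" "last vs = v" unfolding A_def by blast
    have ne: "vs \<noteq> []" using vs(1) by (simp add: path_def)
    have ends: "vs ! 0 = u" "vs ! (length vs - 1) = v" using vs ne by (auto simp: hd_conv_nth last_conv_nth)
    \<comment> \<open>A path with only two vertices would be the removed edge itself.\<close>
    have "length vs \<ge> 3"
    proof (rule ccontr)
      assume "\<not> length vs \<ge> 3"
      moreover have "length vs \<noteq> 0" using ne by simp
      ultimately consider "length vs = 1" | "length vs = 2" by linarith
      then show False
      proof cases
        case 1
        then show False using ends uv(2) by simp
      next
        case 2
        then have "{u, v} \<in> F'" using vs(1) ends by (auto simp: path_def)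
        then show False by (simp add: F'_def)
      qed
    qed
    moreover have "{vs ! i, vs ! (Suc i mod length vs)} \<in> F" if "i < length vs" for i
    proof (cases "Suc i < length vs")
      case True
      then show ?thesis using vs(1) by (auto simp: path_def F'_def)
    next
      case False
      then have "Suc i = length vs" using that by simp
      then have "vs ! i = v" "vs ! (Suc i mod length vs) = u" using ends by (auto simp flip: \<open>Suc i = length vs\<close>)
      then show ?thesis using uv(1) by (simp add: insert_commute)
    qed
    ultimately have "is_cycle F vs" using vs(1) by (simp add: is_cycle_def path_def)
    then show False using forest unfolding forest_def by blast
  qed
  ultimately show ?thesis unfolding F'_def by blast
qed

lemma forest_subset: "forest F \<Longrightarrow> F' \<subseteq> F \<Longrightarrow> forest F'"
  unfolding forest_def is_cycle_def by (meson subsetD)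

text \<open>Any edge of a forest is the only link between two nonempty vertex sets. Induction on
  both sides gives fewer than |V| edges in total, the linking edge included.\<close>

lemma forest_card:
  assumes "simple_graph V F" "forest F" "V \<noteq> {}" shows "card F < card V"
  using assms
proof (induction "card V" arbitrary: V F rule: less_induct)
  case less
  have fin: "finite V" "finite F" using simple_graph_finite[OF less.prems(1)] by auto
  show ?case
  proof (cases "F = {}")
    case True
    then show ?thesis using fin less.prems(3) by (simp add: card_gt_0_iff)
  next
    case False
    then obtain e where e: "e \<in> F" by blast
    obtain u v where uv: "e = {u, v}" "u \<noteq> v" "u \<in> V" "v \<in> V"
      by (rule simple_graph_edge[OF less.prems(1) e])
    have "\<exists>A. u \<in> A \<and> v \<notin> A \<and> bd (F - {{u, v}}) A = {}"
    proof (rule forest_edge_cut[OF less.prems(2)])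
      show "{u, v} \<in> F" using e uv by simp
      show "card e = 2" if "e \<in> F" for e using less.prems(1) that by (simp add: simple_graph_def)
    qed (fact uv(2))
    then obtain A where A: "u \<in> A" "v \<notin> A" "bd (F - {{u, v}}) A = {}" by blast
    define F1 where "F1 = {f \<in> F - {e}. f \<subseteq> V \<inter> A}"
    define F2 where "F2 = {f \<in> F - {e}. f \<subseteq> V - A}"
    have "f \<in> insert e (F1 \<union> F2)" if f: "f \<in> F" for f
    proof (cases "f = e")
      case False
      then have "f \<notin> bd (F - {{u, v}}) A" "f \<in> F - {{u, v}}" using A(3) uv f by auto
      then have "f \<subseteq> A \<or> f \<inter> A = {}" by (auto simp: bd_def)
      moreover have "f \<subseteq> V" using less.prems(1) f by (simp add: simple_graph_def)
      ultimately show ?thesis using False f by (auto simp: F1_def F2_def)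
    qed simp
    then have "F \<subseteq> insert e (F1 \<union> F2)" by blast
    then have "card F \<le> card (insert e (F1 \<union> F2))" using fin by (intro card_mono) (auto simp: F1_def F2_def)
    also have "\<dots> \<le> Suc (card (F1 \<union> F2))" using fin by (simp add: card_insert_if F1_def F2_def)
    also have "\<dots> \<le> Suc (card F1 + card F2)" using card_Un_le by simp
    finally have le: "card F \<le> Suc (card F1 + card F2)" .
    have cV: "card V = card (V \<inter> A) + card (V - A)" using fin(1) by (metis card_Int_Diff)
    have pos: "card (V \<inter> A) > 0" "card (V - A) > 0" using fin(1) A uv by (auto simp: card_gt_0_iff)
    have "card F1 < card (V \<inter> A)"
    proof (rule less.hyps)
      show "simple_graph (V \<inter> A) F1" using less.prems(1) by (auto simp: simple_graph_def F1_def)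
      show "forest F1" by (rule forest_subset[OF less.prems(2)]) (auto simp: F1_def)
    qed (use cV pos A uv in auto)
    moreover have "card F2 < card (V - A)"
    proof (rule less.hyps)
      show "simple_graph (V - A) F2" using less.prems(1) by (auto simp: simple_graph_def F2_def)
      show "forest F2" by (rule forest_subset[OF less.prems(2)]) (auto simp: F2_def)
    qed (use cV pos A uv in auto)
    ultimately show ?thesis using le cV by linarith
  qed
qed

text \<open>Grow a vertex set one vertex at a time: as long as it is not all of \<open>V\<close>,
  some edge leaves it, and the vertex reached brings this edge into the set.\<close>

lemma connected_card:
  assumes simple: "simple_graph V E" and conn: "\<not> disconnected V E" and "V \<noteq> {}"
  shows "card V \<le> card E + 1"
proof -
  have fin: "finite V" "finite E" using simple_graph_finite[OF simple] by auto
  have "\<exists>A\<subseteq>V. card A = Suc n \<and> n \<le> card {e \<in> E. e \<subseteq> A}" if "n < card V" for n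
    using that
  proof (induction n)
    case 0
    obtain x where "x \<in> V" using assms(3) by blast
    then show ?case by (intro exI[of _ "{x}"]) auto
  next
    case (Suc n)
    then obtain A where A: "A \<subseteq> V" "card A = Suc n" "n \<le> card {e \<in> E. e \<subseteq> A}" by auto
    have "A \<noteq> {}" "A \<noteq> V" using A(2) Suc.prems by auto
    then have "bd E A \<noteq> {}" using connectedD[OF conn A(1)] by blast
    then obtain e where e: "e \<in> E" "e \<inter> A \<noteq> {}" "\<not> e \<subseteq> A" by (auto simp: bd_def)
    obtain x y where xy: "e = {x, y}" "x \<in> V" "y \<in> V" by (rule simple_graph_edge[OF simple e(1)])
    obtain z where z: "z \<in> V" "z \<notin> A" "e \<subseteq> insert z A" using e xy by blast
    have "finite A" using A(1) fin(1) by (rule finite_subset)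
    then have "card (insert z A) = Suc (Suc n)" using z A(2) by simp
    moreover have "insert e {e \<in> E. e \<subseteq> A} \<subseteq> {e \<in> E. e \<subseteq> insert z A}" using e z by blast
    then have "card (insert e {e \<in> E. e \<subseteq> A}) \<le> card {e \<in> E. e \<subseteq> insert z A}" using fin by (intro card_mono) auto
    then have "Suc n \<le> card {e \<in> E. e \<subseteq> insert z A}" using A(3) e fin by (simp add: card_insert_if)
    ultimately show ?case using A(1) z(1) by (intro exI[of _ "insert z A"]) auto
  qed
  from this[of "card V - 1"] obtain A where A: "card A = Suc (card V - 1)" "card V - 1 \<le> card {e \<in> E. e \<subseteq> A}"
    using assms(3) fin(1) by (auto simp: card_gt_0_iff)
  have "card {e \<in> E. e \<subseteq> A} \<le> card E" using fin by (intro card_mono) auto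
  then show ?thesis using A(2) by simp
qed

text \<open>After deleting the edge between positions 0 and 1, the rest of the cycle still joins its
  two ends. So a set closed under the remaining edges is closed under the deleted one.\<close>

lemma connected_cycle_edge:
  assumes "\<not> disconnected V T" "is_cycle T vs"
  shows "\<exists>e\<in>T. \<not> disconnected V (T - {e})"
proof -
  let ?n = "length vs"
  define e where "e = {vs ! 0, vs ! 1}"
  have n: "?n \<ge> 3" and dist: "distinct vs" and edge: "\<And>i. i < ?n \<Longrightarrow> {vs ! i, vs ! (Suc i mod ?n)} \<in> T"
    using assms(2) by (auto simp: is_cycle_def)
  have eT: "e \<in> T"
  proof -
    have "0 < ?n" "Suc 0 mod ?n = 1" using n by auto
    then show ?thesis using edge[of 0] by (simp add: e_def)
  qed
  have "\<not> disconnected V (T - {e})"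
  proof
    assume "disconnected V (T - {e})"
    then obtain A where A: "A \<subset> V" "A \<noteq> {}" "bd (T - {e}) A = {}" by (auto simp: disconnected_def)
    \<comment> \<open>Only the step from position 0 uses the deleted edge. Starting at position 1
      and wrapping around at the end therefore reaches position 0 along surviving edges.\<close>
    have nxt: "vs ! i \<in> A \<longleftrightarrow> vs ! (Suc i mod ?n) \<in> A" if i: "1 \<le> i" "i < ?n" for i
    proof (rule bd_closed[OF A(3)])
      have idx: "vs ! j = vs ! k \<longleftrightarrow> j = k" if "j < ?n" "k < ?n" for j k
        using dist that by (simp add: nth_eq_iff_index_eq)
      have "{vs ! i, vs ! (Suc i mod ?n)} \<noteq> e"
      proof
        assume "{vs ! i, vs ! (Suc i mod ?n)} = e"
        moreover have "vs ! i \<noteq> vs ! 0" using idx[of i 0] i by linarith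
        ultimately have *: "vs ! i = vs ! 1" "vs ! (Suc i mod ?n) = vs ! 0"
          unfolding e_def doubleton_eq_iff by blast+
        have lt: "1 < ?n" "0 < ?n" "Suc i mod ?n < ?n" using n by (linarith, linarith, intro mod_less_divisor, linarith)
        have "i = 1" using *(1) idx[OF i(2) lt(1)] by blast
        moreover have "Suc i mod ?n = 0" using *(2) idx[OF lt(3) lt(2)] by blast
        ultimately show False using n by simp
      qed
      then show "{vs ! i, vs ! (Suc i mod ?n)} \<in> T - {e}" using edge[OF i(2)] by simp
    qed
    have "vs ! 1 \<in> A \<longleftrightarrow> vs ! Suc j \<in> A" if "Suc j < ?n" for j
      using that
    proof (induction j)
      case (Suc j)
      then show ?case using nxt[of "Suc j"] by simp
    qed simp
    from this[of "?n - 2"] have "vs ! 1 \<in> A \<longleftrightarrow> vs ! (?n - 1) \<in> A" using n by (simp add: Suc_diff_Suc numeral_2_eq_2)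
    moreover have "vs ! (?n - 1) \<in> A \<longleftrightarrow> vs ! 0 \<in> A"
    proof -
      have "Suc (?n - 1) = ?n" using n by simp
      then have "Suc (?n - 1) mod ?n = 0" by (metis mod_self)
      then show ?thesis using nxt[of "?n - 1"] n by simp
    qed
    ultimately have "e \<notin> bd T A" by (auto simp: bd_def e_def)
    then have "bd T A = {}" using A(3) by (auto simp: bd_def)
    then show False using assms(1) A by (auto simp: disconnected_def)
  qed
  then show ?thesis using eT by blast
qed

lemma feedback_edge_number_eqI:
  assumes "feedback_edge_set E S" "card S = k" "\<And>S'. feedback_edge_set E S' \<Longrightarrow> k \<le> card S'"
  shows "feedback_edge_number E = k"
  unfolding feedback_edge_number_def by (rule Least_equality) (use assms in auto)

text \<open>What any feedback edge set leaves is a forest and has fewer than |V| edges, whereas a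
  connected \<open>T\<close> has at least |V| - 1. So no feedback edge set is smaller than the
  complement of a spanning tree.\<close>

lemma spanning_tree_feedback:
  assumes simple: "simple_graph V E" and T: "T \<subseteq> E" "forest T" "\<not> disconnected V T"
  shows "feedback_edge_set E (E - T)" "feedback_edge_number E = card (E - T)"
proof -
  have fin: "finite V" "finite E" using simple_graph_finite[OF simple] by auto
  have "E - (E - T) = T" using T(1) by blast
  then show fes: "feedback_edge_set E (E - T)" using T(2) by (simp add: feedback_edge_set_def)
  have "card (E - T) \<le> card S" if S: "feedback_edge_set E S" for S
  proof (cases "V = {}")
    case True
    then have "E = {}" using simple by (auto simp: simple_graph_def)
    then show ?thesis by simp
  next
    case False
    have "simple_graph V (E - S)" "simple_graph V T" using simple T(1) by (auto simp: simple_graph_def)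
    then have "card (E - S) < card V" "card V \<le> card T + 1"
      using forest_card[of V "E - S"] connected_card[of V T] S T False by (auto simp: feedback_edge_set_def)
    moreover have "card (E - S) = card E - card S" "card S \<le> card E" "card (E - T) = card E - card T" "card T \<le> card E"
      using S T fin by (auto simp: feedback_edge_set_def card_Diff_subset finite_subset card_mono)
    ultimately show ?thesis by linarith
  qed
  then show "feedback_edge_number E = card (E - T)"
    by (intro feedback_edge_number_eqI[OF fes]) auto
qed

section \<open>The size of an irreducible graph\<close>

definition incident :: "'a set set \<Rightarrow> 'a \<Rightarrow> 'a set set" where
  "incident E x = {e \<in> E. x \<in> e}"

lemma sum_incident:
  assumes "simple_graph V E" shows "(\<Sum>x\<in>V. card (incident E x)) = 2 * card E"
proof -
  have fin: "finite V" "finite E" using simple_graph_finite[OF assms] by auto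
  have "(\<Sum>x\<in>V. card (incident E x)) = (\<Sum>x\<in>V. \<Sum>e\<in>E. if x \<in> e then 1 else 0)"
    unfolding incident_def using fin by (simp add: sum.If_cases Int_def)
  also have "\<dots> = (\<Sum>e\<in>E. \<Sum>x\<in>V. if x \<in> e then 1 else 0)" by (rule sum.swap)
  also have "\<dots> = (\<Sum>e\<in>E. 2)"
  proof (rule sum.cong[OF refl])
    fix e assume "e \<in> E"
    then have "{x \<in> V. x \<in> e} = e" "card e = 2" using assms by (auto simp: simple_graph_def)
    then show "(\<Sum>x\<in>V. if x \<in> e then 1 else 0) = (2 :: nat)" using fin(1) by (simp add: sum.If_cases Int_def)
  qed
  finally show ?thesis by simp
qed

lemma degree_two_edges:
  assumes "simple_graph V E" "card (incident E u) = 2"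
  obtains a v where "a \<noteq> v" "a \<noteq> u" "v \<noteq> u" "incident E u = {{a, u}, {u, v}}"
proof -
  obtain e f where ef: "incident E u = {e, f}" "e \<noteq> f" using assms(2) by (auto simp: card_2_iff)
  have nb: "\<exists>a. a \<noteq> u \<and> e = {a, u}" if "e \<in> incident E u" for e
  proof -
    have e: "e \<in> E" "u \<in> e" using that by (auto simp: incident_def)
    obtain x y where "e = {x, y}" "x \<noteq> y" by (rule simple_graph_edge[OF assms(1) e(1)])
    then show ?thesis using e(2) by (auto simp: insert_commute)
  qed
  obtain a where "a \<noteq> u" "e = {a, u}" using nb[of e] ef by auto
  moreover obtain v where "v \<noteq> u" "f = {v, u}" using nb[of f] ef by auto
  ultimately show ?thesis using that[of a v] ef by (auto simp: insert_commute)
qed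

text \<open>If every vertex of degree two has a neighbour of larger degree, then \<open>D\<close> is
  no larger than the sum \<open>d\<close> of the degrees in \<open>B\<close>, and counting edge ends
  bounds everything by \<open>k\<close>. The summand 3 covers the exceptional triangle.\<close>

lemma irreducible_card:
  assumes simple: "simple_graph V E" and conn: "\<not> disconnected V E"
    and m: "card E + 1 \<le> card V + k"
    and deg: "\<And>x. x \<in> V \<Longrightarrow> 2 \<le> card (incident E x)"
    and irr: "\<And>a u v. suppress V E a u v \<Longrightarrow> \<not> (card (incident E a) = 2 \<and> card (incident E v) = 2)"
  shows "card V \<le> 8 * k + 3"
proof -
  have fin: "finite V" "finite E" using simple_graph_finite[OF simple] by auto
  define D where "D = {x \<in> V. card (incident E x) = 2}"
  define B where "B = V - D"
  have finDB: "finite D" "finite B" using fin by (auto simp: D_def B_def)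
  have in_V: "x \<in> V \<and> y \<in> V" if "{x, y} \<in> E" for x y using simple that by (auto simp: simple_graph_def)
  show ?thesis
  proof (cases "\<forall>u\<in>D. \<exists>b\<in>B. {u, b} \<in> E")
    \<comment> \<open>Here \<open>u\<close> and both its neighbours have degree two. Irreducibility
      forces the neighbours to be adjacent, so these three vertices use up all their edges among
      themselves and, by connectedness, are the whole graph.\<close>
    case False
    then obtain u where u: "u \<in> D" "\<And>b. {u, b} \<in> E \<Longrightarrow> b \<notin> B" by blast
    obtain a v where av: "a \<noteq> v" "a \<noteq> u" "v \<noteq> u" "incident E u = {{a, u}, {u, v}}"
      using degree_two_edges[OF simple] u(1) by (auto simp: D_def)
    have au: "{a, u} \<in> E" and uv: "{u, v} \<in> E" using av(4) by (auto simp: incident_def)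
    have D: "a \<in> D" "v \<in> D" using u(2)[of a] u(2)[of v] au uv in_V by (auto simp: B_def insert_commute)
    have edge: "{a, v} \<in> E"
    proof (rule ccontr)
      assume "{a, v} \<notin> E"
      moreover have "e = {a, u} \<or> e = {u, v}" if "e \<in> E" "u \<in> e" for e
        using av(4) that unfolding incident_def by blast
      ultimately have "suppress V E a u v" using simple au uv av(1) by (simp add: suppress_def)
      from irr[OF this] show False using D by (simp add: D_def)
    qed
    have pair: "incident E x = {e, f}" if "card (incident E x) = 2" "e \<noteq> f" "e \<in> incident E x" "f \<in> incident E x" for x e f
    proof -
      obtain p q where pq: "incident E x = {p, q}" using \<open>card (incident E x) = 2\<close> by (auto simp: card_2_iff)
      show ?thesis using that(2-4) unfolding pq by auto
    qed
    have ne: "{a, u} \<noteq> {a, v}" "{u, v} \<noteq> {a, v}" using av(1-3) by (auto simp: doubleton_eq_iff)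
    have inc_a: "incident E a = {{a, u}, {a, v}}"
      using D au edge by (intro pair ne) (auto simp: D_def incident_def)
    have inc_v: "incident E v = {{u, v}, {a, v}}"
      using D uv edge by (intro pair ne) (auto simp: D_def incident_def)
    have tri: "incident E x \<subseteq> {{a, u}, {u, v}, {a, v}}" if "x \<in> {a, u, v}" for x
    proof -
      from that consider "x = a" | "x = u" | "x = v" by blast
      then show ?thesis
      proof cases
        case 1 show ?thesis unfolding 1 inc_a by (intro insert_subsetI empty_subsetI) simp_all
      next
        case 2 show ?thesis unfolding 2 av(4) by (intro insert_subsetI empty_subsetI) simp_all
      next
        case 3 show ?thesis unfolding 3 inc_v by (intro insert_subsetI empty_subsetI) simp_all
      qed
    qed
    have "bd E {a, u, v} = {}"
    proof (rule ccontr)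
      assume "bd E {a, u, v} \<noteq> {}"
      then obtain e where e: "e \<in> E" "e \<inter> {a, u, v} \<noteq> {}" "\<not> e \<subseteq> {a, u, v}" by (auto simp: bd_def)
      then obtain x where x: "x \<in> e" "x \<in> {a, u, v}" by blast
      then have "e \<in> incident E x" using e(1) by (simp add: incident_def)
      then have "e \<in> {{a, u}, {u, v}, {a, v}}" using tri[OF x(2)] by (rule rev_subsetD)
      then show False using e(3) by blast
    qed
    moreover have "{a, u, v} \<subseteq> V" using au uv in_V by blast
    ultimately have "{a, u, v} = V" by (intro connectedD[OF conn]) simp_all
    moreover have "card {a, u, v} \<le> 3" by (simp add: card_insert_if)
    ultimately have "card V \<le> 3" by simp
    then show ?thesis by simp
  next
    case True
    define d where "d = (\<Sum>b\<in>B. card (incident E b))"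
    \<comment> \<open>Each vertex of \<open>D\<close> is charged to an edge end in
      \<open>B\<close>.\<close>
    have "D \<subseteq> (\<Union>b\<in>B. \<Union>e\<in>incident E b. e - {b})"
    proof
      fix x assume x: "x \<in> D"
      then obtain b where "b \<in> B" "{x, b} \<in> E" using True by blast
      moreover have "x \<noteq> b" using x \<open>b \<in> B\<close> by (auto simp: B_def)
      ultimately show "x \<in> (\<Union>b\<in>B. \<Union>e\<in>incident E b. e - {b})" by (force simp: incident_def)
    qed
    moreover have "e - {b} \<subseteq> V" if "e \<in> incident E b" for e b
      using that simple by (auto simp: incident_def simple_graph_def)
    then have "(\<Union>b\<in>B. \<Union>e\<in>incident E b. e - {b}) \<subseteq> V" by blast
    then have "finite (\<Union>b\<in>B. \<Union>e\<in>incident E b. e - {b})" using fin(1) by (rule finite_subset)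
    ultimately have "card D \<le> card (\<Union>b\<in>B. \<Union>e\<in>incident E b. e - {b})" by (intro card_mono)
    also have "\<dots> \<le> (\<Sum>b\<in>B. card (\<Union>e\<in>incident E b. e - {b}))" by (rule card_UN_le[OF finDB(2)])
    also have "\<dots> \<le> d" unfolding d_def
    proof (rule sum_mono)
      fix b assume "b \<in> B"
      have "finite (incident E b)" using fin by (simp add: incident_def)
      then have "card (\<Union>e\<in>incident E b. e - {b}) \<le> (\<Sum>e\<in>incident E b. card (e - {b}))" by (rule card_UN_le)
      also have "\<dots> = (\<Sum>e\<in>incident E b. 1)"
      proof (rule sum.cong[OF refl])
        fix e assume "e \<in> incident E b"
        then have "card e = 2" "b \<in> e" using simple by (auto simp: incident_def simple_graph_def)
        then show "card (e - {b}) = 1" by simp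
      qed
      finally show "card (\<Union>e\<in>incident E b. e - {b}) \<le> card (incident E b)" by simp
    qed
    finally have Dd: "card D \<le> d" .
    have "(\<Sum>x\<in>V. card (incident E x)) = (\<Sum>x\<in>D. card (incident E x)) + d"
      unfolding d_def B_def using fin(1) by (subst sum.subset_diff[of D V]) (auto simp: D_def add.commute)
    also have "(\<Sum>x\<in>D. card (incident E x)) = 2 * card D" by (simp add: D_def)
    finally have sum: "2 * card E = 2 * card D + d" using sum_incident[OF simple] by simp
    have cV: "card V = card D + card B" using fin(1) unfolding B_def
      by (subst card_Diff_subset) (auto simp: D_def card_mono)
    have "(\<Sum>b\<in>B. 3) \<le> d" unfolding d_def
    proof (rule sum_mono)
      fix b assume "b \<in> B"
      then show "3 \<le> card (incident E b)" using deg[of b] by (auto simp: B_def D_def)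
    qed
    then have "3 * card B \<le> d" by simp
    \<comment> \<open>From 2|E| = 2|D| + d and |E| < |V| + k follows d < 2|B| + 2k. With 3|B| <= d
      this gives |B| < 2k and d < 6k, and |D| <= d then yields |V| < 8k.\<close>
    then show ?thesis using Dd sum cV m by linarith
  qed
qed

section \<open>Renaming vertices\<close>

lemma inj_on_image_subset_iff: "inj_on r V \<Longrightarrow> A \<subseteq> V \<Longrightarrow> B \<subseteq> V \<Longrightarrow> r ` A \<subseteq> r ` B \<longleftrightarrow> A \<subseteq> B"
  unfolding inj_on_def by blast

lemma mcut_image:
  assumes inj: "inj_on r V" and E: "\<And>e. e \<in> E \<Longrightarrow> e \<subseteq> V" and M: "mcut V E M"
  shows "mcut (r ` V) ((`) r ` E) ((`) r ` M)"
proof -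
  have bd: "bd ((`) r ` E) (r ` C) = (`) r ` bd E C" if "C \<subseteq> V" for C
  proof -
    have "r ` e \<inter> r ` C \<noteq> {} \<and> \<not> r ` e \<subseteq> r ` C \<longleftrightarrow> e \<inter> C \<noteq> {} \<and> \<not> e \<subseteq> C" if "e \<in> E" for e
      using inj_on_image_Int[OF inj E[OF that] \<open>C \<subseteq> V\<close>] inj_on_image_subset_iff[OF inj E[OF that] \<open>C \<subseteq> V\<close>]
      by (metis image_is_empty)
    then show ?thesis by (auto simp: bd_def image_iff)
  qed
  from M obtain A where A: "disjoint M" "A \<subset> V" "A \<noteq> {}" "M = bd E A"
    "\<And>C. C \<subset> V \<Longrightarrow> C \<noteq> {} \<Longrightarrow> \<not> bd E C \<subset> M" by (rule mcutE) blast
  have ME: "M \<subseteq> E" by (rule mcut_subset[OF M])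
  show ?thesis
  proof (rule mcutI[of _ "r ` A"])
    show "disjoint ((`) r ` M)"
      unfolding disjoint_def
    proof (intro ballI impI)
      fix x y assume "x \<in> (`) r ` M" "y \<in> (`) r ` M" "x \<noteq> y"
      then obtain e f where ef: "e \<in> M" "f \<in> M" "x = r ` e" "y = r ` f" "e \<noteq> f" by blast
      then have "e \<inter> f = {}" using A(1) by (simp add: disjoint_def)
      moreover have "e \<subseteq> V" "f \<subseteq> V" using E ME ef by blast+
      ultimately show "x \<inter> y = {}" using inj_on_image_Int[OF inj, of e f] ef by simp
    qed
    show "r ` A \<subset> r ` V"
      using A(2) inj_on_image_subset_iff[OF inj, of V A] by blast
    show "r ` A \<noteq> {}" using A(3) by simp
    show "(`) r ` M = bd ((`) r ` E) (r ` A)" using bd[of A] A(2,4) by auto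
    fix C' assume C': "C' \<subset> r ` V" "C' \<noteq> {}" "bd ((`) r ` E) C' \<subset> (`) r ` M"
    then obtain C where C: "C \<subseteq> V" "C' = r ` C" by (meson psubset_imp_subset subset_imageE)
    have sub: "(`) r ` bd E C \<subset> (`) r ` M" using C' C bd[of C] by simp
    have injE: "inj_on ((`) r) E"
    proof (rule inj_onI)
      fix e f assume "e \<in> E" "f \<in> E" "r ` e = r ` f"
      then show "e = f" using inj_on_image_eq_iff[OF inj E E, of e f] by simp
    qed
    have "bd E C \<subseteq> E" by (auto simp: bd_def)
    then have "bd E C \<subseteq> M" using inj_on_image_subset_iff[OF injE _ ME] psubset_imp_subset[OF sub] by simp
    moreover have "bd E C \<noteq> M" using sub by (metis order_less_irrefl)
    ultimately have "bd E C \<subset> M" by (rule psubsetI)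
    moreover have "C \<subset> V" "C \<noteq> {}" using C C' by auto
    ultimately show False using A(5) by blast
  qed
qed

text \<open>A bijection of the vertices fits the same scheme with one-edge labels, so the final
  renumbering composes with the reductions by \<open>lifts_trans\<close>.\<close>

lemma renaming_lifts:
  assumes inj: "inj_on r V" and simple: "simple_graph V E"
  shows "simple_graph (r ` V) ((`) r ` E)"
    "lifts (sols V E) (\<lambda>f. {e \<in> E. r ` e = f}) ((`) r ` E) (sols (r ` V) ((`) r ` E))"
proof -
  have E: "e \<subseteq> V" "card e = 2" if "e \<in> E" for e using simple that by (auto simp: simple_graph_def)
  have "card (r ` e) = 2" if "e \<in> E" for e
    using E[OF that] inj card_image inj_on_subset by metis
  then show simple': "simple_graph (r ` V) ((`) r ` E)"
    using simple E by (auto simp: simple_graph_def)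
  \<comment> \<open>\<open>mcut_image\<close> is used in one direction only; the converse is the
    same lemma for the inverse renaming.\<close>
  define r' where "r' = inv_into V r"
  have inj': "inj_on r' (r ` V)" unfolding r'_def by (rule inj_on_inv_into) simp
  have r'r: "r' ` r ` X = X" if "X \<subseteq> V" for X
    using inv_into_image_cancel[OF inj that] by (simp add: r'_def)
  have r'rE: "(`) r' ` (`) r ` X = X" if "X \<subseteq> E" for X
  proof -
    have "(`) r' ` (`) r ` X = (\<lambda>e. r' ` r ` e) ` X" by (rule image_image)
    also have "\<dots> = id ` X"
    proof (rule image_cong[OF refl])
      fix e assume "e \<in> X"
      then have "e \<subseteq> V" using that E by blast
      then show "r' ` r ` e = id e" using r'r by simp
    qed
    finally show ?thesis by simp
  qed
  have down: "mcut V E M" if "mcut (r ` V) ((`) r ` E) ((`) r ` M)" "M \<subseteq> E" for M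
  proof -
    have "e \<subseteq> r ` V" if "e \<in> (`) r ` E" for e using that E by blast
    from mcut_image[OF inj' this that(1)] show ?thesis using r'r[of V] r'rE[of E] r'rE[OF that(2)] by simp
  qed
  show "lifts (sols V E) (\<lambda>f. {e \<in> E. r ` e = f}) ((`) r ` E) (sols (r ` V) ((`) r ` E))"
    unfolding lifts_def
  proof (intro conjI ballI impI)
    show "disjoint_family_on (\<lambda>f. {e \<in> E. r ` e = f}) ((`) r ` E)" by (auto simp: disjoint_family_on_def)
    fix s assume "s \<in> sols (r ` V) ((`) r ` E)"
    then have s: "mcut (r ` V) ((`) r ` E) s" using simple' by (simp add: sols_iff)
    then show "s \<subseteq> (`) r ` E" by (rule mcut_subset)
    fix c assume c: "c \<in> Pi s (\<lambda>f. {e \<in> E. r ` e = f})"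
    have "(`) r ` c ` s = id ` s" unfolding image_image by (rule image_cong) (use c in auto)
    moreover have "c ` s \<subseteq> E" using c by auto
    ultimately have "mcut V E (c ` s)" using down[of "c ` s"] s by simp
    then show "c ` s \<in> sols V E" using simple by (simp add: sols_iff)
  next
    fix M assume "M \<in> sols V E"
    then have M: "mcut V E M" using simple by (simp add: sols_iff)
    have "mcut (r ` V) ((`) r ` E) ((`) r ` M)" using mcut_image[OF inj E(1) M] .
    then have "(`) r ` M \<in> sols (r ` V) ((`) r ` E)" using simple' by (simp add: sols_iff)
    moreover have "r ` r' ` r ` e = r ` e \<and> r' ` r ` e \<in> E" if "e \<in> M" for e
      using r'r[of e] E that mcut_subset[OF M] by auto
    then have "(`) r' \<in> Pi ((`) r ` M) (\<lambda>f. {e \<in> E. r ` e = f})" by (intro Pi_I) blast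
    moreover have "M = (`) r' ` (`) r ` M" using r'rE[of M] mcut_subset[OF M] by simp
    ultimately show "\<exists>s\<in>sols (r ` V) ((`) r ` E). \<exists>c\<in>Pi s (\<lambda>f. {e \<in> E. r ` e = f}). M = c ` s"
      by (intro bexI[where x = "(`) r ` M"] bexI[where x = "(`) r'"])
  qed
qed

section \<open>Attaching a pendant edge\<close>

text \<open>The new bridge contributes exactly one solution, itself, and disturbs no other. This is
  the slot of the kernel to which the missed solutions are assigned.\<close>

lemma pendant_sols:
  assumes simple: "simple_graph V E" and conn: "\<not> disconnected V E" and vw: "w \<in> V" "v \<notin> V"
  shows "simple_graph (insert v V) (insert {v, w} E)"
    "sols (insert v V) (insert {v, w} E) = insert {{v, w}} (sols V E)"
    "\<not> disconnected (insert v V) (insert {v, w} E)"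
proof -
  let ?V = "insert v V" and ?E = "insert {v, w} E"
  have ne: "v \<noteq> w" using vw by blast
  show simple': "simple_graph ?V ?E"
    using simple vw ne unfolding simple_graph_def by auto
  have nE: "v \<notin> e" if "e \<in> E" for e using that simple vw(2) by (auto simp: simple_graph_def)
  then have notE: "{v, w} \<notin> E" by blast
  have leaf: "e = {v, w}" if "e \<in> ?E" "v \<in> e" for e using that nE by blast
  have VE: "?V - {v} = V" "?E - {{v, w}} = E" using vw notE by auto
  have iff: "mcut ?V ?E M \<and> {v, w} \<notin> M \<longleftrightarrow> mcut V E M" for M
    using leaf_mcut_iff[of v ?V w ?E M, OF _ _ ne _ leaf] vw VE by simp
  show conn': "\<not> disconnected ?V ?E"
    using iff[of "{}"] conn empty_mcut_iff by auto
  have "bd ?E {v} = {{v, w}}"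
  proof
    show "bd ?E {v} \<subseteq> {{v, w}}" using leaf by (fastforce simp: bd_def)
    show "{{v, w}} \<subseteq> bd ?E {v}" using ne by (simp add: bd_def)
  qed
  then have "mcut ?V ?E {{v, w}}"
  proof (intro mcutI[of _ "{v}"])
    show "{v} \<subset> ?V" using vw by blast
    show False if "C \<subset> ?V" "C \<noteq> {}" "bd ?E C \<subset> {{v, w}}" for C
    proof -
      have "bd ?E C = {}" using that(3) by blast
      then show False using connectedD[OF conn' psubset_imp_subset[OF that(1)] that(2)] that(1) by simp
    qed
  qed (simp_all add: disjoint_def)
  moreover have "M = {{v, w}}" if "mcut ?V ?E M" "{v, w} \<in> M" for M
    using leaf_edge_mcut[of v ?V w ?E M, OF _ _ ne _ leaf] that vw by blast
  ultimately have "mcut ?V ?E M \<longleftrightarrow> M = {{v, w}} \<or> mcut V E M" for M using iff by metis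
  then show "sols ?V ?E = insert {{v, w}} (sols V E)"
    using sols_iff[OF simple] sols_iff[OF simple'] by auto
qed

section \<open>Encoding typed data as trees\<close>

lemma poly_nat_mono: "x \<le> y \<Longrightarrow> poly (p :: nat poly) x \<le> poly p y"
  by (induction p) (auto intro!: add_mono mult_mono)

text \<open>A single overloaded encoding lets running times be stated for HOL functions on typed
  data. Injectivity makes the tree comparison \<open>Eq\<close> decide equality of the encoded
  values. On numbers and lists it agrees with \<open>enc_nat\<close> and
  \<open>enc_list\<close>.\<close>

class encodable =
  fixes enc :: "'a \<Rightarrow> tree"
  assumes enc_inject: "enc x = enc y \<Longrightarrow> x = y"

instantiation tree :: encodable begin
definition enc_tree :: "tree \<Rightarrow> tree" where "enc_tree t = t"
instance by standard (simp add: enc_tree_def)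
end

instantiation unit :: encodable begin
definition enc_unit :: "unit \<Rightarrow> tree" where "enc_unit u = Leaf"
instance by standard simp
end

text \<open>These codes are the values returned by \<open>Eq\<close> and tested by \<open>If\<close>
  and \<open>While\<close>.\<close>

instantiation bool :: encodable begin
definition enc_bool :: "bool \<Rightarrow> tree" where "enc_bool b = (if b then Node Leaf Leaf else Leaf)"
instance by standard (auto simp: enc_bool_def split: if_splits)
end

instantiation nat :: encodable begin
definition enc_nat' : "enc = enc_nat"
instance
proof
  show "enc x = enc y \<Longrightarrow> x = y" for x y :: nat
    unfolding enc_nat'
  proof (induction x arbitrary: y)
    case 0 then show ?case by (cases y) auto
  next
    case (Suc x) then show ?case by (cases y) auto
  qed
qed
end

instantiation prod :: (encodable, encodable) encodable begin
definition enc_prod :: "'a \<times> 'b \<Rightarrow> tree" where "enc_prod p = Node (enc (fst p)) (enc (snd p))"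
instance by standard (auto simp: enc_prod_def prod_eq_iff dest: enc_inject)
end

instantiation list :: (encodable) encodable begin
definition enc_list' : "enc = enc_list enc"
instance
proof
  show "enc x = enc y \<Longrightarrow> x = y" for x y :: "'a list"
    unfolding enc_list'
  proof (induction x arbitrary: y)
    case Nil then show ?case by (cases y) auto
  next
    case (Cons a x) then show ?case by (cases y) (auto dest: enc_inject)
  qed
qed
end

lemma enc_eq_iff [simp]: "enc x = enc y \<longleftrightarrow> x = y"
  using enc_inject by blast

lemma enc_simps [simp]:
  "enc (0 :: nat) = Leaf" "enc (Suc n) = Node Leaf (enc n)"
  "enc (a, b) = Node (enc a) (enc b)"
  "enc ([] :: 'a :: encodable list) = Leaf" "enc (x # xs) = Node (enc x) (enc xs)"
  "enc True = Node Leaf Leaf" "enc False = Leaf" "enc () = Leaf" "enc (t :: tree) = t"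
  by (auto simp: enc_nat' enc_prod_def enc_list' enc_bool_def enc_unit_def enc_tree_def)

lemma size_enc_prod: "size (enc p) = size (enc (fst p)) + size (enc (snd p)) + 1"
  by (cases p) simp

lemma enc_pair_unfold: "enc p = Node (enc (fst p)) (enc (snd p))"
  by (cases p) simp

abbreviation esize :: "'a :: encodable \<Rightarrow> nat" where "esize x \<equiv> size (enc x)"

lemma esize_nat [simp]: "esize (n :: nat) = n"
  by (induction n) auto

lemma esize_append: "esize (xs @ ys) = esize xs + esize ys"
  by (induction xs) auto

lemma esize_rev: "esize (rev xs) = esize xs"
  by (induction xs) (auto simp: esize_append)

lemma length_le_esize: "length xs \<le> esize xs"
  by (induction xs) auto

lemma esize_mem: "x \<in> set xs \<Longrightarrow> esize x < esize xs"
  by (induction xs) auto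

lemma esize_filter: "esize (filter P xs) \<le> esize xs"
  by (induction xs) auto

lemma esize_list_le:
  assumes "\<And>x. x \<in> set xs \<Longrightarrow> esize x \<le> b" shows "esize xs \<le> length xs * (b + 1)"
  using assms
proof (induction xs)
  case (Cons x xs)
  have "esize x \<le> b" "esize xs \<le> length xs * (b + 1)" using Cons by auto
  then show ?case by simp
qed auto

section \<open>Silent polynomial-time programs\<close>

text \<open>
  The program works in the variables below \<open>N\<close>, with input and output in variable 0. So a caller
  can keep values in the variables from \<open>N\<close> on, and no renaming of variables is needed.
\<close>

definition silent :: "com \<Rightarrow> nat \<Rightarrow> state \<Rightarrow> tree \<Rightarrow> nat \<Rightarrow> bool" where
  "silent c N \<sigma> r b \<longleftrightarrow> (\<exists>t \<sigma>'. exec c \<sigma> (replicate t None) \<sigma>' \<and> \<sigma>' 0 = r \<and> (\<forall>i\<ge>N. \<sigma>' i = \<sigma> i) \<and> t \<le> b)"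

text \<open>Time alone does not bound the output: pairing a variable with itself is a constant-time
  step that doubles the tree. Since the time of the next program is measured in its input size, the
  size bound is what makes composition work.\<close>

definition polytime_by :: "com \<Rightarrow> nat \<Rightarrow> nat poly \<Rightarrow> ('a :: encodable \<Rightarrow> 'b :: encodable) \<Rightarrow> bool" where
  "polytime_by c N p f \<longleftrightarrow> (\<forall>x \<sigma>. \<sigma> 0 = enc x \<longrightarrow>
     silent c N \<sigma> (enc (f x)) (poly p (esize x)) \<and> esize (f x) \<le> poly p (esize x))"

definition pt :: "('a :: encodable \<Rightarrow> 'b :: encodable) \<Rightarrow> bool" where
  "pt f \<longleftrightarrow> (\<exists>c N p. polytime_by c N p f)"

lemma exec_Seq_silent:
  "exec c \<sigma> (replicate t None) \<sigma>' \<Longrightarrow> exec d \<sigma>' (replicate u None) \<sigma>'' \<Longrightarrow>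
    exec (Seq c d) \<sigma> (replicate (t + u) None) \<sigma>''"
  by (metis exec.Seq replicate_add)

lemma polytime_byE:
  assumes "polytime_by c N p f" "\<sigma> 0 = enc x"
  obtains t \<sigma>' where "exec c \<sigma> (replicate t None) \<sigma>'" "\<sigma>' 0 = enc (f x)"
    "\<And>i. N \<le> i \<Longrightarrow> \<sigma>' i = \<sigma> i" "t \<le> poly p (esize x)"
  using assms unfolding polytime_by_def silent_def by blast

lemma polytime_by_esize: "polytime_by c N p f \<Longrightarrow> esize (f x) \<le> poly p (esize x)"
  unfolding polytime_by_def by (metis fun_upd_same)

lemma polytime_byI:
  assumes "\<And>x \<sigma>. \<sigma> 0 = enc x \<Longrightarrow> \<exists>t \<sigma>'. exec c \<sigma> (replicate t None) \<sigma>' \<and> \<sigma>' 0 = enc (f x) \<and>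
    (\<forall>i\<ge>N. \<sigma>' i = \<sigma> i) \<and> t \<le> poly p (esize x)"
    and "\<And>x. esize (f x) \<le> poly p (esize x)"
  shows "polytime_by c N p f"
  using assms unfolding polytime_by_def silent_def by blast

lemma pt_esize:
  assumes "pt f" obtains p :: "nat poly" where "\<And>x. esize (f x) \<le> poly p (esize x)"
  using assms polytime_by_esize unfolding pt_def by metis

lemma polytime_by_mono: "polytime_by c N p f \<Longrightarrow> N \<le> N' \<Longrightarrow> polytime_by c N' p f"
  unfolding polytime_by_def silent_def by (meson order_trans)

lemma pt_assign:
  fixes f :: "'a :: encodable \<Rightarrow> 'b :: encodable"
  assumes "\<And>x \<sigma>. \<sigma> 0 = enc x \<Longrightarrow> eval e \<sigma> = enc (f x) \<and> cost e \<sigma> \<le> poly p (esize x)"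
    and "\<And>x. esize (f x) \<le> poly p (esize x)"
  shows "pt f"
  unfolding pt_def
proof (intro exI, rule polytime_byI)
  fix x :: 'a and \<sigma> :: state assume "\<sigma> 0 = enc x"
  with assms(1) show "\<exists>t \<sigma>'. exec (Assign 0 e) \<sigma> (replicate t None) \<sigma>' \<and> \<sigma>' 0 = enc (f x) \<and>
      (\<forall>i\<ge>1. \<sigma>' i = \<sigma> i) \<and> t \<le> poly p (esize x)"
    by (intro exI[of _ "cost e \<sigma>"] exI[of _ "\<sigma>(0 := eval e \<sigma>)"] conjI exec.Assign) auto
qed (fact assms)

definition pconst :: "nat \<Rightarrow> nat poly" where "pconst n = [:n:]"
definition pvar :: "nat poly" where "pvar = [:0, 1:]"

lemma poly_const_var [simp]: "poly (pconst n) x = n" "poly pvar x = x"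
  by (auto simp: pconst_def pvar_def)

text \<open>Changing the type without changing the code costs nothing. In this way list construction
  is pairing and a number is a list of units.\<close>

lemma pt_cast:
  assumes "\<And>x. enc (f x) = enc x" shows "pt f"
  by (rule pt_assign[where e = "Var 0" and p = "pvar + 1"]) (auto simp: assms)

lemma pt_ident [intro]: "pt (\<lambda>x. x)" by (rule pt_cast) simp

fun tree_expr :: "tree \<Rightarrow> expr" where
  "tree_expr Leaf = Lf"
| "tree_expr (Node l r) = Pair (tree_expr l) (tree_expr r)"

lemma tree_expr: "eval (tree_expr t) \<sigma> = t \<and> cost (tree_expr t) \<sigma> = 2 * size t + 1"
  by (induction t) auto

lemma pt_const: "pt (\<lambda>x. c)"
  by (rule pt_assign[where e = "tree_expr (enc c)" and p = "pconst (2 * size (enc c) + 1)"]) (auto simp: tree_expr)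

lemma pt_comp:
  assumes f: "pt (f :: 'a :: encodable \<Rightarrow> _)" and g: "pt g" shows "pt (\<lambda>x. g (f x))"
proof -
  from f g obtain c N p d N' q where c: "polytime_by c N p f" and d: "polytime_by d N' q g"
    unfolding pt_def by blast
  show ?thesis unfolding pt_def
  proof (intro exI, rule polytime_byI)
    fix x :: 'a and \<sigma> :: state assume x: "\<sigma> 0 = enc x"
    from polytime_byE[OF c, of \<sigma> x, OF x] obtain t \<sigma>' where 1: "exec c \<sigma> (replicate t None) \<sigma>'" "\<sigma>' 0 = enc (f x)"
      "\<And>i. N \<le> i \<Longrightarrow> \<sigma>' i = \<sigma> i" "t \<le> poly p (esize x)" by blast
    from polytime_byE[OF d, of \<sigma>' "f x", OF 1(2)] obtain u \<sigma>'' where 2: "exec d \<sigma>' (replicate u None) \<sigma>''" "\<sigma>'' 0 = enc (g (f x))"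
      "\<And>i. N' \<le> i \<Longrightarrow> \<sigma>'' i = \<sigma>' i" "u \<le> poly q (esize (f x))" by blast
    have "poly q (esize (f x)) \<le> poly q (poly p (esize x))"
      by (intro poly_nat_mono polytime_by_esize[OF c])
    with 1 2 show "\<exists>t \<sigma>''. exec (Seq c d) \<sigma> (replicate t None) \<sigma>'' \<and> \<sigma>'' 0 = enc (g (f x)) \<and>
        (\<forall>i\<ge>max N N'. \<sigma>'' i = \<sigma> i) \<and> t \<le> poly (p + pcompose q p) (esize x)"
      by (intro exI[of _ "t + u"] exI[of _ \<sigma>'']) (auto intro: exec_Seq_silent simp: poly_pcompose)
  next
    fix x :: 'a
    have "esize (g (f x)) \<le> poly q (esize (f x))" by (rule polytime_by_esize[OF d])
    also have "\<dots> \<le> poly q (poly p (esize x))" by (intro poly_nat_mono polytime_by_esize[OF c])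
    finally show "esize (g (f x)) \<le> poly (p + pcompose q p) (esize x)" by (simp add: poly_pcompose)
  qed
qed

lemma exec_Assign': "cost e \<sigma> = t \<Longrightarrow> \<sigma>' = \<sigma>(i := eval e \<sigma>) \<Longrightarrow> exec (Assign i e) \<sigma> (replicate t None) \<sigma>'"
  by (auto intro: exec.Assign)

lemma pt_Pair:
  assumes f: "pt (f :: 'a :: encodable \<Rightarrow> _)" and g: "pt g" shows "pt (\<lambda>x. (f x, g x))"
proof -
  from f g obtain c N p d N' q where c: "polytime_by c N p f" and d: "polytime_by d N' q g"
    unfolding pt_def by blast
  \<comment> \<open>From \<open>m\<close> on, neither program touches a variable, so
    \<open>m\<close> and its successor can keep the input and the first result. The successor
    function keeps \<open>m\<close> different from 0, the input and output variable.\<close>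
  define m where "m = Suc (max N N')"
  have c: "polytime_by c m p f" and d: "polytime_by d m q g" and m: "0 < m"
    using c d by (auto elim!: polytime_by_mono simp: m_def)
  let ?prog = "Seq (Assign m (Var 0)) (Seq c (Seq (Assign (Suc m) (Var 0)) (Seq (Assign 0 (Var m))
    (Seq d (Assign 0 (Pair (Var (Suc m)) (Var 0)))))))"
  show ?thesis unfolding pt_def
  proof (intro exI, rule polytime_byI)
    fix x :: 'a and \<sigma> :: state assume x: "\<sigma> 0 = enc x"
    define \<sigma>1 where "\<sigma>1 = \<sigma>(m := enc x)"
    have e1: "exec (Assign m (Var 0)) \<sigma> (replicate 1 None) \<sigma>1"
      by (rule exec_Assign') (auto simp: \<sigma>1_def x)
    have s1: "\<sigma>1 0 = enc x" using x m by (auto simp: \<sigma>1_def)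
    from polytime_byE[OF c, of \<sigma>1 x, OF s1] obtain t \<sigma>2 where 2: "exec c \<sigma>1 (replicate t None) \<sigma>2" "\<sigma>2 0 = enc (f x)"
      "\<And>i. m \<le> i \<Longrightarrow> \<sigma>2 i = \<sigma>1 i" "t \<le> poly p (esize x)" by blast
    define \<sigma>3 where "\<sigma>3 = \<sigma>2(Suc m := enc (f x))"
    have e3: "exec (Assign (Suc m) (Var 0)) \<sigma>2 (replicate 1 None) \<sigma>3"
      by (rule exec_Assign') (auto simp: \<sigma>3_def 2)
    define \<sigma>4 where "\<sigma>4 = \<sigma>3(0 := enc x)"
    have e4: "exec (Assign 0 (Var m)) \<sigma>3 (replicate 1 None) \<sigma>4"
      by (rule exec_Assign') (auto simp: \<sigma>4_def \<sigma>3_def 2 \<sigma>1_def)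
    have s4: "\<sigma>4 0 = enc x" by (simp add: \<sigma>4_def)
    from polytime_byE[OF d, of \<sigma>4 x, OF s4] obtain u \<sigma>5 where 5: "exec d \<sigma>4 (replicate u None) \<sigma>5" "\<sigma>5 0 = enc (g x)"
      "\<And>i. m \<le> i \<Longrightarrow> \<sigma>5 i = \<sigma>4 i" "u \<le> poly q (esize x)" by blast
    define \<sigma>6 where "\<sigma>6 = \<sigma>5(0 := enc (f x, g x))"
    have "\<sigma>5 (Suc m) = enc (f x)" using 5 m by (simp add: \<sigma>4_def \<sigma>3_def)
    then have e6: "exec (Assign 0 (Pair (Var (Suc m)) (Var 0))) \<sigma>5 (replicate 3 None) \<sigma>6"
      by (intro exec_Assign') (auto simp: \<sigma>6_def 5)
    have "exec ?prog \<sigma> (replicate (1 + (t + (1 + (1 + (u + 3))))) None) \<sigma>6"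
      by (intro exec_Seq_silent) fact+
    also have "1 + (t + (1 + (1 + (u + 3)))) = 6 + (t + u)" by simp
    finally have "exec ?prog \<sigma> (replicate (6 + (t + u)) None) \<sigma>6" .
    moreover have "\<forall>i\<ge>Suc (Suc m). \<sigma>6 i = \<sigma> i"
      using 2 5 by (auto simp: \<sigma>6_def \<sigma>4_def \<sigma>3_def \<sigma>1_def)
    ultimately show "\<exists>t \<sigma>'. exec ?prog \<sigma> (replicate t None) \<sigma>' \<and> \<sigma>' 0 = enc (f x, g x) \<and>
        (\<forall>i\<ge>Suc (Suc m). \<sigma>' i = \<sigma> i) \<and> t \<le> poly (p + q + pconst 6) (esize x)"
      using 2(4) 5(4) by (intro exI[of _ "6 + (t + u)"] exI[of _ \<sigma>6] conjI) (auto simp: \<sigma>6_def)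
  next
    fix x :: 'a
    show "esize (f x, g x) \<le> poly (p + q + pconst 6) (esize x)"
      using polytime_by_esize[OF c, of x] polytime_by_esize[OF d, of x] by simp
  qed
qed

lemma pt_fst: "pt f \<Longrightarrow> pt (\<lambda>x. fst (f x))"
  by (rule pt_comp[where g = fst], assumption,
      rule pt_assign[where e = "Hd (Var 0)" and p = "pvar + pconst 2"]) (auto simp: enc_pair_unfold)

lemma pt_snd: "pt f \<Longrightarrow> pt (\<lambda>x. snd (f x))"
  by (rule pt_comp[where g = snd], assumption,
      rule pt_assign[where e = "Tl (Var 0)" and p = "pvar + pconst 2"]) (auto simp: enc_pair_unfold)

lemma pt_apply2:
  assumes "pt (\<lambda>p. h (fst p) (snd p))" "pt f" "pt g" shows "pt (\<lambda>x. h (f x) (g x))"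
  using pt_comp[OF pt_Pair[OF assms(2,3)] assms(1)] by simp

lemma pt_eq: "pt f \<Longrightarrow> pt g \<Longrightarrow> pt (\<lambda>x. f x = g x)"
  by (rule pt_apply2[where h = "(=)"],
      rule pt_assign[where e = "Eq (Hd (Var 0)) (Tl (Var 0))" and p = "pvar + pconst 6"])
     (auto simp: enc_pair_unfold enc_bool_def)

lemma pt_Cons: "pt f \<Longrightarrow> pt g \<Longrightarrow> pt (\<lambda>x. f x # g x)"
  by (rule pt_apply2[where h = "(#)"], rule pt_cast) (auto simp: enc_pair_unfold)

lemma pt_Suc: "pt f \<Longrightarrow> pt (\<lambda>x. Suc (f x))"
  by (rule pt_comp[where g = Suc], assumption,
      rule pt_assign[where e = "Pair Lf (Var 0)" and p = "pvar + pconst 3"]) auto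

lemma pt_if:
  assumes P: "pt (P :: 'a :: encodable \<Rightarrow> _)" and f: "pt f" and g: "pt g" shows "pt (\<lambda>x. if P x then f x else g x)"
proof -
  from P f g obtain b Nb r c N p d N' q where b: "polytime_by b Nb r P" and
    c: "polytime_by c N p f" and d: "polytime_by d N' q g"
    unfolding pt_def by blast
  define m where "m = Suc (max Nb (max N N'))"
  have b: "polytime_by b m r P" and c: "polytime_by c m p f" and d: "polytime_by d m q g" and m: "0 < m"
    using b c d by (auto elim!: polytime_by_mono simp: m_def)
  let ?prog = "Seq (Assign m (Var 0)) (Seq b (If (Var 0) (Seq (Assign 0 (Var m)) c) (Seq (Assign 0 (Var m)) d)))"
  show ?thesis unfolding pt_def
  proof (intro exI, rule polytime_byI)
    fix x :: 'a and \<sigma> :: state assume x: "\<sigma> 0 = enc x"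
    define \<sigma>1 where "\<sigma>1 = \<sigma>(m := enc x)"
    have e1: "exec (Assign m (Var 0)) \<sigma> (replicate 1 None) \<sigma>1"
      by (rule exec_Assign') (auto simp: \<sigma>1_def x)
    have s1: "\<sigma>1 0 = enc x" using x m by (auto simp: \<sigma>1_def)
    from polytime_byE[OF b, of \<sigma>1 x, OF s1] obtain t \<sigma>2 where 2: "exec b \<sigma>1 (replicate t None) \<sigma>2" "\<sigma>2 0 = enc (P x)"
      "\<And>i. m \<le> i \<Longrightarrow> \<sigma>2 i = \<sigma>1 i" "t \<le> poly r (esize x)" by blast
    define \<sigma>3 where "\<sigma>3 = \<sigma>2(0 := enc x)"
    have e3: "exec (Assign 0 (Var m)) \<sigma>2 (replicate 1 None) \<sigma>3"
      by (rule exec_Assign') (auto simp: \<sigma>3_def \<sigma>1_def 2)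
    have 3: "\<sigma>3 0 = enc x" by (simp add: \<sigma>3_def)
    have "\<exists>u \<sigma>'. exec (If (Var 0) (Seq (Assign 0 (Var m)) c) (Seq (Assign 0 (Var m)) d)) \<sigma>2 (replicate u None) \<sigma>' \<and>
      \<sigma>' 0 = enc (if P x then f x else g x) \<and> (\<forall>i\<ge>m. \<sigma>' i = \<sigma>3 i) \<and> u \<le> poly (p + q + pconst 2) (esize x)"
    proof (cases "P x")
      case True
      from polytime_byE[OF c, of \<sigma>3 x, OF 3] obtain u \<sigma>4 where 4: "exec c \<sigma>3 (replicate u None) \<sigma>4" "\<sigma>4 0 = enc (f x)"
        "\<And>i. m \<le> i \<Longrightarrow> \<sigma>4 i = \<sigma>3 i" "u \<le> poly p (esize x)" by blast
      have "exec (If (Var 0) (Seq (Assign 0 (Var m)) c) (Seq (Assign 0 (Var m)) d)) \<sigma>2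
          (replicate (cost (Var 0) \<sigma>2) None @ replicate (1 + u) None) \<sigma>4"
        using 2 True by (intro exec.IfTrue exec_Seq_silent[OF e3 4(1)]) auto
      with 4 True show ?thesis
        by (intro exI[of _ "Suc (Suc u)"] exI[of _ \<sigma>4]) auto
    next
      case False
      from polytime_byE[OF d, of \<sigma>3 x, OF 3] obtain u \<sigma>4 where 4: "exec d \<sigma>3 (replicate u None) \<sigma>4" "\<sigma>4 0 = enc (g x)"
        "\<And>i. m \<le> i \<Longrightarrow> \<sigma>4 i = \<sigma>3 i" "u \<le> poly q (esize x)" by blast
      have "exec (If (Var 0) (Seq (Assign 0 (Var m)) c) (Seq (Assign 0 (Var m)) d)) \<sigma>2
          (replicate (cost (Var 0) \<sigma>2) None @ replicate (1 + u) None) \<sigma>4"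
        using 2 False by (intro exec.IfFalse exec_Seq_silent[OF e3 4(1)]) auto
      with 4 False show ?thesis
        by (intro exI[of _ "Suc (Suc u)"] exI[of _ \<sigma>4]) auto
    qed
    then obtain u \<sigma>' where 5: "exec (If (Var 0) (Seq (Assign 0 (Var m)) c) (Seq (Assign 0 (Var m)) d)) \<sigma>2 (replicate u None) \<sigma>'"
      "\<sigma>' 0 = enc (if P x then f x else g x)" "\<forall>i\<ge>m. \<sigma>' i = \<sigma>3 i" "u \<le> poly (p + q + pconst 2) (esize x)" by blast
    have "exec ?prog \<sigma> (replicate (1 + (t + u)) None) \<sigma>'"
      by (intro exec_Seq_silent) fact+
    moreover have "\<forall>i\<ge>Suc m. \<sigma>' i = \<sigma> i" using 5(3) 2(3) by (auto simp: \<sigma>3_def \<sigma>1_def)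
    ultimately show "\<exists>t \<sigma>'. exec ?prog \<sigma> (replicate t None) \<sigma>' \<and> \<sigma>' 0 = enc (if P x then f x else g x) \<and>
        (\<forall>i\<ge>Suc m. \<sigma>' i = \<sigma> i) \<and> t \<le> poly (p + q + r + pconst 3) (esize x)"
      using 5(2,4) 2(4) by (intro exI[of _ "1 + (t + u)"] exI[of _ \<sigma>'] conjI) auto
  next
    fix x :: 'a
    show "esize (if P x then f x else g x) \<le> poly (p + q + r + pconst 3) (esize x)"
      using polytime_by_esize[OF c, of x] polytime_by_esize[OF d, of x] by simp
  qed
qed

text \<open>All loops are obtained from this rule. A polynomial number of rounds, each polynomial in
  its current accumulator, may still explode, so every intermediate accumulator has to be bounded in
  the size of the original input.\<close>

lemma pt_fold:
  fixes xs :: "'x :: encodable \<Rightarrow> 'y :: encodable list" and s0 :: "'x \<Rightarrow> 's :: encodable"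
  assumes xs: "pt xs" and s0: "pt s0"
    and F: "pt (\<lambda>z. F (snd (snd z)) (fst z) (fst (snd z)))"
    and b: "\<And>x ys zs. xs x = ys @ zs \<Longrightarrow> esize (fold (F x) ys (s0 x)) \<le> poly b (esize x)"
  shows "pt (\<lambda>x. fold (F x) (xs x) (s0 x))"
proof -
  have "pt (\<lambda>x. (xs x, s0 x))" using xs s0 by (rule pt_Pair)
  then obtain c N p where c: "polytime_by c N p (\<lambda>x. (xs x, s0 x))" unfolding pt_def by blast
  from F obtain d N' q where d: "polytime_by d N' q (\<lambda>z. F (snd (snd z)) (fst z) (fst (snd z)))"
    unfolding pt_def by blast
  define m where "m = Suc (max N N')"
  have c: "polytime_by c m p (\<lambda>x. (xs x, s0 x))" and
    d: "polytime_by d m q (\<lambda>z. F (snd (snd z)) (fst z) (fst (snd z)))" and m: "0 < m"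
    using c d by (auto elim!: polytime_by_mono simp: m_def)
  \<comment> \<open>Variables \<open>m\<close>, \<open>m + 1\<close> and \<open>m + 2\<close> hold
    the input, the rest of the list and the accumulator.\<close>
  let ?get = "Assign 0 (Pair (Hd (Var (m + 1))) (Pair (Var (m + 2)) (Var m)))"
  let ?body = "Seq ?get (Seq d (Seq (Assign (m + 2) (Var 0)) (Assign (m + 1) (Tl (Var (m + 1))))))"
  let ?loop = "While (Var (m + 1)) ?body"
  let ?prog = "Seq (Assign m (Var 0)) (Seq c (Seq (Assign (m + 1) (Hd (Var 0)))
    (Seq (Assign (m + 2) (Tl (Var 0))) (Seq ?loop (Assign 0 (Var (m + 2)))))))"
  \<comment> \<open>\<open>Z\<close> bounds the list elements and \<open>B\<close> the accumulators;
    the 2 counts the inner nodes that join the triple. The 10 steps per round are the test (1),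
    packing the triple (6), storing the result (1) and taking the tail (2).\<close>
  have loop: "\<exists>t \<sigma>'. exec ?loop \<sigma> (replicate t None) \<sigma>' \<and> \<sigma>' (m + 2) = enc (fold (F x) ys s) \<and>
      (\<forall>i\<ge>m + 3. \<sigma>' i = \<sigma> i) \<and> t \<le> length ys * (poly q (Z + B + esize x + 2) + 10) + 1"
    if "\<sigma> m = enc x" "\<sigma> (m + 1) = enc ys" "\<sigma> (m + 2) = enc s"
      "\<And>us vs. ys = us @ vs \<Longrightarrow> esize (fold (F x) us s) \<le> B" "\<And>y. y \<in> set ys \<Longrightarrow> esize y \<le> Z"
    for \<sigma> x ys s Z B
    using that
  proof (induction ys arbitrary: \<sigma> s)
    case Nil
    then have "exec ?loop \<sigma> (replicate (cost (Var (m + 1)) \<sigma>) None) \<sigma>" by (intro exec.WhileFalse) auto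
    with Nil show ?case by (intro exI[of _ 1] exI[of _ \<sigma>]) auto
  next
    case (Cons y ys)
    define \<sigma>1 where "\<sigma>1 = \<sigma>(0 := enc (y, s, x))"
    have e1: "exec ?get \<sigma> (replicate 6 None) \<sigma>1"
      by (rule exec_Assign') (use Cons.prems in \<open>auto simp: \<sigma>1_def\<close>)
    have s1: "\<sigma>1 0 = enc (y, s, x)" by (simp add: \<sigma>1_def)
    from polytime_byE[OF d, of \<sigma>1 "(y, s, x)", OF s1] obtain t \<sigma>2 where
      2: "exec d \<sigma>1 (replicate t None) \<sigma>2" "\<sigma>2 0 = enc (F x y s)"
      "\<And>i. m \<le> i \<Longrightarrow> \<sigma>2 i = \<sigma>1 i" "t \<le> poly q (esize (y, s, x))" by auto
    define \<sigma>3 where "\<sigma>3 = \<sigma>2(m + 2 := enc (F x y s))"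
    have e3: "exec (Assign (m + 2) (Var 0)) \<sigma>2 (replicate 1 None) \<sigma>3"
      by (rule exec_Assign') (auto simp: \<sigma>3_def 2)
    define \<sigma>4 where "\<sigma>4 = \<sigma>3(m + 1 := enc ys)"
    have e4: "exec (Assign (m + 1) (Tl (Var (m + 1)))) \<sigma>3 (replicate 2 None) \<sigma>4"
      by (rule exec_Assign') (use Cons.prems m 2(3)[of "m + 1"] in \<open>auto simp: \<sigma>4_def \<sigma>3_def \<sigma>1_def\<close>)
    have body: "exec ?body \<sigma> (replicate (6 + (t + (1 + 2))) None) \<sigma>4"
      by (intro exec_Seq_silent) fact+
    have "\<exists>u \<sigma>5. exec ?loop \<sigma>4 (replicate u None) \<sigma>5 \<and> \<sigma>5 (m + 2) = enc (fold (F x) ys (F x y s)) \<and>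
      (\<forall>i\<ge>m + 3. \<sigma>5 i = \<sigma>4 i) \<and> u \<le> length ys * (poly q (Z + B + esize x + 2) + 10) + 1"
    proof (rule Cons.IH)
      show "\<sigma>4 m = enc x" using 2(3)[of m] Cons.prems m by (simp add: \<sigma>4_def \<sigma>3_def \<sigma>1_def)
      show "esize (fold (F x) us (F x y s)) \<le> B" if "ys = us @ vs" for us vs
        using Cons.prems(4)[of "y # us" vs] that by simp
    qed (use Cons.prems in \<open>auto simp: \<sigma>4_def \<sigma>3_def\<close>)
    then obtain u \<sigma>5 where 5: "exec ?loop \<sigma>4 (replicate u None) \<sigma>5" "\<sigma>5 (m + 2) = enc (fold (F x) ys (F x y s))"
      "\<forall>i\<ge>m + 3. \<sigma>5 i = \<sigma>4 i" "u \<le> length ys * (poly q (Z + B + esize x + 2) + 10) + 1" by blast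
    have "exec ?loop \<sigma> (replicate (cost (Var (m + 1)) \<sigma>) None @ replicate (6 + (t + (1 + 2))) None @ replicate u None) \<sigma>5"
      using Cons.prems by (intro exec.WhileTrue[OF _ body 5(1)]) auto
    then have loop': "exec ?loop \<sigma> (replicate (10 + t + u) None) \<sigma>5"
      by (simp flip: replicate_add replicate_Suc) (simp add: algebra_simps)
    have "esize (y, s, x) \<le> Z + B + esize x + 2"
      using Cons.prems(4)[of "[]" "y # ys"] Cons.prems(5)[of y] by simp
    then have "poly q (esize (y, s, x)) \<le> poly q (Z + B + esize x + 2)" by (rule poly_nat_mono)
    with 2(4) 5(4) have "10 + t + u \<le> length (y # ys) * (poly q (Z + B + esize x + 2) + 10) + 1" by simp
    moreover have "\<forall>i\<ge>m + 3. \<sigma>5 i = \<sigma> i"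
      using 5(3) 2(3) by (auto simp: \<sigma>4_def \<sigma>3_def \<sigma>1_def)
    ultimately show ?case using loop' 5(2) by (intro exI[of _ "10 + t + u"] exI[of _ \<sigma>5]) auto
  qed
  define pp where "pp = p + b + p * (pcompose q (p + b + pvar + pconst 2) + pconst 10) + pconst 9"
  show ?thesis unfolding pt_def
  proof (intro exI, rule polytime_byI)
    fix x :: 'x and \<sigma> :: state assume x: "\<sigma> 0 = enc x"
    define \<sigma>1 where "\<sigma>1 = \<sigma>(m := enc x)"
    have e1: "exec (Assign m (Var 0)) \<sigma> (replicate 1 None) \<sigma>1"
      by (rule exec_Assign') (auto simp: \<sigma>1_def x)
    have s1: "\<sigma>1 0 = enc x" using x m by (auto simp: \<sigma>1_def)
    from polytime_byE[OF c, of \<sigma>1 x, OF s1] obtain t \<sigma>2 where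
      2: "exec c \<sigma>1 (replicate t None) \<sigma>2" "\<sigma>2 0 = enc (xs x, s0 x)"
      "\<And>i. m \<le> i \<Longrightarrow> \<sigma>2 i = \<sigma>1 i" "t \<le> poly p (esize x)" by blast
    define \<sigma>3 where "\<sigma>3 = \<sigma>2(m + 1 := enc (xs x))"
    have e3: "exec (Assign (m + 1) (Hd (Var 0))) \<sigma>2 (replicate 2 None) \<sigma>3"
      by (rule exec_Assign') (auto simp: \<sigma>3_def 2)
    define \<sigma>4 where "\<sigma>4 = \<sigma>3(m + 2 := enc (s0 x))"
    have e4: "exec (Assign (m + 2) (Tl (Var 0))) \<sigma>3 (replicate 2 None) \<sigma>4"
      by (rule exec_Assign') (auto simp: \<sigma>4_def \<sigma>3_def 2)
    let ?Z = "poly p (esize x)" let ?B = "poly b (esize x)"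
    have sz: "esize (xs x) \<le> ?Z" using polytime_by_esize[OF c, of x] by simp
    have "\<exists>u \<sigma>5. exec ?loop \<sigma>4 (replicate u None) \<sigma>5 \<and> \<sigma>5 (m + 2) = enc (fold (F x) (xs x) (s0 x)) \<and>
      (\<forall>i\<ge>m + 3. \<sigma>5 i = \<sigma>4 i) \<and> u \<le> length (xs x) * (poly q (?Z + ?B + esize x + 2) + 10) + 1"
    proof (rule loop)
      show "\<sigma>4 m = enc x" using 2(3)[of m] by (simp add: \<sigma>4_def \<sigma>3_def \<sigma>1_def)
      show "esize y \<le> ?Z" if "y \<in> set (xs x)" for y using esize_mem[OF that] sz by simp
    qed (auto simp: \<sigma>4_def \<sigma>3_def b)
    then obtain u \<sigma>5 where 5: "exec ?loop \<sigma>4 (replicate u None) \<sigma>5" "\<sigma>5 (m + 2) = enc (fold (F x) (xs x) (s0 x))"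
      "\<forall>i\<ge>m + 3. \<sigma>5 i = \<sigma>4 i" "u \<le> length (xs x) * (poly q (?Z + ?B + esize x + 2) + 10) + 1" by blast
    define \<sigma>6 where "\<sigma>6 = \<sigma>5(0 := enc (fold (F x) (xs x) (s0 x)))"
    have e6: "exec (Assign 0 (Var (m + 2))) \<sigma>5 (replicate 1 None) \<sigma>6"
      by (rule exec_Assign') (use 5 in \<open>auto simp: \<sigma>6_def\<close>)
    have "exec ?prog \<sigma> (replicate (1 + (t + (2 + (2 + (u + 1))))) None) \<sigma>6"
      by (intro exec_Seq_silent) fact+
    moreover have "\<forall>i\<ge>m + 3. \<sigma>6 i = \<sigma> i"
      using 5(3) 2(3) by (auto simp: \<sigma>6_def \<sigma>4_def \<sigma>3_def \<sigma>1_def)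
    moreover have "1 + (t + (2 + (2 + (u + 1)))) \<le> poly pp (esize x)"
    proof -
      have "length (xs x) \<le> ?Z" using length_le_esize[of "xs x"] sz by simp
      then have "length (xs x) * (poly q (?Z + ?B + esize x + 2) + 10) \<le> ?Z * (poly q (?Z + ?B + esize x + 2) + 10)"
        by (rule mult_le_mono1)
      moreover have "poly pp (esize x) = ?Z + ?B + ?Z * (poly q (?Z + ?B + esize x + 2) + 10) + 9"
        by (simp add: pp_def poly_pcompose)
      ultimately show ?thesis using 5(4) 2(4) by linarith
    qed
    ultimately show "\<exists>t \<sigma>'. exec ?prog \<sigma> (replicate t None) \<sigma>' \<and> \<sigma>' 0 = enc (fold (F x) (xs x) (s0 x)) \<and>
        (\<forall>i\<ge>m + 3. \<sigma>' i = \<sigma> i) \<and> t \<le> poly pp (esize x)"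
      by (intro exI[of _ "1 + (t + (2 + (2 + (u + 1))))"] exI[of _ \<sigma>6] conjI) (auto simp: \<sigma>6_def)
  next
    fix x :: 'x
    show "esize (fold (F x) (xs x) (s0 x)) \<le> poly pp (esize x)"
      using b[of x "xs x" "[]"] by (simp add: pp_def)
  qed
qed

lemma esize_image_bound:
  fixes xs :: "'x :: encodable \<Rightarrow> 'y :: encodable list" and g :: "'x \<Rightarrow> 'y \<Rightarrow> 'z :: encodable"
  assumes "pt xs" "pt (\<lambda>z. g (snd z) (fst z))"
  obtains b :: "nat poly" where "\<And>x y. y \<in> set (xs x) \<Longrightarrow> esize (g x y) \<le> poly b (esize x)"
    "\<And>x. esize (xs x) \<le> poly b (esize x)"
proof -
  obtain p where p: "esize (xs x) \<le> poly p (esize x)" for x using pt_esize[OF assms(1)] by blast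
  obtain q where q: "esize (g (snd z) (fst z)) \<le> poly q (esize z)" for z using pt_esize[OF assms(2)] by blast
  have "esize (g x y) \<le> poly (pcompose q (p + pvar + pconst 1) + p) (esize x)" if "y \<in> set (xs x)" for x y
  proof -
    have "esize (g x y) \<le> poly q (esize (y, x))" using q[of "(y, x)"] by simp
    also have "\<dots> \<le> poly q (poly p (esize x) + esize x + 1)"
      using esize_mem[OF that] p[of x] by (intro poly_nat_mono) auto
    finally show ?thesis by (simp add: poly_pcompose)
  qed
  moreover have "esize (xs x) \<le> poly (pcompose q (p + pvar + pconst 1) + p) (esize x)" for x
    using p[of x] by simp
  ultimately show ?thesis using that by blast
qed

lemma pt_rev: assumes "pt xs" shows "pt (\<lambda>x. rev (xs x))"
proof -
  obtain b where b: "esize (xs x) \<le> poly b (esize x)" for x using pt_esize[OF assms] by blast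
  have fold_rev: "fold (#) ys [] = rev ys" for ys :: "'b list"
    by (simp add: fold_Cons_rev)
  then have "pt (\<lambda>x. fold (#) (xs x) [])"
  proof (intro pt_fold[where b = b])
    fix x ys zs assume "xs x = ys @ zs"
    then show "esize (fold (#) ys []) \<le> poly b (esize x)"
      using b[of x] by (simp add: fold_rev esize_rev esize_append)
  qed (intro assms pt_const pt_Cons pt_fst pt_snd pt_ident)+
  then show ?thesis by (simp add: fold_rev)
qed

lemma pt_tl:
  fixes xs :: "'x :: encodable \<Rightarrow> 'a :: encodable list"
  assumes "pt xs" shows "pt (\<lambda>x. tl (xs x))"
proof (rule pt_comp[where g = tl, OF assms])
  show "pt (tl :: 'a list \<Rightarrow> _)"
  proof (rule pt_assign[where e = "Tl (Var 0)" and p = "pvar + pconst 2"])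
    show "eval (Tl (Var 0)) \<sigma> = enc (tl xs) \<and> cost (Tl (Var 0)) \<sigma> \<le> poly (pvar + pconst 2) (esize xs)"
      if "\<sigma> 0 = enc xs" for xs :: "'a list" and \<sigma> using that by (cases xs) auto
    show "esize (tl xs) \<le> poly (pvar + pconst 2) (esize xs)" for xs :: "'a list" by (cases xs) auto
  qed
qed

text \<open>A case distinction as a loop: over the reversed list the head comes last and overwrites
  the accumulator, while for the empty list the initial \<open>f x\<close> survives. The loop body
  does not see the tail, so the tail is taken from the whole list, which explains the form of the
  premise on \<open>g\<close>.\<close>

lemma pt_case_list:
  fixes xs :: "'x :: encodable \<Rightarrow> 'y :: encodable list" and f :: "'x \<Rightarrow> 'z :: encodable"
  assumes xs: "pt xs" and f: "pt f" and g: "pt (\<lambda>z. g (snd z) (fst z) (tl (xs (snd z))))"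
  shows "pt (\<lambda>x. case xs x of [] \<Rightarrow> f x | y # ys \<Rightarrow> g x y ys)"
proof -
  have g': "pt (\<lambda>z. (\<lambda>x y s. g x y (tl (xs x))) (snd (snd z)) (fst z) (fst (snd z)))"
    using pt_comp[OF pt_Pair[OF pt_fst[OF pt_ident] pt_snd[OF pt_snd[OF pt_ident]]] g] by simp
  obtain p where p: "esize (f x) \<le> poly p (esize x)" for x using pt_esize[OF f] by blast
  obtain q where q: "\<And>x y. y \<in> set (xs x) \<Longrightarrow> esize (g x y (tl (xs x))) \<le> poly q (esize x)"
    using esize_image_bound[OF xs, of "\<lambda>x y. g x y (tl (xs x))"] g by metis
  have fold_case: "fold (\<lambda>y s. h y) ys a = (case rev ys of [] \<Rightarrow> a | y # _ \<Rightarrow> h y)" for h :: "'y \<Rightarrow> 'z" and ys a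
    by (induction ys arbitrary: a rule: rev_induct) auto
  have "pt (\<lambda>x. fold (\<lambda>y s. g x y (tl (xs x))) (rev (xs x)) (f x))"
  proof (rule pt_fold[where b = "p + q", OF pt_rev[OF xs] f g'])
    fix x ys zs assume eq: "rev (xs x) = ys @ zs"
    have sub: "set ys \<subseteq> set (rev (xs x))" unfolding eq by simp
    show "esize (fold (\<lambda>y s. g x y (tl (xs x))) ys (f x)) \<le> poly (p + q) (esize x)"
    proof (cases "rev ys")
      case Nil then show ?thesis using p[of x] by simp
    next
      case (Cons y us)
      then have "y \<in> set ys" by (metis list.set_intros(1) set_rev)
      then have "esize (g x y (tl (xs x))) \<le> poly q (esize x)" using sub by (intro q) auto
      then show ?thesis unfolding fold_case Cons by simp
    qed
  qed
  moreover have "fold (\<lambda>y s. g x y (tl (xs x))) (rev (xs x)) (f x) = (case xs x of [] \<Rightarrow> f x | y # ys \<Rightarrow> g x y ys)" for x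
    unfolding fold_case by (simp split: list.split)
  ultimately show ?thesis by simp
qed

lemma pt_map:
  fixes xs :: "'x :: encodable \<Rightarrow> 'y :: encodable list" and g :: "'x \<Rightarrow> 'y \<Rightarrow> 'z :: encodable"
  assumes xs: "pt xs" and g: "pt (\<lambda>z. g (snd z) (fst z))"
  shows "pt (\<lambda>x. map (g x) (xs x))"
proof -
  obtain b :: "nat poly" where b: "\<And>x y. y \<in> set (xs x) \<Longrightarrow> esize (g x y) \<le> poly b (esize x)"
    and b': "\<And>x. esize (xs x) \<le> poly b (esize x)"
    using esize_image_bound[OF xs g] by blast
  have fold_map: "fold (\<lambda>y acc. g x y # acc) ys acc = rev (map (g x) ys) @ acc" for x ys acc
    by (induction ys arbitrary: acc) auto
  have "pt (\<lambda>z. (\<lambda>x y s. g x y # s) (snd (snd z)) (fst z) (fst (snd z)))"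
    using pt_comp[OF pt_Pair[OF pt_fst[OF pt_ident] pt_snd[OF pt_snd[OF pt_ident]]] g]
    by (auto intro!: pt_Cons pt_fst pt_snd)
  then have "pt (\<lambda>x. fold (\<lambda>y s. g x y # s) (xs x) [])"
  proof (rule pt_fold[where b = "b * (b + pconst 1)", OF xs pt_const])
    fix x ys zs assume "xs x = ys @ zs"
    then have "set ys \<subseteq> set (xs x)" "length ys \<le> length (xs x)" by auto
    then have "esize (map (g x) ys) \<le> length (map (g x) ys) * (poly b (esize x) + 1)"
      by (intro esize_list_le) (auto intro: b)
    also have "\<dots> \<le> poly b (esize x) * (poly b (esize x) + 1)"
      using \<open>length ys \<le> length (xs x)\<close> length_le_esize[of "xs x"] b'[of x]
      by (intro mult_le_mono1) simp
    finally show "esize (fold (\<lambda>y s. g x y # s) ys []) \<le> poly (b * (b + pconst 1)) (esize x)"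
      by (simp add: fold_map esize_rev)
  qed
  from pt_rev[OF this] show ?thesis by (simp add: fold_map)
qed

lemma pt_append:
  assumes f: "pt f" and g: "pt g" shows "pt (\<lambda>x. f x @ g x)"
proof -
  obtain p where p: "esize (f x) \<le> poly p (esize x)" for x using pt_esize[OF f] by blast
  obtain q where q: "esize (g x) \<le> poly q (esize x)" for x using pt_esize[OF g] by blast
  have fold_app: "fold (#) ys acc = rev ys @ acc" for ys acc :: "'b list"
    by (simp add: fold_Cons_rev)
  have "pt (\<lambda>x. fold (#) (rev (f x)) (g x))"
  proof (rule pt_fold[where b = "p + q"])
    fix x ys zs assume "rev (f x) = ys @ zs"
    then have "esize (f x) = esize ys + esize zs" by (metis esize_append esize_rev)
    then show "esize (fold (#) ys (g x)) \<le> poly (p + q) (esize x)"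
      using p[of x] q[of x] by (simp add: fold_app esize_append esize_rev)
  qed (intro pt_rev f g pt_Cons pt_fst pt_snd pt_ident)+
  then show ?thesis by (simp add: fold_app)
qed

lemma pt_concat:
  assumes f: "pt f" shows "pt (\<lambda>x. concat (f x))"
proof -
  obtain p where p: "esize (f x) \<le> poly p (esize x)" for x using pt_esize[OF f] by blast
  have le: "esize (concat xs) \<le> esize xs" for xs :: "'b list list"
    by (induction xs) (auto simp: esize_append)
  have fold_conc: "fold (@) ys acc = concat (rev ys) @ acc" for ys and acc :: "'b list"
    by (induction ys arbitrary: acc) auto
  have "pt (\<lambda>x. fold (@) (rev (f x)) [])"
  proof (rule pt_fold[where b = p])
    fix x ys zs assume "rev (f x) = ys @ zs"
    then have "esize (rev ys) \<le> esize (f x)" by (metis esize_append esize_rev le_add1)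
    then show "esize (fold (@) ys []) \<le> poly p (esize x)"
      using p[of x] le[of "rev ys"] by (simp add: fold_conc)
  qed (intro pt_rev f pt_const pt_append pt_fst pt_snd pt_ident)+
  then show ?thesis by (simp add: fold_conc)
qed

lemma pt_filter:
  assumes xs: "pt xs" and P: "pt (\<lambda>z. P (snd z) (fst z))"
  shows "pt (\<lambda>x. filter (P x) (xs x))"
proof -
  have "pt (\<lambda>x. concat (map (\<lambda>y. if P x y then [y] else []) (xs x)))"
    by (intro pt_concat pt_map xs pt_if P pt_Cons pt_fst pt_const pt_ident)
  moreover have "concat (map (\<lambda>y. if Q y then [y] else []) ys) = filter Q ys" for Q and ys :: "'b list"
    by (induction ys) auto
  ultimately show ?thesis by simp
qed

lemma pt_not: "pt P \<Longrightarrow> pt (\<lambda>x. \<not> P x)"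
proof -
  assume "pt P"
  then have "pt (\<lambda>x. if P x then False else True)" by (intro pt_if pt_const)
  moreover have "(\<lambda>x. if P x then False else True) = (\<lambda>x. \<not> P x)" by auto
  ultimately show ?thesis by simp
qed

lemma pt_conj: "pt P \<Longrightarrow> pt Q \<Longrightarrow> pt (\<lambda>x. P x \<and> Q x)"
proof -
  assume "pt P" "pt Q"
  then have "pt (\<lambda>x. if P x then Q x else False)" by (intro pt_if pt_const)
  moreover have "(\<lambda>x. if P x then Q x else False) = (\<lambda>x. P x \<and> Q x)" by auto
  ultimately show ?thesis by simp
qed

lemma pt_disj: "pt P \<Longrightarrow> pt Q \<Longrightarrow> pt (\<lambda>x. P x \<or> Q x)"
proof -
  assume "pt P" "pt Q"
  then have "pt (\<lambda>x. \<not> (\<not> P x \<and> \<not> Q x))" by (intro pt_not pt_conj)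
  then show ?thesis by simp
qed

lemma pt_bex:
  assumes "pt xs" "pt (\<lambda>z. P (snd z) (fst z))" shows "pt (\<lambda>x. \<exists>y\<in>set (xs x). P x y)"
proof -
  have "pt (\<lambda>x. filter (P x) (xs x) \<noteq> [])"
    by (intro pt_not pt_eq pt_filter assms pt_const)
  then show ?thesis by (simp add: filter_empty_conv)
qed

lemma pt_ball:
  assumes "pt xs" "pt (\<lambda>z. P (snd z) (fst z))" shows "pt (\<lambda>x. \<forall>y\<in>set (xs x). P x y)"
proof -
  have "pt (\<lambda>x. \<not> (\<exists>y\<in>set (xs x). \<not> P x y))" by (intro pt_not pt_bex assms)
  then show ?thesis by simp
qed

lemma pt_member: assumes "pt f" "pt xs" shows "pt (\<lambda>x. f x \<in> set (xs x))"
proof -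
  have "pt (\<lambda>x. \<exists>y\<in>set (xs x). y = f x)"
    by (intro pt_bex assms(2) pt_eq pt_fst pt_ident pt_comp[OF pt_snd[OF pt_ident] assms(1)])
  moreover have "(\<exists>y\<in>set (xs x). y = f x) \<longleftrightarrow> f x \<in> set (xs x)" for x by auto
  ultimately show ?thesis by simp
qed

section \<open>Unary numbers and bounded iteration\<close>

lemma enc_nat_units: "enc (replicate n ()) = enc n"
  by (induction n) auto

text \<open>Counting loops and arithmetic become list operations: iteration runs over a list of
  units, addition is appending, and comparison is membership in an initial segment.\<close>

lemma pt_units: "pt n \<Longrightarrow> pt (\<lambda>x. replicate (n x) ())"
  by (rule pt_comp[where g = "\<lambda>n. replicate n ()"], assumption, rule pt_cast) (rule enc_nat_units)

lemma pt_length: assumes "pt xs" shows "pt (\<lambda>x. length (xs x))"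
proof -
  have "pt (length :: unit list \<Rightarrow> nat)"
  proof (rule pt_cast)
    show "enc (length us) = enc us" for us :: "unit list" by (induction us) auto
  qed
  from pt_comp[OF pt_map[OF assms pt_const[of "()"]] this] show ?thesis by simp
qed

lemma pt_funpow:
  fixes f :: "'x :: encodable \<Rightarrow> 's :: encodable \<Rightarrow> 's"
  assumes n: "pt n" and s: "pt s" and f: "pt (\<lambda>z. f (snd z) (fst z))"
    and b: "\<And>x i. i \<le> n x \<Longrightarrow> esize ((f x ^^ i) (s x)) \<le> poly b (esize x)"
  shows "pt (\<lambda>x. (f x ^^ n x) (s x))"
proof -
  have fold_pow: "fold (\<lambda>_. h) us a = (h ^^ length us) a" for h :: "'s \<Rightarrow> 's" and us :: "unit list" and a
    by (induction us arbitrary: a) (auto simp: funpow_swap1)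
  have "pt (\<lambda>x. fold (\<lambda>_. f x) (replicate (n x) ()) (s x))"
  proof (rule pt_fold[where b = b])
    show "pt (\<lambda>z. f (snd (snd z)) (fst (snd z)))" using pt_comp[OF pt_snd[OF pt_ident] f] .
    fix x ys zs assume "replicate (n x) () = ys @ zs"
    then have "length ys \<le> n x" by (metis le_add1 length_append length_replicate)
    then show "esize (fold (\<lambda>_. f x) ys (s x)) \<le> poly b (esize x)" unfolding fold_pow by (rule b)
  qed (intro pt_units n s)+
  then show ?thesis by (simp add: fold_pow)
qed

lemma pt_upt: assumes n: "pt n" shows "pt (\<lambda>x. [0..<n x])"
proof -
  obtain p where p: "esize (n x) \<le> poly p (esize x)" for x using pt_esize[OF n] by blast
  have pow: "((\<lambda>ys. ys @ [length ys]) ^^ i) [] = [0..<i]" for i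
    by (induction i) auto
  have "pt (\<lambda>x. ((\<lambda>ys. ys @ [length ys]) ^^ n x) [])"
  proof (rule pt_funpow[where b = "p * (p + pconst 1)"])
    fix x i assume "i \<le> n x"
    then have "esize [0..<i] \<le> length [0..<i] * (n x + 1)"
      by (intro esize_list_le) auto
    also have "\<dots> \<le> poly p (esize x) * (poly p (esize x) + 1)"
      using p[of x] \<open>i \<le> n x\<close> by (intro mult_le_mono) auto
    finally show "esize (((\<lambda>ys. ys @ [length ys]) ^^ i) []) \<le> poly (p * (p + pconst 1)) (esize x)"
      by (simp add: pow)
  qed (intro n pt_const pt_append pt_Cons pt_length pt_fst pt_ident)+
  then show ?thesis by (simp add: pow)
qed

lemma pt_less: assumes "pt f" "pt g" shows "pt (\<lambda>x. (f x :: nat) < g x)"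
  using pt_member[OF assms(1) pt_upt[OF assms(2)]] by simp

lemma pt_add: assumes "pt f" "pt g" shows "pt (\<lambda>x. (f x :: nat) + g x)"
  using pt_length[OF pt_append[OF pt_units[OF assms(1)] pt_units[OF assms(2)]]] by simp

lemma pt_mult: assumes f: "pt f" and g: "pt g" shows "pt (\<lambda>x. (f x :: nat) * g x)"
proof -
  have "pt (\<lambda>x. length (concat (map (\<lambda>_. replicate (g x) ()) (replicate (f x) ()))))"
    by (intro pt_length pt_concat pt_map pt_units f pt_comp[OF pt_snd[OF pt_ident] g])
  then show ?thesis by (simp add: length_concat o_def sum_list_triv sum_list_replicate)
qed

definition nub :: "'a list \<Rightarrow> 'a list" where
  "nub xs = fold List.insert xs []"

lemma fold_insert: "distinct acc \<Longrightarrow> distinct (fold List.insert xs acc) \<and> set (fold List.insert xs acc) = set xs \<union> set acc"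
  by (induction xs arbitrary: acc) auto

lemma distinct_nub [simp]: "distinct (nub xs)" and set_nub [simp]: "set (nub xs) = set xs"
  using fold_insert[of "[]" xs] by (auto simp: nub_def)

lemma pt_nub: assumes f: "pt f" shows "pt (\<lambda>x. nub (f x))"
proof -
  obtain p where p: "esize (f x) \<le> poly p (esize x)" for x using pt_esize[OF f] by blast
  have le: "esize (fold List.insert ys acc) \<le> esize ys + esize acc" for ys acc :: "'b list"
  proof (induction ys arbitrary: acc)
    case (Cons y ys)
    show ?case using Cons[of "List.insert y acc"] by (auto simp: List.insert_def split: if_splits)
  qed simp
  have "pt (\<lambda>x. fold List.insert (f x) [])"
  proof (rule pt_fold[where b = p])
    fix x ys zs assume "f x = ys @ zs"
    then show "esize (fold List.insert ys []) \<le> poly p (esize x)"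
      using p[of x] le[of ys "[]"] by (simp add: esize_append)
  qed (unfold List.insert_def, (intro f pt_const pt_if pt_member pt_Cons pt_fst pt_snd pt_ident)+)
  then show ?thesis by (simp add: nub_def)
qed

section \<open>Enumeration\<close>

text \<open>The trace of a deterministic iterator. The current state is a list with at most one
  element, so the end of the run is coded by \<open>Leaf\<close> and a \<open>While\<close> loop can
  test for it directly.\<close>

inductive runs :: "('s \<Rightarrow> 's list) \<Rightarrow> 's list \<Rightarrow> 's list \<Rightarrow> bool" for nx where
  runs_Nil: "runs nx [] []"
| runs_Cons: "runs nx (nx s) ss \<Longrightarrow> runs nx [s] (s # ss)"

lemma delay_at_most_replicate: "n \<le> d \<Longrightarrow> delay_at_most (replicate n None) d"
  unfolding delay_at_most_def by (metis length_append length_replicate le_add1 le_add2 le_trans)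

text \<open>A silent stretch cannot contain the output at position \<open>n\<close>, so it lies
  entirely before or entirely after it.\<close>

lemma delay_at_most_block:
  assumes "n \<le> d" "delay_at_most tr d"
  shows "delay_at_most (replicate n None @ Some v # tr) d"
  unfolding delay_at_most_def
proof (intro allI impI)
  fix us m ws assume eq: "replicate n None @ Some v # tr = us @ replicate m None @ ws"
  show "m \<le> d"
  proof (cases "length us \<le> n")
    case True
    have "m \<le> n - length us"
    proof (rule ccontr)
      assume "\<not> m \<le> n - length us"
      then have "(us @ replicate m None @ ws) ! n = None" using True by (auto simp: nth_append)
      moreover have "(replicate n None @ Some v # tr) ! n = Some v" by (simp add: nth_append)
      ultimately show False by (simp add: eq)
    qed
    with assms(1) show ?thesis by simp
  next
    case False
    have "tr = drop (Suc n) (replicate n None @ Some v # tr)" by simp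
    also have "\<dots> = drop (Suc n) us @ replicate m None @ ws" unfolding eq using False by simp
    finally show ?thesis using assms(2) unfolding delay_at_most_def by blast
  qed
qed

lemma outputs_simps [simp]:
  "outputs (replicate n None) = []" "outputs (tr @ tr') = outputs tr @ outputs tr'"
  "outputs (None # tr) = outputs tr" "outputs (Some v # tr) = v # outputs tr" "outputs [] = []"
  by (auto simp: outputs_def)

text \<open>The number of states may be exponential. Only their individual sizes are bounded, which
  suffices for the delay because each round outputs once.\<close>

lemma enumeration_program:
  fixes ini :: "'x :: encodable \<Rightarrow> 's :: encodable list" and out :: "'s \<Rightarrow> 'b :: encodable"
  assumes "pt ini" "pt out" "pt nx"
    and runs: "\<And>x. x \<in> D \<Longrightarrow> runs nx (ini x) (ss x)"
    and bound: "\<And>x s. x \<in> D \<Longrightarrow> s \<in> set (ss x) \<Longrightarrow> esize s \<le> poly b (esize x)"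
  shows "\<exists>c q. \<forall>x\<in>D. \<forall>\<sigma>. \<sigma> 0 = enc x \<longrightarrow> (\<exists>tr \<sigma>'. exec c \<sigma> tr \<sigma>' \<and>
    delay_at_most tr (poly q (esize x)) \<and> outputs tr = map (\<lambda>s. enc (out s)) (ss x))"
proof -
  from assms(1-3) obtain ci Ni pi co No po cn Nn pn where
    ci: "polytime_by ci Ni pi ini" and co: "polytime_by co No po out" and cn: "polytime_by cn Nn pn nx"
    unfolding pt_def by blast
  define m where "m = Suc (max No Nn)"
  have co: "polytime_by co m po out" and cn: "polytime_by cn m pn nx" and m: "0 < m"
    using co cn by (auto elim!: polytime_by_mono simp: m_def)
  let ?body = "Seq (Assign m (Hd (Var 0))) (Seq (Assign 0 (Var m)) (Seq co (Seq (Out (Var 0)) (Seq (Assign 0 (Var m)) cn))))"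
  let ?loop = "While (Var 0) ?body"
  \<comment> \<open>Computing the next state happens after an output and belongs to the delay of the
    following one. So the induction allows up to \<open>A\<close> silent steps pending in front of
    the trace.\<close>
  have loop: "\<exists>tr \<sigma>'. exec ?loop \<sigma> tr \<sigma>' \<and> outputs tr = map (\<lambda>s. enc (out s)) zs \<and>
      (\<forall>a\<le>A. delay_at_most (replicate a None @ tr) (A + 2 * poly po B + 5))"
    if "runs nx L zs" "\<sigma> 0 = enc L" "\<And>s. s \<in> set zs \<Longrightarrow> esize s \<le> B" "poly pn B + 1 \<le> A" for L zs \<sigma> A B
    using that
  proof (induction arbitrary: \<sigma> rule: runs.induct)
    case runs_Nil
    then have "exec ?loop \<sigma> (replicate (cost (Var 0) \<sigma>) None) \<sigma>" by (intro exec.WhileFalse) auto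
    moreover have "delay_at_most (replicate a None @ replicate (cost (Var 0) \<sigma>) None) (A + 2 * poly po B + 5)"
      if "a \<le> A" for a
      unfolding replicate_add[symmetric] by (rule delay_at_most_replicate) (use that in simp)
    ultimately show ?case by (intro exI[of _ "replicate (cost (Var 0) \<sigma>) None"] exI[of _ \<sigma>]) auto
  next
    case (runs_Cons s zs)
    have sB: "esize s \<le> B" by (rule runs_Cons.prems) simp
    define \<sigma>1 where "\<sigma>1 = \<sigma>(m := enc s)"
    have e1: "exec (Assign m (Hd (Var 0))) \<sigma> (replicate 2 None) \<sigma>1"
      by (rule exec_Assign') (auto simp: \<sigma>1_def runs_Cons.prems)
    define \<sigma>2 where "\<sigma>2 = \<sigma>1(0 := enc s)"
    have e2: "exec (Assign 0 (Var m)) \<sigma>1 (replicate 1 None) \<sigma>2"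
      by (rule exec_Assign') (auto simp: \<sigma>1_def \<sigma>2_def)
    have s2: "\<sigma>2 0 = enc s" by (simp add: \<sigma>2_def)
    from polytime_byE[OF co, of \<sigma>2 s, OF s2] obtain t \<sigma>3 where
      3: "exec co \<sigma>2 (replicate t None) \<sigma>3" "\<sigma>3 0 = enc (out s)"
      "\<And>i. m \<le> i \<Longrightarrow> \<sigma>3 i = \<sigma>2 i" "t \<le> poly po (esize s)" by blast
    have e4: "exec (Out (Var 0)) \<sigma>3 (replicate (1 + esize (out s)) None @ [Some (enc (out s))]) \<sigma>3"
      using exec.Out[of "Var 0" \<sigma>3] 3(2) by simp
    define \<sigma>4 where "\<sigma>4 = \<sigma>3(0 := enc s)"
    have e5: "exec (Assign 0 (Var m)) \<sigma>3 (replicate 1 None) \<sigma>4"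
      by (rule exec_Assign') (use m 3(3)[of m] in \<open>auto simp: \<sigma>1_def \<sigma>2_def \<sigma>4_def\<close>)
    have s4: "\<sigma>4 0 = enc s" by (simp add: \<sigma>4_def)
    from polytime_byE[OF cn, of \<sigma>4 s, OF s4] obtain u \<sigma>5 where
      5: "exec cn \<sigma>4 (replicate u None) \<sigma>5" "\<sigma>5 0 = enc (nx s)" "u \<le> poly pn (esize s)" by blast
    have "poly pn (esize s) \<le> poly pn B" by (rule poly_nat_mono[OF sB])
    with 5(3) runs_Cons.prems(3) have uA: "1 + u \<le> A" by simp
    obtain tr \<sigma>6 where 6: "exec ?loop \<sigma>5 tr \<sigma>6" "outputs tr = map (\<lambda>s. enc (out s)) zs"
      "\<And>a. a\<le>A \<Longrightarrow> delay_at_most (replicate a None @ tr) (A + 2 * poly po B + 5)"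
      using runs_Cons.IH[of \<sigma>5] 5(2) runs_Cons.prems(2,3) by auto
    have body: "exec ?body \<sigma> (replicate 2 None @ replicate 1 None @ replicate t None @
        (replicate (1 + esize (out s)) None @ [Some (enc (out s))]) @ replicate 1 None @ replicate u None) \<sigma>5"
      by (intro exec.Seq) fact+
    \<comment> \<open>The silent steps before the output: \<open>t\<close> for computing it, its
      size for writing it, and 5 for the test, the two copies and evaluating the output
      expression.\<close>
    define k where "k = 5 + t + esize (out s)"
    have "exec ?loop \<sigma> (replicate (cost (Var 0) \<sigma>) None @ (replicate 2 None @ replicate 1 None @ replicate t None @
        (replicate (1 + esize (out s)) None @ [Some (enc (out s))]) @ replicate 1 None @ replicate u None) @ tr) \<sigma>6"
      using runs_Cons.prems(1) by (intro exec.WhileTrue[OF _ body 6(1)]) auto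
    also have "(replicate (cost (Var 0) \<sigma>) None @ (replicate 2 None @ replicate 1 None @ replicate t None @
        (replicate (1 + esize (out s)) None @ [Some (enc (out s))]) @ replicate 1 None @ replicate u None) @ tr)
      = replicate k None @ Some (enc (out s)) # replicate (1 + u) None @ tr"
      by (simp add: k_def replicate_add numeral_eq_Suc replicate_app_Cons_same)
    finally have ex: "exec ?loop \<sigma> (replicate k None @ Some (enc (out s)) # replicate (1 + u) None @ tr) \<sigma>6" .
    have "poly po (esize s) \<le> poly po B" by (rule poly_nat_mono[OF sB])
    then have k: "k \<le> 2 * poly po B + 5"
      using 3(4) polytime_by_esize[OF co, of s] by (simp add: k_def)
    have "delay_at_most (replicate a None @ replicate k None @ Some (enc (out s)) # replicate (1 + u) None @ tr)
        (A + 2 * poly po B + 5)" if "a \<le> A" for a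
      unfolding append_assoc[symmetric, of "replicate a None"] replicate_add[symmetric]
      by (rule delay_at_most_block) (use that k 6(3)[OF uA] in auto)
    with ex 6(2) show ?case
      by (intro exI[of _ "replicate k None @ Some (enc (out s)) # replicate (1 + u) None @ tr"] exI[of _ \<sigma>6]) auto
  qed
  define q where "q = pi + pcompose pn b + pconst 1 + pconst 2 * pcompose po b + pconst 5"
  have "\<exists>tr \<sigma>'. exec (Seq ci ?loop) \<sigma> tr \<sigma>' \<and> delay_at_most tr (poly q (esize x)) \<and>
    outputs tr = map (\<lambda>s. enc (out s)) (ss x)" if xD: "x \<in> D" and x: "\<sigma> 0 = enc x" for x \<sigma>
  proof -
    from polytime_byE[OF ci, of \<sigma> x, OF x] obtain t \<sigma>1 where
      1: "exec ci \<sigma> (replicate t None) \<sigma>1" "\<sigma>1 0 = enc (ini x)" "t \<le> poly pi (esize x)" by blast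
    define A where "A = poly pi (esize x) + poly pn (poly b (esize x)) + 1"
    obtain tr \<sigma>2 where 2: "exec ?loop \<sigma>1 tr \<sigma>2" "outputs tr = map (\<lambda>s. enc (out s)) (ss x)"
      "\<And>a. a\<le>A \<Longrightarrow> delay_at_most (replicate a None @ tr) (A + 2 * poly po (poly b (esize x)) + 5)"
      using loop[where L = "ini x" and zs = "ss x" and \<sigma> = \<sigma>1 and A = A and B = "poly b (esize x)",
          OF runs[OF xD] 1(2) bound[OF xD]] by (auto simp: A_def)
    have "exec (Seq ci ?loop) \<sigma> (replicate t None @ tr) \<sigma>2" using 1 2 by (intro exec.Seq)
    moreover have "delay_at_most (replicate t None @ tr) (poly q (esize x))"
      using 2(3)[of t] 1(3) by (simp add: q_def A_def poly_pcompose add_ac)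
    ultimately show ?thesis using 2(2)
      by (intro exI[of _ "replicate t None @ tr"] exI[of _ \<sigma>2]) auto
  qed
  then show ?thesis by blast
qed

section \<open>Products\<close>

text \<open>
  An odometer: every wheel is the nonempty rest of its list of values together with the whole list.
\<close>

fun choices :: "'a list list \<Rightarrow> 'a list list" where
  "choices [] = [[]]"
| "choices (D # Ds) = concat (map (\<lambda>cs. map (\<lambda>c. c # cs) D) (choices Ds))"

lemma set_choices: "cs \<in> set (choices Ds) \<longleftrightarrow> list_all2 (\<lambda>c D. c \<in> set D) cs Ds"
  by (induction Ds arbitrary: cs) (auto simp: list_all2_Cons2)

lemma distinct_choices: "\<forall>D\<in>set Ds. distinct D \<Longrightarrow> distinct (choices Ds)"
proof (induction Ds)
  case (Cons D Ds)
  show ?case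
  proof (cases "D = []")
    case True
    then show ?thesis by (simp add: concat_eq_Nil_conv[THEN iffD2])
  next
    case False
    with Cons show ?thesis by (auto simp: distinct_map inj_on_def intro!: distinct_concat)
  qed
qed simp

type_synonym 'a odometer = "('a list \<times> 'a list) list"

fun advance :: "'a odometer \<Rightarrow> 'a odometer list" where
  "advance [] = []"
| "advance (w # ws) = (if tl (fst w) = [] then map (\<lambda>ws'. (snd w, snd w) # ws') (advance ws)
     else [(tl (fst w), snd w) # ws])"

definition start :: "'a list list \<Rightarrow> 'a odometer" where
  "start Ds = map (\<lambda>D. (D, D)) Ds"

definition reading :: "'a odometer \<Rightarrow> 'a list" where
  "reading ws = concat (map (\<lambda>w. take 1 (fst w)) ws)"

text \<open>The wheel in front turns fastest: for each state of the remaining wheels it passes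
  through all suffixes of \<open>D\<close>. When it is exhausted, the reset and the carry to the
  other wheels happen in one step, so no round is without output.\<close>

lemma runs_wheel:
  assumes "D \<noteq> []" "runs advance L zs"
  shows "runs advance (map ((#) (D, D)) L) (concat (map (\<lambda>ws. map (\<lambda>i. (drop i D, D) # ws) [0..<length D]) zs))"
  using assms(2)
proof (induction rule: runs.induct)
  case runs_Nil
  then show ?case by (auto intro: runs.intros)
next
  case (runs_Cons ws zs)
  let ?rest = "concat (map (\<lambda>ws. map (\<lambda>i. (drop i D, D) # ws) [0..<length D]) zs)"
  have "runs advance [(drop i D, D) # ws] (map (\<lambda>i. (drop i D, D) # ws) [i..<length D] @ ?rest)"
    if "i < length D" for i
    using that
  proof (induction "length D - i" arbitrary: i)
    case (Suc n)
    have upt: "[i..<length D] = i # [Suc i..<length D]" using Suc.prems by (simp add: upt_conv_Cons)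
    have tl: "tl (drop i D) = drop (Suc i) D" by (simp add: drop_Suc tl_drop)
    show ?case
    proof (cases "Suc i = length D")
      case True
      then have "advance ((drop i D, D) # ws) = map ((#) (D, D)) (advance ws)" using tl by simp
      with runs_Cons.IH True show ?thesis unfolding upt by (auto intro!: runs.runs_Cons)
    next
      case False
      then have "advance ((drop i D, D) # ws) = [(drop (Suc i) D, D) # ws]" using tl Suc.prems by simp
      moreover have "runs advance [(drop (Suc i) D, D) # ws] (map (\<lambda>i. (drop i D, D) # ws) [Suc i..<length D] @ ?rest)"
        using Suc False by (intro Suc.hyps) auto
      ultimately show ?thesis unfolding upt by (auto intro!: runs.runs_Cons)
    qed
  qed simp
  from this[of 0] assms(1) show ?case by simp
qed

text \<open>The last conjunct says that wheels only ever hold suffixes of their lists. It keeps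
  every state of the run within twice the size of the input, see
  \<open>esize_odometer\<close>.\<close>

lemma runs_odometer:
  assumes "\<forall>D\<in>set Ds. D \<noteq> []"
  shows "\<exists>zs. runs advance [start Ds] zs \<and> map reading zs = choices Ds \<and>
    (\<forall>ws\<in>set zs. list_all2 (\<lambda>w D. snd w = D \<and> (\<exists>i. fst w = drop i D)) ws Ds)"
  using assms
proof (induction Ds)
  case Nil
  have "runs advance [[]] [[]]" by (rule runs_Cons) (simp add: runs_Nil)
  then show ?case by (intro exI[of _ "[[]]"]) (auto simp: start_def reading_def)
next
  case (Cons D Ds)
  then obtain zs where zs: "runs advance [start Ds] zs" "map reading zs = choices Ds"
    "\<forall>ws\<in>set zs. list_all2 (\<lambda>w D. snd w = D \<and> (\<exists>i. fst w = drop i D)) ws Ds" by auto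
  let ?ys = "concat (map (\<lambda>ws. map (\<lambda>i. (drop i D, D) # ws) [0..<length D]) zs)"
  have "runs advance [start (D # Ds)] ?ys"
    using runs_wheel[OF _ zs(1), of D] Cons.prems by (simp add: start_def)
  moreover have "map reading ?ys = choices (D # Ds)"
  proof -
    have "map (\<lambda>i. reading ((drop i D, D) # ws)) [0..<length D] = map (\<lambda>c. c # reading ws) D" for ws
    proof -
      have "reading ((drop i D, D) # ws) = D ! i # reading ws" if "i < length D" for i
        using that by (simp add: reading_def take_Suc hd_drop_conv_nth)
      then have "map (\<lambda>i. reading ((drop i D, D) # ws)) [0..<length D] = map (\<lambda>i. D ! i # reading ws) [0..<length D]"
        by (intro map_cong) auto
      also have "\<dots> = map (\<lambda>c. c # reading ws) (map ((!) D) [0..<length D])" by (simp add: o_def)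
      finally show ?thesis by (simp add: map_nth)
    qed
    then show ?thesis by (simp add: map_concat o_def zs(2)[symmetric])
  qed
  moreover have "\<forall>ws\<in>set ?ys. list_all2 (\<lambda>w D. snd w = D \<and> (\<exists>i. fst w = drop i D)) ws (D # Ds)"
    using zs(3) by auto
  ultimately show ?case by blast
qed

text \<open>A reset may replace a short rest by the whole list that is stored next to it, hence the
  factor two. This bounds a single step; over a whole run the suffix property of
  \<open>runs_odometer\<close> prevents repeated doubling.\<close>

lemma esize_advance: "length (advance ws) \<le> 1 \<and> (\<forall>vs\<in>set (advance ws). esize vs \<le> 2 * esize ws)"
proof (induction ws)
  case (Cons w ws)
  have "esize (tl (fst w)) \<le> esize (fst w)" by (cases "fst w") auto
  with Cons show ?case by (auto simp: size_enc_prod)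
qed simp

lemma esize_odometer:
  "list_all2 (\<lambda>w D. snd w = D \<and> (\<exists>i. fst w = drop i D)) ws Ds \<Longrightarrow> esize ws \<le> 2 * esize Ds"
proof (induction rule: list_all2_induct)
  case (Cons w ws D Ds)
  have "esize (drop i D) \<le> esize D" for i
    by (metis append_take_drop_id esize_append le_add2)
  with Cons show ?case by (auto simp: size_enc_prod) (metis add_le_mono)
qed simp

text \<open>The recursion needs both the remaining wheels and their advanced form, so the fold from
  the back carries the pair of the two.\<close>

lemma pt_advance: "pt (advance :: 'a :: encodable odometer \<Rightarrow> _)"
proof -
  define F :: "('a list \<times> 'a list) \<Rightarrow> 'a odometer \<times> 'a odometer list \<Rightarrow> 'a odometer \<times> 'a odometer list" where
    "F w s = (w # fst s, if tl (fst w) = [] then map (\<lambda>ws'. (snd w, snd w) # ws') (snd s)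
      else [(tl (fst w), snd w) # fst s])" for w s
  have F: "fold F (rev ws) ([], []) = (ws, advance ws)" for ws
    by (induction ws) (auto simp: F_def)
  have "pt (\<lambda>ws. fold F (rev ws) ([], []))"
  proof (rule pt_fold[where b = "pvar + pconst 2 * pvar + pconst 3"])
    show "pt (\<lambda>z. F (fst z) (fst (snd z)))" unfolding F_def
      by (intro pt_Pair pt_Cons pt_if pt_eq pt_tl pt_map pt_fst pt_snd pt_const pt_ident)
    fix ws us vs :: "'a odometer" assume "rev ws = us @ vs"
    then have "ws = rev vs @ rev us" by (metis rev_append rev_rev_ident)
    then have le: "esize (rev us) \<le> esize ws" by (simp add: esize_append)
    have "esize (advance (rev us)) \<le> 2 * esize (rev us) + 1"
      using esize_advance[of "rev us"] by (cases "advance (rev us)") auto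
    then show "esize (fold F us ([], [])) \<le> poly (pvar + pconst 2 * pvar + pconst 3) (esize ws)"
      using le F[of "rev us"] by simp
  qed (intro pt_rev pt_const pt_ident)+
  from pt_snd[OF this] show ?thesis by (simp add: F)
qed

text \<open>The output depends on the input as well as on the choices, so the iterator states carry
  \<open>x\<close> along with the odometer.\<close>

lemma product_enumeration:
  fixes digits :: "'x :: encodable \<Rightarrow> 'a :: encodable list list" and out :: "'x \<Rightarrow> 'a list \<Rightarrow> 'b :: encodable"
  assumes digits: "pt digits" and out: "pt (\<lambda>z. out (fst z) (snd z))"
    and ne: "\<And>x. x \<in> D \<Longrightarrow> \<forall>ds\<in>set (digits x). ds \<noteq> []"
  shows "\<exists>c q. \<forall>x\<in>D. \<forall>\<sigma>. \<sigma> 0 = enc x \<longrightarrow> (\<exists>tr \<sigma>'. exec c \<sigma> tr \<sigma>' \<and>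
    delay_at_most tr (poly q (esize x)) \<and> outputs tr = map (\<lambda>cs. enc (out x cs)) (choices (digits x)))"
proof -
  define ini where "ini x = [(x, start (digits x))]" for x
  define nx :: "'x \<times> 'a odometer \<Rightarrow> _" where "nx z = map (\<lambda>ws. (fst z, ws)) (advance (snd z))" for z
  define ot where "ot z = out (fst z) (reading (snd z))" for z
  obtain p where p: "esize (digits x) \<le> poly p (esize x)" for x using pt_esize[OF digits] by blast
  define Z where "Z x zs \<longleftrightarrow> runs advance [start (digits x)] zs \<and> map reading zs = choices (digits x) \<and>
    (\<forall>ws\<in>set zs. list_all2 (\<lambda>w D. snd w = D \<and> (\<exists>i. fst w = drop i D)) ws (digits x))" for x zs
  have "\<forall>x\<in>D. \<exists>zs. Z x zs" unfolding Z_def using runs_odometer[OF ne] by blast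
  then obtain zs where "\<forall>x\<in>D. Z x (zs x)" using bchoice[of D Z] by blast
  then have zs: "\<And>x. x \<in> D \<Longrightarrow> runs advance [start (digits x)] (zs x)"
    "\<And>x. x \<in> D \<Longrightarrow> map reading (zs x) = choices (digits x)"
    "\<And>x ws. x \<in> D \<Longrightarrow> ws \<in> set (zs x) \<Longrightarrow> list_all2 (\<lambda>w D. snd w = D \<and> (\<exists>i. fst w = drop i D)) ws (digits x)"
    unfolding Z_def by blast+
  have lift: "runs nx (map (Product_Type.Pair x) L) (map (Product_Type.Pair x) ys)" if "runs advance L ys" for x L ys
    using that by induction (auto intro!: runs.intros simp: nx_def)
  have "\<exists>c q. \<forall>x\<in>D. \<forall>\<sigma>. \<sigma> 0 = enc x \<longrightarrow> (\<exists>tr \<sigma>'. exec c \<sigma> tr \<sigma>' \<and>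
    delay_at_most tr (poly q (esize x)) \<and> outputs tr = map (\<lambda>s. enc (ot s)) (map (Product_Type.Pair x) (zs x)))"
  proof (rule enumeration_program[where nx = nx and ini = ini and b = "pvar + pconst 2 * p + pconst 1"])
    show "pt ini" unfolding ini_def start_def
      by (intro pt_Cons pt_Pair pt_map digits pt_fst pt_const pt_ident)
    have "reading = (\<lambda>ws :: 'a odometer. concat (map (\<lambda>w. case fst w of [] \<Rightarrow> [] | c # cs \<Rightarrow> [c]) ws))"
      unfolding reading_def
      by (intro ext arg_cong[of _ _ concat] map_cong) (auto simp: take_Suc split: list.split)
    moreover have "pt (\<lambda>ws :: 'a odometer. concat (map (\<lambda>w. case fst w of [] \<Rightarrow> [] | c # cs \<Rightarrow> [c]) ws))"
      by (intro pt_concat pt_map pt_case_list pt_Cons pt_fst pt_const pt_ident)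
    ultimately have "pt (reading :: 'a odometer \<Rightarrow> _)" by simp
    from pt_comp[OF pt_Pair[OF pt_fst[OF pt_ident] pt_comp[OF pt_snd[OF pt_ident] this]] out]
    show "pt ot" unfolding ot_def by simp
    show "pt nx" unfolding nx_def
      by (intro pt_map pt_Pair pt_fst pt_snd pt_ident pt_comp[OF pt_snd[OF pt_ident] pt_advance])
    show "runs nx (ini x) (map (Product_Type.Pair x) (zs x))" if "x \<in> D" for x
      using lift[OF zs(1)[OF that], of x] by (simp add: ini_def)
    show "esize s \<le> poly (pvar + pconst 2 * p + pconst 1) (esize x)" if xD: "x \<in> D" and s: "s \<in> set (map (Product_Type.Pair x) (zs x))" for x s
    proof -
      obtain ws where ws: "s = (x, ws)" "ws \<in> set (zs x)" using s by auto
      have "esize ws \<le> 2 * esize (digits x)" by (rule esize_odometer[OF zs(3)[OF xD ws(2)]])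
      then show ?thesis using p[of x] by (simp add: ws)
    qed
  qed
  moreover have "map (\<lambda>s. enc (ot s)) (map (Product_Type.Pair x) (zs x)) = map (\<lambda>cs. enc (out x cs)) (choices (digits x))"
    if "x \<in> D" for x
    by (simp add: ot_def zs(2)[OF that, symmetric])
  ultimately show ?thesis by (simp cong: ball_cong)
qed

lemma pt_computable:
  assumes "pt f" shows "computable f"
proof -
  from assms obtain c N p where c: "polytime_by c N p f" unfolding pt_def by blast
  have "\<exists>t. computes_in_time c [enc_nat n] (enc_nat (f n)) t" for n
  proof -
    have "init [enc_nat n] 0 = enc n" by (simp add: init_def enc_nat')
    from polytime_byE[OF c, of "init [enc_nat n]" n, OF this] obtain t \<sigma>' where
      "exec c (init [enc_nat n]) (replicate t None) \<sigma>'" "\<sigma>' 0 = enc (f n)" by blast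
    then show ?thesis unfolding computes_in_time_def enc_nat' by blast
  qed
  then show ?thesis unfolding computable_def by blast
qed

section \<open>The kernelization algorithm\<close>

type_synonym edge = "nat \<times> nat"
type_synonym 'l labelled = "(edge \<times> 'l list) list"

lemmas pt_intros = pt_ident pt_const pt_fst pt_snd pt_Pair pt_Cons pt_eq pt_if pt_not pt_conj pt_disj
  pt_bex pt_ball pt_filter pt_map pt_member pt_append pt_concat pt_tl pt_length pt_upt pt_less pt_add pt_mult
  pt_Suc pt_case_list pt_nub

text \<open>Connectedness is decided by contracting the edges one by one.\<close>

definition subst_vertex :: "edge \<Rightarrow> nat \<Rightarrow> nat" where
  "subst_vertex e x = (if x = fst e then snd e else x)"

definition contract :: "nat list \<times> edge list \<Rightarrow> nat list \<times> edge list" where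
  "contract st = (case snd st of [] \<Rightarrow> st | e # es \<Rightarrow>
     (map (subst_vertex e) (fst st), map (\<lambda>f. (subst_vertex e (fst f), subst_vertex e (snd f))) es))"

definition conn :: "nat list \<Rightarrow> edge list \<Rightarrow> bool" where
  "conn vs es \<longleftrightarrow> (\<forall>x\<in>set (fst ((contract ^^ length es) (vs, es))).
     \<forall>y\<in>set (fst ((contract ^^ length es) (vs, es))). x = y)"

text \<open>The criterion of \<open>mcut_iff_disconnected\<close>: \<open>M\<close> is a matching,
  deleting it disconnects the graph, and sparing any one of its edges does not.\<close>

definition is_sol :: "nat list \<Rightarrow> edge list \<Rightarrow> edge list \<Rightarrow> bool" where
  "is_sol vs es M \<longleftrightarrow>
     (\<forall>e\<in>set M. \<forall>f\<in>set M. e = f \<or>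
        \<not> (fst e = fst f \<or> fst e = snd f \<or> snd e = fst f \<or> snd e = snd f)) \<and>
     \<not> conn vs (filter (\<lambda>f. f \<notin> set M) es) \<and>
     (\<forall>e\<in>set M. conn vs (filter (\<lambda>f. f \<notin> set M \<or> f = e) es))"

definition inc :: "nat \<Rightarrow> 'l labelled \<Rightarrow> 'l labelled" where
  "inc x lab = filter (\<lambda>t. fst (fst t) = x \<or> snd (fst t) = x) lab"

definition opp :: "nat \<Rightarrow> edge \<Rightarrow> nat" where
  "opp x e = (if fst e = x then snd e else fst e)"

definition mk_edge :: "nat \<Rightarrow> nat \<Rightarrow> edge" where
  "mk_edge a b = (if a < b then (a, b) else (b, a))"

definition remove_vertex :: "nat \<Rightarrow> nat list \<times> 'l labelled \<Rightarrow> nat list \<times> 'l labelled" where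
  "remove_vertex u st = (filter (\<lambda>x. x \<noteq> u) (fst st),
     filter (\<lambda>t. \<not> (fst (fst t) = u \<or> snd (fst t) = u)) (snd st))"

text \<open>The label of a suppressed path is the concatenation of the two old labels. A vertex
  without edges is left alone; in a connected graph it can only be the last vertex.\<close>

definition red :: "nat \<Rightarrow> nat list \<times> 'l labelled \<Rightarrow> nat list \<times> 'l labelled" where
  "red u st = (case inc u (snd st) of [] \<Rightarrow> st | t1 # r \<Rightarrow>
     (case r of [] \<Rightarrow> remove_vertex u st | t2 # r' \<Rightarrow>
       if r' = [] \<and> length (inc (opp u (fst t1)) (snd st)) = 2 \<and> length (inc (opp u (fst t2)) (snd st)) = 2 \<and>
         \<not> (\<exists>t\<in>set (snd st). fst t = mk_edge (opp u (fst t1)) (opp u (fst t2)))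
       then (fst (remove_vertex u st),
         (mk_edge (opp u (fst t1)) (opp u (fst t2)), snd t1 @ snd t2) # snd (remove_vertex u st))
       else st))"

text \<open>A rule counts as applicable when it changes the state, so a fixpoint of
  \<open>red_step\<close> is irreducible by construction.\<close>

definition red_step :: "nat list \<times> 'l labelled \<Rightarrow> nat list \<times> 'l labelled" where
  "red_step st = (case filter (\<lambda>u. red u st \<noteq> st) (fst st) of [] \<Rightarrow> st | u # us \<Rightarrow> red u st)"

text \<open>The renumbering preserves the order of the vertices, so edges stay written with the
  smaller end in front, as instances require.\<close>

definition rank :: "nat list \<Rightarrow> nat \<Rightarrow> nat" where
  "rank vs x = length (filter (\<lambda>y. y < x) vs)"

definition rename :: "nat list \<times> 'l labelled \<Rightarrow> nat \<times> 'l labelled" where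
  "rename st = (length (fst st),
     map (\<lambda>t. ((rank (fst st) (fst (fst t)), rank (fst st) (snd (fst t))), snd t)) (snd st))"

text \<open>Every effective step removes a vertex, so \<open>n\<close> rounds reach a
  fixpoint.\<close>

definition reduced :: "nat \<Rightarrow> edge list \<Rightarrow> nat \<times> edge labelled" where
  "reduced n es = rename ((red_step ^^ n) ([0..<n], map (\<lambda>e. (e, [e])) es))"

text \<open>The case \<open>e = f\<close> supplies the single edges. Filtering \<open>es\<close>
  puts the edges in input order, so each edge set has only one representative.\<close>

definition small :: "edge list \<Rightarrow> edge list list" where
  "small es = nub (concat (map (\<lambda>e. map (\<lambda>f. filter (\<lambda>g. g = e \<or> g = f) es) es) es))"

definition selected :: "edge labelled \<Rightarrow> edge list \<Rightarrow> edge labelled" where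
  "selected lab M = filter (\<lambda>t. \<exists>e\<in>set (snd t). e \<in> set M) lab"

text \<open>Labels are disjoint, so as many labels meet \<open>M\<close> as \<open>M\<close> has
  edges exactly if each edge of \<open>M\<close> lies in a label of its own. The labelled edges that
  meet \<open>M\<close> are then the only possible preimage.\<close>

definition lifted :: "nat \<Rightarrow> edge labelled \<Rightarrow> edge list \<Rightarrow> bool" where
  "lifted N lab M \<longleftrightarrow> length (selected lab M) = length M \<and>
     is_sol [0..<N] (map fst lab) (map fst (selected lab M))"

definition missed :: "nat \<Rightarrow> edge list \<Rightarrow> edge list list" where
  "missed n es = filter (\<lambda>M. is_sol [0..<n] es M \<and> \<not> lifted (fst (reduced n es)) (snd (reduced n es)) M) (small es)"

text \<open>A label lists alternatives, and each alternative is a list of edges: a single edge for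
  an ordinary kernel edge, but a whole missed solution for the pendant edge. Both kinds are thus
  enumerated by the same product. The pendant vertex gets the next free number and hangs on vertex
  0.\<close>

definition kern :: "nat \<Rightarrow> edge list \<Rightarrow> nat \<times> edge list labelled" where
  "kern n es = (if conn [0..<n] es then
     (if missed n es = [] then fst (reduced n es) else Suc (fst (reduced n es)),
      map (\<lambda>t. (fst t, map (\<lambda>e. [e]) (snd t))) (snd (reduced n es)) @
        (if missed n es = [] then [] else [((0, fst (reduced n es)), missed n es)]))
     else (2, []))"

definition spanning :: "nat \<Rightarrow> edge list \<Rightarrow> edge list" where
  "spanning n es = fold (\<lambda>e T. if conn [0..<n] (filter (\<lambda>f. f \<noteq> e) T) then filter (\<lambda>f. f \<noteq> e) T else T) es es"

definition mc_kernel :: "mc_instance \<Rightarrow> mc_instance" where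
  "mc_kernel x = (let k = kern (fst x) (fst (snd x)); es = map fst (snd k) in
     (fst k, es, filter (\<lambda>e. \<not> e \<in> set (spanning (fst k) es)) es))"

text \<open>The lifting program is not told the labels, so the kernelization is run again on the
  original instance.\<close>

definition digits :: "mc_instance \<times> edge list \<Rightarrow> edge list list list" where
  "digits z = map snd (filter (\<lambda>t. fst t \<in> set (snd z)) (snd (kern (fst (fst z)) (fst (snd (fst z))))))"

definition lift_out :: "mc_instance \<times> edge list \<Rightarrow> edge list list \<Rightarrow> edge list" where
  "lift_out z cs = filter (\<lambda>e. e \<in> set (concat cs)) (fst (snd (fst z)))"

section \<open>The algorithm takes polynomial time\<close>

lemma pt_subst_vertex: "pt f \<Longrightarrow> pt g \<Longrightarrow> pt (\<lambda>x. subst_vertex (f x) (g x))"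
  unfolding subst_vertex_def by (intro pt_intros)

lemma pt_contract: "pt contract"
  unfolding contract_def by (intro pt_intros pt_subst_vertex)+

text \<open>Substituting one endpoint by the other introduces no larger number and no further
  entries. In unary coding this bounds the size through all contractions.\<close>

lemma contract_bound:
  assumes "\<forall>x\<in>set (fst st). x \<le> b" "\<forall>e\<in>set (snd st). fst e \<le> b \<and> snd e \<le> b"
  shows "(\<forall>x\<in>set (fst (contract st)). x \<le> b) \<and> (\<forall>e\<in>set (snd (contract st)). fst e \<le> b \<and> snd e \<le> b) \<and>
    length (fst (contract st)) = length (fst st) \<and> length (snd (contract st)) = length (snd st) - 1"
  using assms by (auto simp: contract_def subst_vertex_def split: list.split)

lemma contract_pow_bound:
  assumes "\<forall>x\<in>set vs. x \<le> b" "\<forall>e\<in>set es. fst e \<le> b \<and> snd e \<le> b"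
  shows "(\<forall>x\<in>set (fst ((contract ^^ i) (vs, es))). x \<le> b) \<and>
    (\<forall>e\<in>set (snd ((contract ^^ i) (vs, es))). fst e \<le> b \<and> snd e \<le> b) \<and>
    length (fst ((contract ^^ i) (vs, es))) = length vs \<and> length (snd ((contract ^^ i) (vs, es))) = length es - i"
proof (induction i)
  case (Suc i)
  then show ?case using contract_bound[of "(contract ^^ i) (vs, es)" b] by auto
qed (use assms in auto)

lemma esize_edges_le:
  assumes "\<forall>e\<in>set es. fst e \<le> b \<and> snd e \<le> b" shows "esize (es :: edge list) \<le> length es * (2 * b + 2)"
proof -
  have "esize es \<le> length es * ((2 * b + 1) + 1)"
  proof (rule esize_list_le)
    fix e assume "e \<in> set es"
    then have "fst e \<le> b" "snd e \<le> b" using assms by auto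
    then show "esize e \<le> 2 * b + 1" by (simp add: size_enc_prod)
  qed
  then show ?thesis by simp
qed

lemma edge_le_esize: "e \<in> set (es :: edge list) \<Longrightarrow> fst e \<le> esize es \<and> snd e \<le> esize es"
  using esize_mem[of e es] by (simp add: size_enc_prod)

lemma pt_conn: assumes "pt f" "pt g" shows "pt (\<lambda>x. conn (f x) (g x))"
proof (rule pt_apply2[where h = conn])
  have "pt (\<lambda>p :: nat list \<times> edge list. (contract ^^ length (snd p)) p)"
  proof (rule pt_funpow[where b = "pvar * (pvar + pconst 1) + pvar * (pconst 2 * pvar + pconst 2) + pconst 1"])
    show "pt (\<lambda>z :: (nat list \<times> edge list) \<times> (nat list \<times> edge list). contract (fst z))"
      by (rule pt_comp[OF pt_fst[OF pt_ident] pt_contract])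
    fix p :: "nat list \<times> edge list" and i
    obtain vs es where p: "p = (vs, es)" by fastforce
    let ?b = "esize p" and ?st = "(contract ^^ i) p"
    have "\<forall>x\<in>set vs. x \<le> ?b" using esize_mem[of _ vs] by (fastforce simp: p)
    moreover have "\<forall>e\<in>set es. fst e \<le> ?b \<and> snd e \<le> ?b" using edge_le_esize[of _ es] by (fastforce simp: p)
    ultimately have *: "\<forall>x\<in>set (fst ?st). x \<le> ?b" "\<forall>e\<in>set (snd ?st). fst e \<le> ?b \<and> snd e \<le> ?b"
      "length (fst ?st) \<le> ?b" "length (snd ?st) \<le> ?b"
      using contract_pow_bound[of vs ?b es i] length_le_esize[of vs] length_le_esize[of es] by (auto simp: p)
    have "esize (fst ?st) \<le> length (fst ?st) * (?b + 1)" using *(1) by (intro esize_list_le) auto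
    also have "\<dots> \<le> ?b * (?b + 1)" using *(3) by (rule mult_le_mono1)
    finally have 1: "esize (fst ?st) \<le> ?b * (?b + 1)" .
    have "esize (snd ?st) \<le> length (snd ?st) * (2 * ?b + 2)" using *(2) by (rule esize_edges_le)
    also have "\<dots> \<le> ?b * (2 * ?b + 2)" using *(4) by (rule mult_le_mono1)
    finally show "esize ?st \<le> poly (pvar * (pvar + pconst 1) + pvar * (pconst 2 * pvar + pconst 2) + pconst 1) ?b"
      using 1 by (simp add: size_enc_prod[of ?st])
  qed (intro pt_intros)+
  note base = pt_fst[OF this]
  then show "pt (\<lambda>p. conn (fst p) (snd p))" unfolding conn_def prod.collapse
    by (intro pt_ball pt_eq base pt_comp[OF pt_snd[OF pt_ident] base] pt_fst pt_snd pt_ident)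
qed (fact assms)+

lemma pt_is_sol: assumes "pt f" "pt g" "pt h" shows "pt (\<lambda>x. is_sol (f x) (g x) (h x))"
proof -
  have "pt (\<lambda>z :: nat list \<times> edge list \<times> edge list. is_sol (fst z) (fst (snd z)) (snd (snd z)))"
    unfolding is_sol_def by (intro pt_conn pt_intros)
  from pt_comp[OF pt_Pair[OF assms(1) pt_Pair[OF assms(2,3)]] this] show ?thesis by simp
qed

lemma pt_inc: assumes "pt f" "pt (g :: 'x :: encodable \<Rightarrow> 'l :: encodable labelled)" shows "pt (\<lambda>x. inc (f x) (g x))"
  by (rule pt_apply2[OF _ assms]) (unfold inc_def, intro pt_intros)

lemma pt_opp: assumes "pt f" "pt g" shows "pt (\<lambda>x. opp (f x) (g x))"
  unfolding opp_def by (intro pt_intros assms)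

lemma pt_mk_edge: assumes "pt f" "pt g" shows "pt (\<lambda>x. mk_edge (f x) (g x))"
  unfolding mk_edge_def by (intro pt_intros assms)

lemma pt_remove_vertex:
  assumes "pt f" "pt (g :: 'x :: encodable \<Rightarrow> nat list \<times> 'l :: encodable labelled)"
  shows "pt (\<lambda>x. remove_vertex (f x) (g x))"
  by (rule pt_apply2[OF _ assms]) (unfold remove_vertex_def, intro pt_intros)

lemma pt_red:
  assumes "pt f" "pt (g :: 'x :: encodable \<Rightarrow> nat list \<times> 'l :: encodable labelled)"
  shows "pt (\<lambda>x. red (f x) (g x))"
  by (rule pt_apply2[OF _ assms])
    (unfold red_def, intro pt_intros pt_inc pt_opp pt_mk_edge pt_remove_vertex)

lemma pt_red_step: "pt (red_step :: nat list \<times> 'l :: encodable labelled \<Rightarrow> _)"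
  unfolding red_step_def by (intro pt_red pt_intros)

lemma pt_rename: "pt (rename :: nat list \<times> 'l :: encodable labelled \<Rightarrow> _)"
  unfolding rename_def rank_def by (intro pt_intros)

definition weight :: "'l :: encodable labelled \<Rightarrow> nat" where
  "weight lab = (\<Sum>t\<leftarrow>lab. esize (snd t))"

text \<open>Labels grow when they are concatenated, so their individual sizes are no invariant;
  their total weight does not grow.\<close>

definition red_bounded :: "nat \<Rightarrow> nat list \<times> 'l :: encodable labelled \<Rightarrow> bool" where
  "red_bounded b st \<longleftrightarrow> (\<forall>x\<in>set (fst st). x \<le> b) \<and> (\<forall>t\<in>set (snd st). fst (fst t) \<le> b \<and> snd (fst t) \<le> b) \<and>
    length (fst st) \<le> b \<and> length (snd st) \<le> b \<and> weight (snd st) \<le> b"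

lemma inc_split:
  "length lab = length (inc u lab) + length (filter (\<lambda>t. \<not> (fst (fst t) = u \<or> snd (fst t) = u)) lab)"
  "weight lab = weight (inc u lab) + weight (filter (\<lambda>t. \<not> (fst (fst t) = u \<or> snd (fst t) = u)) lab)"
  unfolding inc_def weight_def by (induction lab) auto

lemma set_inc: "set (inc u lab) \<subseteq> set lab"
  by (auto simp: inc_def)

lemma red_bounded_remove: "red_bounded b st \<Longrightarrow> red_bounded b (remove_vertex u st)"
  using inc_split[of "snd st" u]
  by (auto simp: red_bounded_def remove_vertex_def intro: order_trans[OF length_filter_le])

lemma red_bounded_red: assumes "red_bounded b st" shows "red_bounded b (red u st)"
proof (cases "\<exists>t1 t2. inc u (snd st) = [t1, t2]")
  case True
  then obtain t1 t2 where t: "inc u (snd st) = [t1, t2]" by blast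
  then have "t1 \<in> set (snd st)" "t2 \<in> set (snd st)" using set_inc[of u "snd st"] by auto
  then have opp: "opp u (fst t1) \<le> b" "opp u (fst t2) \<le> b" using assms by (auto simp: red_bounded_def opp_def)
  have "weight (inc u (snd st)) = esize (snd t1) + esize (snd t2)" unfolding t by (simp add: weight_def)
  then have "red_bounded b (fst (remove_vertex u st),
      (mk_edge (opp u (fst t1)) (opp u (fst t2)), snd t1 @ snd t2) # snd (remove_vertex u st))"
    using red_bounded_remove[OF assms, of u] inc_split[of "snd st" u] opp assms t
    by (auto simp: red_bounded_def remove_vertex_def mk_edge_def weight_def esize_append)
  then show ?thesis using assms t by (auto simp: red_def)
next
  case False
  then have "red u st = st \<or> red u st = remove_vertex u st" by (auto simp: red_def split: list.split)
  then show ?thesis using red_bounded_remove[OF assms] assms by metis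
qed

lemma red_bounded_step: "red_bounded b st \<Longrightarrow> red_bounded b (red_step st)"
  by (auto simp: red_step_def red_bounded_red split: list.split)

lemma red_bounded_esize: assumes "red_bounded b st" shows "esize st \<le> b * (b + 1) + b * (2 * b + 3) + b + 1"
proof -
  have "esize (fst st) \<le> length (fst st) * (b + 1)" using assms by (intro esize_list_le) (auto simp: red_bounded_def)
  also have "\<dots> \<le> b * (b + 1)" using assms by (intro mult_le_mono1) (simp add: red_bounded_def)
  finally have 1: "esize (fst st) \<le> b * (b + 1)" .
  have "esize lab \<le> length lab * (2 * b + 3) + weight lab"
    if "\<forall>t\<in>set lab. fst (fst t) \<le> b \<and> snd (fst t) \<le> b" for lab :: "'a labelled"
    using that
  proof (induction lab)
    case (Cons t lab)
    then have "esize (fst t) \<le> 2 * b + 1" by (simp add: size_enc_prod)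
    with Cons show ?case by (simp add: weight_def size_enc_prod[of t])
  qed simp
  then have "esize (snd st) \<le> length (snd st) * (2 * b + 3) + weight (snd st)" using assms by (auto simp: red_bounded_def)
  also have "\<dots> \<le> b * (2 * b + 3) + b" using assms by (intro add_mono mult_le_mono1) (auto simp: red_bounded_def)
  finally show ?thesis using 1 by (simp add: size_enc_prod[of st])
qed

lemma pt_reduced: assumes "pt f" "pt g" shows "pt (\<lambda>x. reduced (f x) (g x))"
proof (rule pt_apply2[OF _ assms, where h = reduced])
  let ?s = "\<lambda>p :: nat \<times> edge list. ([0..<fst p], map (\<lambda>e. (e, [e])) (snd p))"
  have s: "pt ?s" by (intro pt_intros)
  obtain r where r: "esize (?s p) \<le> poly r (esize p)" for p using pt_esize[OF s] by blast
  have "pt (\<lambda>p. (red_step ^^ fst p) (?s p))"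
  proof (rule pt_funpow[where b = "r * (r + pconst 1) + r * (pconst 2 * r + pconst 3) + r + pconst 1"])
    show "pt (\<lambda>z :: (nat list \<times> edge labelled) \<times> (nat \<times> edge list). red_step (fst z))"
      by (rule pt_comp[OF pt_fst[OF pt_ident] pt_red_step])
    fix p :: "nat \<times> edge list" and i
    let ?b = "poly r (esize p)"
    have le: "esize (fst (?s p)) \<le> ?b" "esize (snd (?s p)) \<le> ?b" using r[of p] by auto
    have "red_bounded ?b (?s p)"
      unfolding red_bounded_def
    proof (intro conjI ballI)
      fix x assume "x \<in> set (fst (?s p))"
      then show "x \<le> ?b" using esize_mem le(1) by fastforce
    next
      fix t assume t: "t \<in> set (snd (?s p))"
      then have "esize t \<le> ?b" using esize_mem[OF t] le(2) by linarith
      then show "fst (fst t) \<le> ?b" "snd (fst t) \<le> ?b" by (auto simp: size_enc_prod)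
    next
      show "length (fst (?s p)) \<le> ?b" "length (snd (?s p)) \<le> ?b"
        using le length_le_esize[of "fst (?s p)"] length_le_esize[of "snd (?s p)"] by auto
      have "weight lab \<le> esize lab" for lab :: "edge labelled"
        by (induction lab) (auto simp: weight_def size_enc_prod)
      then show "weight (snd (?s p)) \<le> ?b" using le(2) order_trans by blast
    qed
    then have "red_bounded ?b ((red_step ^^ i) (?s p))" by (induction i) (auto simp: red_bounded_step)
    from red_bounded_esize[OF this]
    show "esize ((red_step ^^ i) (?s p)) \<le> poly (r * (r + pconst 1) + r * (pconst 2 * r + pconst 3) + r + pconst 1) (esize p)"
      by simp
  qed (intro pt_intros s)+
  from pt_comp[OF this pt_rename] show "pt (\<lambda>p. reduced (fst p) (snd p))" unfolding reduced_def .
qed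

lemma pt_small: "pt f \<Longrightarrow> pt (\<lambda>x. small (f x))"
  by (rule pt_comp[where g = small], assumption) (unfold small_def, intro pt_intros)

lemma pt_selected: assumes "pt f" "pt g" shows "pt (\<lambda>x. selected (f x) (g x))"
  by (rule pt_apply2[OF _ assms]) (unfold selected_def, intro pt_intros)

lemma pt_lifted: assumes "pt f" "pt g" "pt h" shows "pt (\<lambda>x. lifted (f x) (g x) (h x))"
  unfolding lifted_def by (intro pt_conj pt_eq pt_is_sol pt_map pt_length pt_selected pt_upt pt_fst pt_ident assms)

lemma pt_missed: assumes "pt f" "pt g" shows "pt (\<lambda>x. missed (f x) (g x))"
  by (rule pt_apply2[OF _ assms])
    (unfold missed_def, intro pt_filter pt_conj pt_not pt_is_sol pt_lifted pt_reduced pt_small pt_upt pt_fst pt_snd pt_ident)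

lemma pt_kern: assumes "pt f" "pt g" shows "pt (\<lambda>x. kern (f x) (g x))"
  by (rule pt_apply2[OF _ assms])
    (unfold kern_def, intro pt_if pt_conn pt_upt pt_Pair pt_eq pt_Suc pt_append pt_map pt_Cons pt_const
      pt_missed pt_reduced pt_fst pt_snd pt_ident)

lemma spanning_fold_subset:
  "esize (fold (\<lambda>e T. if P e T then filter (\<lambda>f. f \<noteq> e) T else T) es T) \<le> esize T"
proof (induction es arbitrary: T)
  case (Cons e es)
  then show ?case using esize_filter[of "\<lambda>f. f \<noteq> e" T] order_trans by (auto; blast)
qed simp

lemma pt_spanning: assumes "pt f" "pt g" shows "pt (\<lambda>x. spanning (f x) (g x))"
proof (rule pt_apply2[OF _ assms, where h = spanning])
  show "pt (\<lambda>p. spanning (fst p) (snd p))"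
    unfolding spanning_def
  proof (rule pt_fold[where b = pvar])
    fix p :: "nat \<times> edge list" and ys zs
    show "esize (fold (\<lambda>e T. if conn [0..<fst p] (filter (\<lambda>f. f \<noteq> e) T) then filter (\<lambda>f. f \<noteq> e) T else T) ys (snd p))
        \<le> poly pvar (esize p)"
      using spanning_fold_subset[of "\<lambda>e T. conn [0..<fst p] (filter (\<lambda>f. f \<noteq> e) T)" ys "snd p"]
      by (simp add: size_enc_prod[of p])
  qed (intro pt_if pt_conn pt_filter pt_not pt_eq pt_upt pt_fst pt_snd pt_ident)+
qed

lemma pt_kernel: "pt mc_kernel"
  unfolding mc_kernel_def Let_def
  by (intro pt_Pair pt_filter pt_not pt_member pt_spanning pt_map pt_kern pt_fst pt_snd pt_ident)

lemma pt_digits: "pt digits"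
  unfolding digits_def by (intro pt_map pt_filter pt_member pt_kern pt_fst pt_snd pt_ident)

lemma pt_lift_out: "pt (\<lambda>z. lift_out (fst z) (snd z))"
  unfolding lift_out_def by (intro pt_filter pt_member pt_concat pt_fst pt_snd pt_ident)

section \<open>Correctness of the algorithm\<close>

definition uedge :: "edge \<Rightarrow> nat set" where
  "uedge e = {fst e, snd e}"

definition wf_edges :: "nat set \<Rightarrow> edge set \<Rightarrow> bool" where
  "wf_edges V F \<longleftrightarrow> (\<forall>e\<in>F. fst e < snd e \<and> fst e \<in> V \<and> snd e \<in> V)"

lemma uedge_eq_iff: "fst e < snd e \<Longrightarrow> fst f < snd f \<Longrightarrow> uedge e = uedge f \<longleftrightarrow> e = f"
  by (auto simp: uedge_def doubleton_eq_iff prod_eq_iff)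

lemma inj_on_uedge: "wf_edges V F \<Longrightarrow> inj_on uedge F"
  by (auto simp: wf_edges_def inj_on_def uedge_eq_iff)

lemma simple_graph_uedge: "finite V \<Longrightarrow> wf_edges V F \<Longrightarrow> simple_graph V (uedge ` F)"
  by (fastforce simp: simple_graph_def wf_edges_def uedge_def card_insert_if)

text \<open>Contraction produces loops and edges in the wrong order, so the states in between
  violate \<open>wf_edges\<close>. This form of disconnectedness makes sense for arbitrary
  pairs.\<close>

definition separated :: "nat set \<Rightarrow> edge set \<Rightarrow> bool" where
  "separated V F \<longleftrightarrow> (\<exists>A. (\<exists>x\<in>V. x \<in> A) \<and> (\<exists>x\<in>V. x \<notin> A) \<and> (\<forall>e\<in>F. fst e \<in> A \<longleftrightarrow> snd e \<in> A))"

text \<open>A separating set of the contracted graph is pulled back along the substitution.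
  Conversely, a separating set contains both ends of the contracted edge or neither, so the
  substitution respects it.\<close>

lemma separated_contract:
  "separated (set (fst (contract st))) (set (snd (contract st))) \<longleftrightarrow> separated (set (fst st)) (set (snd st))"
proof (cases "snd st")
  case (Cons e es)
  obtain vs where st: "st = (vs, e # es)" using Cons by (cases st) auto
  have c: "contract st = (map (subst_vertex e) vs, map (\<lambda>f. (subst_vertex e (fst f), subst_vertex e (snd f))) es)"
    by (simp add: contract_def st)
  show ?thesis
  proof
    assume "separated (set (fst (contract st))) (set (snd (contract st)))"
    then obtain A where A: "\<exists>x\<in>set vs. subst_vertex e x \<in> A" "\<exists>x\<in>set vs. subst_vertex e x \<notin> A"
      "\<forall>f\<in>set es. subst_vertex e (fst f) \<in> A \<longleftrightarrow> subst_vertex e (snd f) \<in> A"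
      unfolding separated_def c by auto
    moreover have "subst_vertex e (fst e) = subst_vertex e (snd e)" by (simp add: subst_vertex_def)
    ultimately show "separated (set (fst st)) (set (snd st))"
      unfolding separated_def st by (intro exI[of _ "{x. subst_vertex e x \<in> A}"]) auto
  next
    assume "separated (set (fst st)) (set (snd st))"
    then obtain A where A: "\<exists>x\<in>set vs. x \<in> A" "\<exists>x\<in>set vs. x \<notin> A"
      "\<forall>f\<in>set (e # es). fst f \<in> A \<longleftrightarrow> snd f \<in> A"
      unfolding separated_def st by auto
    then have "subst_vertex e x \<in> A \<longleftrightarrow> x \<in> A" for x by (simp add: subst_vertex_def)
    then show "separated (set (fst (contract st))) (set (snd (contract st)))"
      unfolding separated_def c using A by (intro exI[of _ A]) auto
  qed
qed (simp add: contract_def)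

lemma conn_iff_separated: "conn vs es \<longleftrightarrow> \<not> separated (set vs) (set es)"
proof -
  have len: "length (snd ((contract ^^ i) st)) = length (snd st) - i" for i st
    by (induction i) (auto simp: contract_def split: list.split)
  have sep: "separated (set (fst ((contract ^^ i) st))) (set (snd ((contract ^^ i) st))) \<longleftrightarrow>
      separated (set (fst st)) (set (snd st))" for i st
    by (induction i) (auto simp: separated_contract)
  let ?st = "(contract ^^ length es) (vs, es)"
  have "snd ?st = []" using len[of "length es" "(vs, es)"] by simp
  then have "separated (set vs) (set es) \<longleftrightarrow> separated (set (fst ?st)) {}"
    using sep[of "length es" "(vs, es)"] by simp
  also have "\<dots> \<longleftrightarrow> (\<exists>x\<in>set (fst ?st). \<exists>y\<in>set (fst ?st). x \<noteq> y)"
  proof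
    assume "separated (set (fst ?st)) {}"
    then obtain A x y where "x \<in> set (fst ?st)" "y \<in> set (fst ?st)" "x \<in> A" "y \<notin> A"
      unfolding separated_def by blast
    then show "\<exists>x\<in>set (fst ?st). \<exists>y\<in>set (fst ?st). x \<noteq> y" by metis
  next
    assume "\<exists>x\<in>set (fst ?st). \<exists>y\<in>set (fst ?st). x \<noteq> y"
    then obtain x y where "x \<in> set (fst ?st)" "y \<in> set (fst ?st)" "x \<noteq> y" by blast
    then show "separated (set (fst ?st)) {}" unfolding separated_def by (intro exI[of _ "{x}"]) auto
  qed
  finally show ?thesis unfolding conn_def by blast
qed

lemma separated_iff_disconnected:
  assumes "wf_edges V F" shows "separated V F \<longleftrightarrow> disconnected V (uedge ` F)"
proof
  assume "separated V F"
  then obtain A where A: "\<exists>x\<in>V. x \<in> A" "\<exists>x\<in>V. x \<notin> A" "\<forall>e\<in>F. fst e \<in> A \<longleftrightarrow> snd e \<in> A"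
    by (auto simp: separated_def)
  have "uedge e \<inter> (A \<inter> V) = {} \<or> uedge e \<subseteq> A \<inter> V" if "e \<in> F" for e
    using A(3) assms that by (auto simp: uedge_def wf_edges_def)
  then have "bd (uedge ` F) (A \<inter> V) = {}" by (auto simp: bd_def)
  then show "disconnected V (uedge ` F)" unfolding disconnected_def
    using A(1,2) by (intro exI[of _ "A \<inter> V"]) auto
next
  assume "disconnected V (uedge ` F)"
  then obtain A where A: "A \<subset> V" "A \<noteq> {}" "bd (uedge ` F) A = {}" by (auto simp: disconnected_def)
  have "fst e \<in> A \<longleftrightarrow> snd e \<in> A" if "e \<in> F" for e
    by (rule bd_closed[OF A(3)]) (use that in \<open>auto simp: uedge_def\<close>)
  then show "separated V F" unfolding separated_def using A(1,2) by (intro exI[of _ A]) auto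
qed

lemma conn_iff: "wf_edges (set vs) (set es) \<Longrightarrow> conn vs es \<longleftrightarrow> \<not> disconnected (set vs) (uedge ` set es)"
  by (simp add: conn_iff_separated separated_iff_disconnected)

lemma is_sol_iff:
  assumes wf: "wf_edges (set vs) (set es)" and M: "set M \<subseteq> set es"
  shows "is_sol vs es M \<longleftrightarrow> uedge ` set M \<in> sols (set vs) (uedge ` set es)"
proof -
  have inj: "inj_on uedge (set es)" by (rule inj_on_uedge[OF wf])
  have diff: "uedge ` (set es - Y) = uedge ` set es - uedge ` Y" if "Y \<subseteq> set es" for Y
    using inj_on_image_set_diff[OF inj, of "set es" Y] that by simp
  have cn: "conn vs (filter P es) \<longleftrightarrow> \<not> disconnected (set vs) (uedge ` {e \<in> set es. P e})" for P
  proof -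
    have "wf_edges (set vs) (set (filter P es))" using wf by (simp add: wf_edges_def)
    from conn_iff[OF this] show ?thesis by simp
  qed
  have "conn vs (filter (\<lambda>f. f \<notin> set M) es) \<longleftrightarrow> \<not> disconnected (set vs) (uedge ` set es - uedge ` set M)"
    unfolding cn diff[OF M, symmetric] by (simp add: set_diff_eq)
  moreover have "conn vs (filter (\<lambda>f. f \<notin> set M \<or> f = e) es) \<longleftrightarrow>
      \<not> disconnected (set vs) (uedge ` set es - (uedge ` set M - {uedge e}))" if "e \<in> set M" for e
  proof -
    have 1: "uedge ` set M - {uedge e} = uedge ` (set M - {e})"
      using inj_on_image_set_diff[OF inj, of "set M" "{e}"] M that by auto
    have 2: "{f \<in> set es. f \<notin> set M \<or> f = e} = set es - (set M - {e})" using that M by blast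
    have "set M - {e} \<subseteq> set es" using M by blast
    from diff[OF this] show ?thesis unfolding cn 1 2 by simp
  qed
  moreover have "(\<forall>e\<in>set M. \<forall>f\<in>set M. e = f \<or>
        \<not> (fst e = fst f \<or> fst e = snd f \<or> snd e = fst f \<or> snd e = snd f)) \<longleftrightarrow> disjoint (uedge ` set M)"
  proof -
    have eq: "uedge e = uedge f \<longleftrightarrow> e = f" if "e \<in> set M" "f \<in> set M" for e f
      using inj M that by (meson inj_on_eq_iff subset_iff)
    have "disjoint (uedge ` set M) \<longleftrightarrow> (\<forall>e\<in>set M. \<forall>f\<in>set M. e \<noteq> f \<longrightarrow> uedge e \<inter> uedge f = {})"
      unfolding disjoint_def by (simp add: eq cong: ball_cong)
    moreover have "uedge e \<inter> uedge f = {} \<longleftrightarrow> \<not> (fst e = fst f \<or> fst e = snd f \<or> snd e = fst f \<or> snd e = snd f)" for e f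
      by (auto simp: uedge_def)
    ultimately show ?thesis by (simp only:) blast
  qed
  moreover have "simple_graph (set vs) (uedge ` set es)" using wf by (intro simple_graph_uedge) auto
  ultimately show ?thesis
    unfolding is_sol_def sols_iff[OF \<open>simple_graph _ _\<close>] mcut_iff_disconnected using M by auto
qed

lemma lifts_cong: "(\<And>f. f \<in> F \<Longrightarrow> l f = l' f) \<Longrightarrow> lifts S l F S' \<Longrightarrow> lifts S l' F S'"
proof -
  assume eq: "\<And>f. f \<in> F \<Longrightarrow> l f = l' f" and l: "lifts S l F S'"
  have Pi: "Pi s l = Pi s l'" if "s \<in> S'" for s
    using eq liftsD(2)[OF l that] by (auto simp: Pi_def)
  have "disjoint_family_on l' F"
    using liftsD(1)[OF l] eq by (simp add: disjoint_family_on_def)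
  then show ?thesis using l Pi unfolding lifts_def by auto
qed

section \<open>The invariant of the reductions\<close>

definition Lab :: "edge labelled \<Rightarrow> nat set \<Rightarrow> nat set set" where
  "Lab lab e = (\<Union>t\<in>{t \<in> set lab. uedge (fst t) = e}. uedge ` set (snd t))"

definition EH :: "'l labelled \<Rightarrow> nat set set" where
  "EH lab = (\<lambda>t. uedge (fst t)) ` set lab"

lemma EHE: "e \<in> EH lab \<Longrightarrow> (\<And>t. t \<in> set lab \<Longrightarrow> e = uedge (fst t) \<Longrightarrow> thesis) \<Longrightarrow> thesis"
  unfolding EH_def by blast

definition wf_state :: "nat list \<times> 'l labelled \<Rightarrow> bool" where
  "wf_state st \<longleftrightarrow> distinct (fst st) \<and> distinct (map fst (snd st)) \<and> wf_edges (set (fst st)) (fst ` set (snd st)) \<and>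
    (\<forall>t\<in>set (snd st). snd t \<noteq> []) \<and> distinct (concat (map snd (snd st)))"

text \<open>The last conjunct says that |E| - |V| is unchanged, written without subtraction. It
  transports the bound by the feedback edge number to the reduced graph.\<close>

definition invar :: "nat \<Rightarrow> edge list \<Rightarrow> nat list \<times> edge labelled \<Rightarrow> bool" where
  "invar n es st \<longleftrightarrow> wf_state st \<and> set (concat (map snd (snd st))) \<subseteq> set es \<and>
    lifts (sols {..<n} (uedge ` set es)) (Lab (snd st)) (EH (snd st)) (sols (set (fst st)) (EH (snd st))) \<and>
    card (EH (snd st)) + n = card (uedge ` set es) + card (set (fst st))"

lemma wf_state_simple_graph: "wf_state st \<Longrightarrow> simple_graph (set (fst st)) (EH (snd st))"
  unfolding EH_def wf_state_def image_image[symmetric, of uedge fst] by (intro simple_graph_uedge) auto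

lemma wf_stateD:
  assumes "wf_state st" "t \<in> set (snd st)"
  shows "fst (fst t) < snd (fst t)" "fst (fst t) \<in> set (fst st)" "snd (fst t) \<in> set (fst st)" "snd t \<noteq> []"
  using assms unfolding wf_state_def wf_edges_def by (auto simp del: snd_eqD)

lemma wf_state_ust_eq:
  assumes "wf_state st" "t \<in> set (snd st)" "t' \<in> set (snd st)" shows "uedge (fst t) = uedge (fst t') \<longleftrightarrow> t = t'"
proof
  assume "uedge (fst t) = uedge (fst t')"
  then have "fst t = fst t'" using wf_stateD(1)[OF assms(1)] assms(2,3) by (simp add: uedge_eq_iff)
  then show "t = t'" using assms by (metis distinct_map inj_onD wf_state_def)
qed simp

lemma Lab_eq: "wf_state st \<Longrightarrow> t \<in> set (snd st) \<Longrightarrow> Lab (snd st) (uedge (fst t)) = uedge ` set (snd t)"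
  unfolding Lab_def using wf_state_ust_eq[of st] by blast

lemma inc_iff: "t \<in> set (inc x lab) \<longleftrightarrow> t \<in> set lab \<and> x \<in> uedge (fst t)"
  by (auto simp: inc_def uedge_def)

lemma opp_uedge: "x \<in> uedge e \<Longrightarrow> fst e < snd e \<Longrightarrow> uedge e = {x, opp x e} \<and> opp x e \<noteq> x"
  by (auto simp: uedge_def opp_def)

lemma uedge_mk_edge: "uedge (mk_edge a b) = {a, b}"
  by (auto simp: uedge_def mk_edge_def)

text \<open>Reductions rearrange the labels. Multisets ignore the order, which lets the disjointness
  of all labels be carried over.\<close>

lemma mset_concat_split:
  "mset (concat (map snd lab)) = mset (concat (map snd (inc u lab))) +
    mset (concat (map snd (filter (\<lambda>t. \<not> (fst (fst t) = u \<or> snd (fst t) = u)) lab)))"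
  unfolding inc_def by (induction lab) auto

lemma wf_state_remove: "wf_state st \<Longrightarrow> wf_state (remove_vertex u st)"
proof -
  assume wf: "wf_state st"
  let ?l = "filter (\<lambda>t. \<not> (fst (fst t) = u \<or> snd (fst t) = u)) (snd st)"
  have "distinct (map fst ?l)" using wf by (auto simp: wf_state_def distinct_map intro: inj_on_subset)
  moreover have "mset (concat (map snd (snd st))) = mset (concat (map snd (inc u (snd st))) @ concat (map snd ?l))"
    using mset_concat_split[of "snd st" u] by simp
  from mset_eq_imp_distinct_iff[OF this]
  have "distinct (concat (map snd (inc u (snd st))) @ concat (map snd ?l))"
    using wf unfolding wf_state_def by blast
  moreover have "wf_edges (set (filter (\<lambda>x. x \<noteq> u) (fst st))) (fst ` set ?l)"
    using wf unfolding wf_state_def wf_edges_def by auto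
  ultimately show ?thesis using wf by (auto simp: wf_state_def remove_vertex_def)
qed

lemma remove_vertex_sets:
  "set (fst (remove_vertex u st)) = set (fst st) - {u}"
  "set (snd (remove_vertex u st)) = {t \<in> set (snd st). u \<notin> uedge (fst t)}"
  by (auto simp: remove_vertex_def uedge_def)

lemma EH_remove: "EH (snd (remove_vertex u st)) = {e \<in> EH (snd st). u \<notin> e}"
  unfolding EH_def remove_vertex_sets by auto

lemma Lab_remove: "u \<notin> e \<Longrightarrow> Lab (snd (remove_vertex u st)) e = Lab (snd st) e"
  unfolding Lab_def remove_vertex_sets by auto

lemma invar_remove:
  assumes inv: "invar n es st" and u: "u \<in> set (fst st)" and t: "inc u (snd st) = [t]"
  shows "invar n es (remove_vertex u st)"
proof -
  let ?E = "EH (snd st)" and ?V = "set (fst st)" and ?st = "remove_vertex u st"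
  have wf: "wf_state st" using inv by (simp add: invar_def)
  have tl: "t \<in> set (snd st)" "u \<in> uedge (fst t)" using inc_iff[of t u "snd st"] t by auto
  define w where "w = opp u (fst t)"
  have w: "uedge (fst t) = {u, w}" "w \<noteq> u" using opp_uedge[OF tl(2) wf_stateD(1)[OF wf tl(1)]] by (auto simp: w_def)
  have leaf: "e = {u, w}" if e: "e \<in> ?E" "u \<in> e" for e
  proof -
    obtain t' where t': "t' \<in> set (snd st)" "e = uedge (fst t')" using e(1) by (rule EHE)
    then have "t' = t" using inc_iff[of t' u "snd st"] e(2) t by simp
    then show ?thesis using t' w by simp
  qed
  have uw: "{u, w} \<in> ?E" "w \<in> ?V"
    using tl w wf_stateD(2,3)[OF wf tl(1)] by (auto simp: EH_def uedge_def doubleton_eq_iff intro: rev_image_eqI)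
  have E': "EH (snd ?st) = ?E - {{u, w}}" unfolding EH_remove using leaf by blast
  have simple: "simple_graph ?V ?E" by (rule wf_state_simple_graph[OF wf])
  note leaf_lifts = leaf_lifts[OF simple u uw(2) w(2)[symmetric] uw(1) leaf]
  have l: "lifts (sols {..<n} (uedge ` set es)) (Lab (snd st)) ?E (sols ?V ?E)" using inv by (simp add: invar_def)
  have "lifts (sols {..<n} (uedge ` set es)) (\<lambda>f. \<Union> (Lab (snd st) ` {f})) (?E - {{u, w}}) (sols (?V - {u}) (?E - {{u, w}}))"
    by (rule lifts_trans[OF l leaf_lifts(2)]) auto
  then have "lifts (sols {..<n} (uedge ` set es)) (Lab (snd ?st)) (?E - {{u, w}}) (sols (?V - {u}) (?E - {{u, w}}))"
  proof (rule lifts_cong[rotated])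
    fix f assume "f \<in> ?E - {{u, w}}"
    then have "u \<notin> f" using leaf by blast
    then show "\<Union> (Lab (snd st) ` {f}) = Lab (snd ?st) f" by (simp add: Lab_remove)
  qed
  moreover have "card ?E = Suc (card (?E - {{u, w}}))" "card ?V = Suc (card (?V - {u}))"
    using uw(1) u simple_graph_finite[OF simple] by (metis card_Suc_Diff1)+
  moreover have "set (concat (map snd (snd ?st))) \<subseteq> set es"
    using inv unfolding invar_def by (auto simp: remove_vertex_sets)
  ultimately show ?thesis using wf_state_remove[OF wf, of u] inv
    unfolding invar_def E' remove_vertex_sets(1) by simp
qed

text \<open>A list of two incident edges yields the form of the degree conditions that
  \<open>suppress_lifts\<close> requires: the known edge or one fixed other edge.\<close>

lemma two_incident:
  assumes "length (inc a lab) = 2" "t \<in> set lab" "a \<in> uedge (fst t)"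
  obtains h where "\<And>e. e \<in> EH lab \<Longrightarrow> a \<in> e \<Longrightarrow> e = uedge (fst t) \<or> e = h"
proof -
  obtain p q where pq: "inc a lab = [p, q]" using assms(1) by (auto simp: length_Suc_conv numeral_2_eq_2)
  have "t = p \<or> t = q" using inc_iff[of t a lab] assms(2,3) pq by simp
  then have "set (inc a lab) = {t, if t = p then q else p}" using pq by auto
  then obtain s where s: "set (inc a lab) = {t, s}" by blast
  have "e = uedge (fst t) \<or> e = uedge (fst s)" if e: "e \<in> EH lab" "a \<in> e" for e
  proof -
    obtain t' where t': "t' \<in> set lab" "e = uedge (fst t')" using e(1) by (rule EHE)
    then have "t' \<in> set (inc a lab)" using e(2) by (simp add: inc_iff)
    then show ?thesis using t' s by auto
  qed
  then show ?thesis by (rule that)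
qed

lemma invar_suppress:
  assumes inv: "invar n es st" and u: "u \<in> set (fst st)" and t: "inc u (snd st) = [t1, t2]"
    and a: "a = opp u (fst t1)" and v: "v = opp u (fst t2)"
    and deg: "length (inc a (snd st)) = 2" "length (inc v (snd st)) = 2"
    and new: "\<not> (\<exists>t\<in>set (snd st). fst t = mk_edge a v)"
  shows "invar n es (fst (remove_vertex u st), (mk_edge a v, snd t1 @ snd t2) # snd (remove_vertex u st))"
    (is "invar n es ?st")
proof -
  let ?E = "EH (snd st)" and ?V = "set (fst st)" and ?r = "remove_vertex u st"
  have wf: "wf_state st" using inv by (simp add: invar_def)
  have t1: "t1 \<in> set (snd st)" "u \<in> uedge (fst t1)" and t2: "t2 \<in> set (snd st)" "u \<in> uedge (fst t2)"
    using inc_iff[of t1 u "snd st"] inc_iff[of t2 u "snd st"] t by auto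
  have e1: "uedge (fst t1) = {a, u}" "a \<noteq> u"
    using opp_uedge[OF t1(2) wf_stateD(1)[OF wf t1(1)]] by (auto simp: a insert_commute)
  have e2: "uedge (fst t2) = {u, v}" "v \<noteq> u"
    using opp_uedge[OF t2(2) wf_stateD(1)[OF wf t2(1)]] by (auto simp: v)
  have "distinct (map fst (inc u (snd st)))"
    using wf by (auto simp: wf_state_def inc_def distinct_map intro: inj_on_subset)
  then have "t1 \<noteq> t2" using t by auto
  then have av: "a \<noteq> v" using wf_state_ust_eq[OF wf t1(1) t2(1)] e1 e2 by (auto simp: insert_commute)
  have inV: "a \<in> ?V" "v \<in> ?V"
    using wf_stateD(2,3)[OF wf t1(1)] wf_stateD(2,3)[OF wf t2(1)] by (auto simp: a v opp_def)
  have mk: "fst (mk_edge a v) < snd (mk_edge a v)" using av by (auto simp: mk_edge_def)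
  have avE: "{a, v} \<notin> ?E"
  proof
    assume "{a, v} \<in> ?E"
    then obtain t' where "t' \<in> set (snd st)" "{a, v} = uedge (fst t')" by (rule EHE)
    then have t': "t' \<in> set (snd st)" "uedge (fst t') = uedge (mk_edge a v)" by (simp_all add: uedge_mk_edge)
    then have "fst t' = mk_edge a v" using uedge_eq_iff[OF wf_stateD(1)[OF wf t'(1)] mk] by simp
    then show False using new t'(1) by blast
  qed
  have simple: "simple_graph ?V ?E" by (rule wf_state_simple_graph[OF wf])
  have deg_u: "e = {a, u} \<or> e = {u, v}" if e: "e \<in> ?E" "u \<in> e" for e
  proof -
    obtain t' where t': "t' \<in> set (snd st)" "e = uedge (fst t')" using e(1) by (rule EHE)
    then have "t' = t1 \<or> t' = t2" using inc_iff[of t' u "snd st"] e(2) t by simp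
    then show ?thesis using t' e1 e2 by auto
  qed
  have E12: "{a, u} \<in> ?E" "{u, v} \<in> ?E" using t1(1) t2(1) e1 e2 by (auto simp: EH_def intro: rev_image_eqI)
  interpret suppress ?V ?E a u v
    using simple E12 av avE deg_u by unfold_locales
  obtain h where h: "\<And>e. e \<in> ?E \<Longrightarrow> a \<in> e \<Longrightarrow> e = {a, u} \<or> e = h"
    using two_incident[OF deg(1) t1(1)] e1 by auto
  obtain g where g: "\<And>e. e \<in> ?E \<Longrightarrow> v \<in> e \<Longrightarrow> e = {u, v} \<or> e = g"
    using two_incident[OF deg(2) t2(1)] e2 by auto
  note sl = suppress_lifts[OF h g]
  have V': "set (fst ?st) = V'" by (simp add: V'_def remove_vertex_sets)
  have "{e \<in> ?E. u \<notin> e} = ?E - {{a, u}, {u, v}}" using deg_u by blast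
  then have "EH (snd ?r) = ?E - {{a, u}, {u, v}}" using EH_remove[of u st] by simp
  moreover have "EH (snd ?st) = insert {a, v} (EH (snd ?r))" by (simp add: EH_def uedge_mk_edge)
  ultimately have E': "EH (snd ?st) = E'" by (simp add: E'_def)
  have Lab': "\<Union> (Lab (snd st) ` l f) = Lab (snd ?st) f" if "f \<in> E'" for f
  proof -
    have uf: "u \<notin> f" by (rule E'_u[OF that])
    have ins: "Lab (snd ?st) f = (if f = {a, v} then uedge ` set (snd t1 @ snd t2) else {}) \<union> Lab (snd ?r) f"
      unfolding Lab_def by (auto simp: uedge_mk_edge)
    show ?thesis
    proof (cases "f = {a, v}")
      case True
      \<comment> \<open>{a,v} was no edge before, so nothing but the two joined labels contributes
        to its new label.\<close>
      have "Lab (snd ?r) f = {}"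
      proof -
        have no: "{t \<in> set (snd st). uedge (fst t) = f} = {}"
        proof (intro equals0I)
          fix t assume "t \<in> {t \<in> set (snd st). uedge (fst t) = f}"
          then have "f \<in> ?E" unfolding EH_def by blast
          then show False using avE True by simp
        qed
        have "Lab (snd st) f = {}" unfolding Lab_def no by simp
        then show ?thesis by (simp add: Lab_remove[OF uf])
      qed
      then show ?thesis using True Lab_eq[OF wf t1(1)] Lab_eq[OF wf t2(1)] e1 e2 unfolding ins l_def by auto
    next
      case False
      then show ?thesis unfolding ins l_def by (simp add: Lab_remove[OF uf])
    qed
  qed
  have l: "lifts (sols {..<n} (uedge ` set es)) (Lab (snd st)) ?E (sols ?V ?E)" using inv by (simp add: invar_def)
  have "lifts (sols {..<n} (uedge ` set es)) (\<lambda>f. \<Union> (Lab (snd st) ` l f)) E' (sols V' E')"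
    by (rule lifts_trans[OF l sl]) (use E12 in \<open>auto simp: l_def E'_def split: if_splits\<close>)
  then have lift: "lifts (sols {..<n} (uedge ` set es)) (Lab (snd ?st)) E' (sols V' E')"
    by (rule lifts_cong[rotated]) (rule Lab')
  have fin: "finite ?E" "finite ?V" using simple_graph_finite[OF simple] by auto
  have "card E' = Suc (card (?E - {{a, u}, {u, v}}))" unfolding E'_def using fin avE by simp
  moreover have "card {{a, u}, {u, v}} = 2" using ne by simp
  then have "card ?E = card (?E - {{a, u}, {u, v}}) + 2"
    using fin E12 card_mono[of ?E "{{a, u}, {u, v}}"] by (simp add: card_Diff_subset)
  moreover have "card ?V = Suc (card V')" using u fin(2) unfolding V'_def by (metis card_Suc_Diff1)
  ultimately have card: "card E' + n = card (uedge ` set es) + card V'" using inv by (simp add: invar_def)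
  have concat_inc: "concat (map snd (inc u (snd st))) = snd t1 @ snd t2" by (simp add: t)
  have mset: "mset (concat (map snd (snd st))) = mset (concat (map snd (snd ?st)))"
    using mset_concat_split[of "snd st" u] unfolding concat_inc by (simp add: remove_vertex_def)
  then have conc: "distinct (concat (map snd (snd ?st)))" "set (concat (map snd (snd ?st))) \<subseteq> set es"
    unfolding mset_eq_imp_distinct_iff[OF mset, symmetric] mset_eq_setD[OF mset, symmetric]
    using inv unfolding invar_def wf_state_def by blast+
  have wfr: "wf_state ?r" by (rule wf_state_remove[OF wf])
  have "wf_state ?st"
    unfolding wf_state_def
  proof (intro conjI)
    show "distinct (map fst (snd ?st))"
      using wfr new by (auto simp: wf_state_def remove_vertex_sets)
    show "wf_edges (set (fst ?st)) (fst ` set (snd ?st))"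
      using wfr mk inV e1 e2 by (auto simp: wf_state_def wf_edges_def remove_vertex_sets mk_edge_def)
    show "\<forall>t\<in>set (snd ?st). snd t \<noteq> []"
      using wfr wf_stateD(4)[OF wf t1(1)] by (auto simp: wf_state_def)
  qed (use wfr conc in \<open>auto simp: wf_state_def\<close>)
  then show ?thesis unfolding invar_def V' E' using conc lift card by simp
qed

lemma red_cases:
  assumes "red u st \<noteq> st"
  obtains (leaf) t where "inc u (snd st) = [t]" "red u st = remove_vertex u st"
  | (path) t1 t2 a v where "inc u (snd st) = [t1, t2]" "a = opp u (fst t1)" "v = opp u (fst t2)"
    "length (inc a (snd st)) = 2" "length (inc v (snd st)) = 2" "\<not> (\<exists>t\<in>set (snd st). fst t = mk_edge a v)"
    "red u st = (fst (remove_vertex u st), (mk_edge a v, snd t1 @ snd t2) # snd (remove_vertex u st))"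
proof (cases "inc u (snd st)")
  case Nil
  then show ?thesis using assms by (simp add: red_def)
next
  case (Cons t1 r)
  show ?thesis
  proof (cases r)
    case Nil
    then show ?thesis using leaf[of t1] Cons by (simp add: red_def)
  next
    case (Cons t2 r')
    then have "red u st = (if r' = [] \<and> length (inc (opp u (fst t1)) (snd st)) = 2 \<and> length (inc (opp u (fst t2)) (snd st)) = 2 \<and>
         \<not> (\<exists>t\<in>set (snd st). fst t = mk_edge (opp u (fst t1)) (opp u (fst t2)))
       then (fst (remove_vertex u st),
         (mk_edge (opp u (fst t1)) (opp u (fst t2)), snd t1 @ snd t2) # snd (remove_vertex u st))
       else st)" using \<open>inc u (snd st) = t1 # r\<close> by (simp add: red_def)
    then show ?thesis using assms Cons path[of t1 t2 "opp u (fst t1)" "opp u (fst t2)"] \<open>inc u (snd st) = t1 # r\<close>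
      by (auto split: if_splits)
  qed
qed

lemma red_step_cases:
  obtains "red_step st = st" "\<And>u. u \<in> set (fst st) \<Longrightarrow> red u st = st"
  | u where "u \<in> set (fst st)" "red u st \<noteq> st" "red_step st = red u st"
proof (cases "filter (\<lambda>u. red u st \<noteq> st) (fst st)")
  case Nil
  then show ?thesis using that(1) by (auto simp: red_step_def filter_empty_conv)
next
  case (Cons u us)
  have "u \<in> set (fst st)" "red u st \<noteq> st" using arg_cong[OF Cons, of set] by auto
  then show ?thesis using that(2)[of u] Cons by (simp add: red_step_def)
qed

lemma invar_red_step: assumes "invar n es st" shows "invar n es (red_step st)"
proof (cases rule: red_step_cases[of st])
  case (2 u)
  from 2(2) show ?thesis
    by (cases rule: red_cases) (use invar_remove[OF assms 2(1)] invar_suppress[OF assms 2(1)] 2(3) in auto)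
qed (use assms in simp)

lemma red_step_length: "length (fst (red_step st)) < length (fst st) \<or> red_step st = st"
proof (cases rule: red_step_cases[of st])
  case (2 u)
  have "length (filter (\<lambda>x. x \<noteq> u) (fst st)) < length (fst st)" by (rule length_filter_less[OF 2(1)]) simp
  with 2(2) show ?thesis
    by (cases rule: red_cases) (use 2(3) in \<open>auto simp: remove_vertex_def\<close>)
qed simp

text \<open>Each step that changes the state shortens the vertex list, so there are at most
  \<open>n\<close> of them.\<close>

lemma red_step_fixpoint: "length (fst st) \<le> n \<Longrightarrow> red_step ((red_step ^^ n) st) = (red_step ^^ n) st"
proof (induction n arbitrary: st)
  case 0
  then show ?case using red_step_length[of st] by simp
next
  case (Suc n)
  show ?case
  proof (cases "red_step st = st")
    case True
    then have "(red_step ^^ m) st = st" for m by (induction m) auto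
    then show ?thesis using True by simp
  next
    case False
    then have "length (fst (red_step st)) \<le> n" using red_step_length[of st] Suc.prems by linarith
    from Suc.IH[OF this] show ?thesis by (simp add: funpow_swap1)
  qed
qed

lemma invar_init:
  assumes wf: "wf_edges {..<n} (set es)" and dist: "distinct es"
  shows "invar n es ([0..<n], map (\<lambda>e. (e, [e])) es)"
proof -
  let ?lab = "map (\<lambda>e. (e, [e])) es"
  have V: "set [0..<n] = {..<n}" by (simp add: atLeast_upt)
  have EH: "EH ?lab = uedge ` set es" by (simp add: EH_def image_image)
  have wfs: "wf_state ([0..<n], ?lab)"
    using wf dist by (auto simp: wf_state_def V o_def image_image atLeast_upt)
  have simple: "simple_graph {..<n} (uedge ` set es)" by (rule simple_graph_uedge[OF _ wf]) simp
  have "lifts (sols {..<n} (uedge ` set es)) (\<lambda>f. {f}) (uedge ` set es) (sols {..<n} (uedge ` set es))"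
    by (rule lifts_refl) (use sols_iff[OF simple] mcut_subset in blast)
  then have "lifts (sols {..<n} (uedge ` set es)) (Lab ?lab) (uedge ` set es) (sols {..<n} (uedge ` set es))"
  proof (rule lifts_cong[rotated])
    fix f assume "f \<in> uedge ` set es"
    then obtain e where e: "e \<in> set es" "f = uedge e" by blast
    then show "{f} = Lab ?lab f" using Lab_eq[OF wfs, of "(e, [e])"] by auto
  qed
  moreover have "set (concat (map snd ?lab)) = set es" by auto
  ultimately show ?thesis using wfs unfolding invar_def by (simp add: EH V atLeast_upt o_def)
qed

section \<open>Irreducible states are small\<close>

lemma incident_inc:
  assumes "wf_state st"
  shows "incident (EH (snd st)) x = (\<lambda>t. uedge (fst t)) ` set (inc x (snd st))"
    "card (incident (EH (snd st)) x) = length (inc x (snd st))"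
proof -
  show eq: "incident (EH (snd st)) x = (\<lambda>t. uedge (fst t)) ` set (inc x (snd st))"
    by (auto simp: incident_def EH_def inc_iff)
  have "inj_on (\<lambda>t. uedge (fst t)) (set (inc x (snd st)))"
    using wf_state_ust_eq[OF assms] by (auto simp: inj_on_def inc_iff)
  moreover have "distinct (inc x (snd st))"
    using assms by (auto simp: wf_state_def inc_def distinct_map)
  ultimately show "card (incident (EH (snd st)) x) = length (inc x (snd st))"
    unfolding eq by (simp add: card_image distinct_card)
qed

lemma irreducible_length:
  assumes wf: "wf_state st" and conn: "\<not> disconnected (set (fst st)) (EH (snd st))"
    and card: "card (EH (snd st)) + 1 \<le> card (set (fst st)) + k"
    and irr: "\<And>u. u \<in> set (fst st) \<Longrightarrow> red u st = st"
  shows "length (fst st) \<le> 8 * k + 3"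
proof -
  let ?V = "set (fst st)" and ?E = "EH (snd st)"
  have simple: "simple_graph ?V ?E" by (rule wf_state_simple_graph[OF wf])
  have len: "length (fst st) = card ?V" using wf by (simp add: wf_state_def distinct_card)
  \<comment> \<open>Both rules delete \<open>u\<close>, so comparing the vertex lists is enough to
    see that a rule would have changed the state.\<close>
  have rem: "fst (remove_vertex u st) \<noteq> fst st" if "u \<in> ?V" for u
  proof
    assume "fst (remove_vertex u st) = fst st"
    then have "?V - {u} = ?V" using remove_vertex_sets(1)[of u st] by simp
    then show False using that by blast
  qed
  show ?thesis
  proof (cases "card ?V \<ge> 2")
    case True
    show ?thesis unfolding len
    proof (rule irreducible_card[OF simple conn card])
      fix x assume x: "x \<in> ?V"
      show "2 \<le> card (incident ?E x)"
        unfolding incident_inc(2)[OF wf]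
      proof (rule ccontr)
        assume "\<not> 2 \<le> length (inc x (snd st))"
        then have "length (inc x (snd st)) = 0 \<or> length (inc x (snd st)) = Suc 0" by linarith
        then consider "inc x (snd st) = []" | t where "inc x (snd st) = [t]"
          by (auto simp: length_Suc_conv)
        then show False
        proof cases
          case 1
          then have "incident ?E x = {}" using incident_inc(1)[OF wf, of x] by simp
          then have "bd ?E {x} = {}" by (auto simp: bd_def incident_def)
          then have "{x} = ?V" using connectedD[OF conn, of "{x}"] x by simp
          then show False using True by (metis card_1_singleton_iff numeral_le_one_iff semiring_norm(69) One_nat_def)
        next
          case 2
          then have "red x st = remove_vertex x st" by (simp add: red_def)
          then show False using irr[OF x] rem[OF x] by simp
        qed
      qed
    next
      fix a u v assume sup: "suppress ?V ?E a u v"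
      interpret suppress ?V ?E a u v by (rule sup)
      show "\<not> (card (incident ?E a) = 2 \<and> card (incident ?E v) = 2)"
      proof
        assume deg: "card (incident ?E a) = 2 \<and> card (incident ?E v) = 2"
        have inc_u: "incident ?E u = {{a, u}, {u, v}}" using au uv deg_u by (auto simp: incident_def)
        then have "length (inc u (snd st)) = 2" using incident_inc(2)[OF wf, of u] ne by simp
        then obtain t1 t2 where t: "inc u (snd st) = [t1, t2]" by (auto simp: length_Suc_conv numeral_2_eq_2)
        have t12: "t1 \<in> set (snd st)" "u \<in> uedge (fst t1)" "t2 \<in> set (snd st)" "u \<in> uedge (fst t2)"
          using inc_iff[of t1 u "snd st"] inc_iff[of t2 u "snd st"] t by auto
        have "{uedge (fst t1), uedge (fst t2)} = {{a, u}, {u, v}}"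
          using inc_u incident_inc(1)[OF wf, of u] t by simp
        moreover have o: "uedge (fst t1) = {u, opp u (fst t1)}" "opp u (fst t1) \<noteq> u"
          "uedge (fst t2) = {u, opp u (fst t2)}" "opp u (fst t2) \<noteq> u"
          using opp_uedge[OF t12(2) wf_stateD(1)[OF wf t12(1)]] opp_uedge[OF t12(4) wf_stateD(1)[OF wf t12(3)]] by auto
        ultimately have opp: "opp u (fst t1) = a \<and> opp u (fst t2) = v \<or> opp u (fst t1) = v \<and> opp u (fst t2) = a"
          using ne by (auto simp: doubleton_eq_iff)
        have len: "length (inc (opp u (fst t1)) (snd st)) = 2" "length (inc (opp u (fst t2)) (snd st)) = 2"
          using opp deg incident_inc(2)[OF wf] by auto
        have new: "\<not> (\<exists>t\<in>set (snd st). fst t = mk_edge (opp u (fst t1)) (opp u (fst t2)))"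
        proof
          assume "\<exists>t\<in>set (snd st). fst t = mk_edge (opp u (fst t1)) (opp u (fst t2))"
          then obtain t' where "t' \<in> set (snd st)" "fst t' = mk_edge (opp u (fst t1)) (opp u (fst t2))" by blast
          then have "t' \<in> set (snd st)" "uedge (fst t') = {a, v}"
            using opp by (auto simp: uedge_mk_edge)
          then have "{a, v} \<in> ?E" unfolding EH_def by blast
          then show False using av by simp
        qed
        have "fst (red u st) = fst (remove_vertex u st)" using t len new by (simp add: red_def)
        then show False using irr[OF in_V(2)] rem[OF in_V(2)] by simp
      qed
    qed
  qed (simp add: len)
qed

section \<open>Renumbering the vertices\<close>

lemma rank_less: "distinct vs \<Longrightarrow> x \<in> set vs \<Longrightarrow> x < y \<Longrightarrow> rank vs x < rank vs y"
proof -
  assume "distinct vs" "x \<in> set vs" "x < y"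
  then have "{z \<in> set vs. z < x} \<subset> {z \<in> set vs. z < y}" by auto
  then have "card {z \<in> set vs. z < x} < card {z \<in> set vs. z < y}" by (intro psubset_card_mono) auto
  moreover have "rank vs w = card {z \<in> set vs. z < w}" for w
    unfolding rank_def distinct_length_filter[OF \<open>distinct vs\<close>] by (rule arg_cong[of _ _ card]) auto
  ultimately show ?thesis by simp
qed

lemma rank_bij:
  assumes "distinct vs" shows "inj_on (rank vs) (set vs)" "rank vs ` set vs = {..<length vs}"
proof -
  show inj: "inj_on (rank vs) (set vs)"
  proof (rule linorder_inj_onI)
    show "rank vs x \<noteq> rank vs y" if "x < y" "x \<in> set vs" "y \<in> set vs" for x y
      using rank_less[OF assms that(2,1)] by simp
  qed auto
  have "rank vs x < length vs" if "x \<in> set vs" for x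
    unfolding rank_def by (rule length_filter_less[OF that]) simp
  then have "rank vs ` set vs \<subseteq> {..<length vs}" by blast
  moreover have "card (rank vs ` set vs) = card {..<length vs}"
    using inj assms by (simp add: card_image distinct_card)
  ultimately show "rank vs ` set vs = {..<length vs}" by (intro card_subset_eq) auto
qed

lemma invar_rename:
  assumes inv: "invar n es st" shows "invar n es ([0..<fst (rename st)], snd (rename st))"
proof -
  let ?V = "set (fst st)" and ?E = "EH (snd st)"
  have wf: "wf_state st" using inv by (simp add: invar_def)
  define r where "r = rank (fst st)"
  have dist: "distinct (fst st)" using wf by (simp add: wf_state_def)
  have inj: "inj_on r ?V" and img: "r ` ?V = {..<length (fst st)}" using rank_bij[OF dist] by (auto simp: r_def)
  define lab where "lab = map (\<lambda>t. ((r (fst (fst t)), r (snd (fst t))), snd t)) (snd st)"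
  have ren: "rename st = (length (fst st), lab)" by (simp add: rename_def lab_def r_def)
  have uedge_r: "uedge (r (fst e), r (snd e)) = r ` uedge e" for e by (simp add: uedge_def)
  have EH: "EH lab = (`) r ` ?E" by (simp add: EH_def lab_def image_image uedge_r)
  have simple: "simple_graph ?V ?E" by (rule wf_state_simple_graph[OF wf])
  have wf': "wf_state ([0..<length (fst st)], lab)"
    unfolding wf_state_def fst_conv snd_conv
  proof (intro conjI)
    have mf: "map fst lab = map (\<lambda>e. (r (fst e), r (snd e))) (map fst (snd st))" by (simp add: lab_def)
    have "inj_on (\<lambda>e. (r (fst e), r (snd e))) (set (map fst (snd st)))"
    proof (rule inj_onI)
      fix e f assume ef: "e \<in> set (map fst (snd st))" "f \<in> set (map fst (snd st))" "(r (fst e), r (snd e)) = (r (fst f), r (snd f))"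
      then obtain t t' where t: "t \<in> set (snd st)" "e = fst t" "t' \<in> set (snd st)" "f = fst t'" unfolding set_map by blast
      have "fst e = fst f" "snd e = snd f"
        using ef(3) inj_onD[OF inj, of "fst e" "fst f"] inj_onD[OF inj, of "snd e" "snd f"]
          wf_stateD(2,3)[OF wf t(1)] wf_stateD(2,3)[OF wf t(3)] t(2,4) by simp_all
      then show "e = f" by (rule prod_eqI)
    qed
    moreover have "distinct (map fst (snd st))" using wf by (simp add: wf_state_def)
    ultimately show "distinct (map fst lab)"
      unfolding mf distinct_map[of "\<lambda>e. (r (fst e), r (snd e))"] by simp
    show "wf_edges (set [0..<length (fst st)]) (fst ` set lab)"
      unfolding wf_edges_def
    proof
      fix e assume "e \<in> fst ` set lab"
      then obtain t where t: "t \<in> set (snd st)" "e = (r (fst (fst t)), r (snd (fst t)))" by (auto simp: lab_def)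
      have "fst e < snd e" using rank_less[OF dist wf_stateD(2)[OF wf t(1)] wf_stateD(1)[OF wf t(1)]] t(2) by (simp add: r_def)
      moreover have "fst e \<in> r ` ?V" "snd e \<in> r ` ?V" using wf_stateD(2,3)[OF wf t(1)] t(2) by auto
      ultimately show "fst e < snd e \<and> fst e \<in> set [0..<length (fst st)] \<and> snd e \<in> set [0..<length (fst st)]"
        unfolding img by simp
    qed
  qed (use wf in \<open>auto simp: wf_state_def lab_def o_def\<close>)
  note rl = renaming_lifts[OF inj simple]
  have l: "lifts (sols {..<n} (uedge ` set es)) (Lab (snd st)) ?E (sols ?V ?E)" using inv by (simp add: invar_def)
  have "lifts (sols {..<n} (uedge ` set es)) (\<lambda>f. \<Union> (Lab (snd st) ` {e \<in> ?E. r ` e = f})) ((`) r ` ?E) (sols (r ` ?V) ((`) r ` ?E))"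
    by (rule lifts_trans[OF l rl(2)]) auto
  then have lift: "lifts (sols {..<n} (uedge ` set es)) (Lab lab) ((`) r ` ?E) (sols (r ` ?V) ((`) r ` ?E))"
  proof (rule lifts_cong[rotated])
    fix f assume "f \<in> (`) r ` ?E"
    show "\<Union> (Lab (snd st) ` {e \<in> ?E. r ` e = f}) = Lab lab f"
    proof (intro set_eqI iffI)
      fix x assume "x \<in> \<Union> (Lab (snd st) ` {e \<in> ?E. r ` e = f})"
      then obtain t where t: "t \<in> set (snd st)" "r ` uedge (fst t) = f" "x \<in> uedge ` set (snd t)" unfolding Lab_def by blast
      then have "((r (fst (fst t)), r (snd (fst t))), snd t) \<in> set lab" by (auto simp: lab_def)
      then show "x \<in> Lab lab f" unfolding Lab_def using t(2,3) uedge_r by force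
    next
      fix x assume "x \<in> Lab lab f"
      then obtain t' where t': "t' \<in> set lab" "uedge (fst t') = f" "x \<in> uedge ` set (snd t')" unfolding Lab_def by blast
      then obtain t where t: "t \<in> set (snd st)" "t' = ((r (fst (fst t)), r (snd (fst t))), snd t)" by (auto simp: lab_def)
      then have "uedge (fst t) \<in> {e \<in> ?E. r ` e = f}" using t'(2) uedge_r by (simp add: EH_def)
      moreover have "x \<in> Lab (snd st) (uedge (fst t))" using t' t Lab_eq[OF wf t(1)] by simp
      ultimately show "x \<in> \<Union> (Lab (snd st) ` {e \<in> ?E. r ` e = f})" by blast
    qed
  qed
  have "inj_on ((`) r) ?E"
  proof (rule inj_onI)
    fix e f assume "e \<in> ?E" "f \<in> ?E" "r ` e = r ` f"
    moreover have "e \<subseteq> ?V" if "e \<in> ?E" for e using simple that by (simp add: simple_graph_def)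
    ultimately show "e = f" using inj_on_image_eq_iff[OF inj, of e f] by simp
  qed
  then have "card ((`) r ` ?E) = card ?E" by (rule card_image)
  moreover have "card (r ` ?V) = card ?V" using inj by (rule card_image)
  moreover have "card ?V = length (fst st)" using dist by (rule distinct_card)
  moreover have "set (concat (map snd lab)) \<subseteq> set es" using inv by (simp add: invar_def lab_def o_def)
  moreover have "set [0..<length (fst st)] = r ` ?V" unfolding img by auto
  ultimately show ?thesis using wf' inv lift unfolding invar_def ren fst_conv snd_conv EH by simp
qed

lemma invar_reduced:
  assumes "wf_edges {..<n} (set es)" "distinct es"
  shows "invar n es ([0..<fst (reduced n es)], snd (reduced n es))"
proof -
  have "invar n es ((red_step ^^ m) ([0..<n], map (\<lambda>e. (e, [e])) es))" for m
    using invar_init[OF assms] by (induction m) (auto intro: invar_red_step)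
  then show ?thesis unfolding reduced_def by (rule invar_rename)
qed

lemma reduced_bound:
  assumes wf: "wf_edges {..<n} (set es)" and dist: "distinct es"
    and conn: "\<not> disconnected {..<n} (uedge ` set es)" and k: "card (uedge ` set es) + 1 \<le> n + k"
  shows "fst (reduced n es) \<le> 8 * k + 3"
proof -
  let ?st = "(red_step ^^ n) ([0..<n], map (\<lambda>e. (e, [e])) es)"
  have "invar n es ((red_step ^^ m) ([0..<n], map (\<lambda>e. (e, [e])) es))" for m
    using invar_init[OF wf dist] by (induction m) (auto intro: invar_red_step)
  then have inv: "invar n es ?st" .
  then have wfs: "wf_state ?st" by (simp add: invar_def)
  have "\<not> disconnected (set (fst ?st)) (EH (snd ?st))"
  proof (rule lifts_connected)
    show "lifts (sols {..<n} (uedge ` set es)) (Lab (snd ?st)) (EH (snd ?st)) (sols (set (fst ?st)) (EH (snd ?st)))"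
      using inv by (simp add: invar_def)
    show "simple_graph {..<n} (uedge ` set es)" by (rule simple_graph_uedge[OF _ wf]) simp
  qed (fact conn wf_state_simple_graph[OF wfs])+
  moreover have "card (EH (snd ?st)) + 1 \<le> card (set (fst ?st)) + k" using inv k by (simp add: invar_def)
  moreover have "red u ?st = ?st" if "u \<in> set (fst ?st)" for u
  proof (cases rule: red_step_cases[of ?st])
    case (2 w)
    \<comment> \<open>The case claims a vertex whose reduction changes the state, which contradicts
      the fixpoint.\<close>
    have "red_step ?st = ?st" by (rule red_step_fixpoint) simp
    with 2 show ?thesis by simp
  qed (use that in simp)
  ultimately have "length (fst ?st) \<le> 8 * k + 3" using irreducible_length[OF wfs] by blast
  then show ?thesis by (simp add: reduced_def rename_def)
qed

text \<open>Distinct positions allow a list of choices to be read as a function of the position;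
  this links the lists of the program to the choice functions of \<open>lifts\<close>.\<close>

lemma list_all2_map_ex:
  "list_all2 P cs ts \<Longrightarrow> distinct ts \<Longrightarrow> \<exists>g. cs = map g ts \<and> (\<forall>t\<in>set ts. P (g t) t)"
proof (induction rule: list_all2_induct)
  case (Cons c cs t ts)
  then obtain g where g: "cs = map g ts" "\<forall>t\<in>set ts. P (g t) t" by auto
  have "map (g(t := c)) ts = map g ts" using Cons.prems by (intro map_cong) auto
  then show ?case using g Cons by (intro exI[of _ "g(t := c)"]) auto
qed simp

text \<open>A vertex is removed only if it has an incident edge, and the other end of that edge
  remains. Thus a vertex survives to which the pendant edge can be attached.\<close>

lemma red_step_nonempty:
  assumes wf: "wf_state st" and ne: "set (fst st) \<noteq> {}" shows "set (fst (red_step st)) \<noteq> {}"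
proof (cases rule: red_step_cases[of st])
  case (2 u)
  have other: "set (fst (remove_vertex u st)) \<noteq> {}" if t: "t \<in> set (inc u (snd st))" for t
  proof -
    have "t \<in> set (snd st)" "u \<in> uedge (fst t)" using t by (auto simp: inc_iff)
    then have "opp u (fst t) \<noteq> u" "opp u (fst t) \<in> set (fst st)"
      using opp_uedge[of u "fst t"] wf_stateD(1-3)[OF wf, of t] by (auto simp: opp_def)
    then show ?thesis unfolding remove_vertex_sets by blast
  qed
  from 2(2) show ?thesis
  proof (cases rule: red_cases)
    case (leaf t)
    then show ?thesis using other[of t] 2(3) by simp
  next
    case (path t1 t2 a v)
    then show ?thesis using other[of t1] 2(3) by simp
  qed
qed (use ne in simp)

lemma small_iff: "M \<in> set (small es) \<longleftrightarrow> (\<exists>e\<in>set es. \<exists>f\<in>set es. M = filter (\<lambda>g. g = e \<or> g = f) es)"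
  by (auto simp: small_def)

section \<open>The kernel of a connected instance\<close>

locale connected_instance =
  fixes n :: nat and es :: "edge list"
  assumes wf: "wf_edges {..<n} (set es)" and dist: "distinct es"
    and conn: "\<not> disconnected {..<n} (uedge ` set es)"
begin

definition "N = fst (reduced n es)"
definition "lab = snd (reduced n es)"
definition "S = sols {..<n} (uedge ` set es)"
definition "T = sols {..<N} (EH lab)"
definition "R = missed n es"

lemma inv: "invar n es ([0..<N], lab)"
  unfolding N_def lab_def by (rule invar_reduced[OF wf dist])

lemma wfs: "wf_state ([0..<N], lab)"
  using inv by (simp add: invar_def)

lemma set_upt0: "set [0..<m] = {..<m}"
  by auto

lemma simple: "simple_graph {..<n} (uedge ` set es)" "simple_graph {..<N} (EH lab)"
  using simple_graph_uedge[OF _ wf] wf_state_simple_graph[OF wfs] by (simp_all add: lessThan_atLeast0)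

lemma lift: "lifts S (Lab lab) (EH lab) T"
  using inv unfolding invar_def S_def T_def fst_conv snd_conv set_upt0 by simp

lemma conn': "\<not> disconnected {..<N} (EH lab)"
  using lifts_connected[OF lift[unfolded S_def T_def] simple conn] .

lemma inj_uedge: "inj_on uedge (set es)"
  by (rule inj_on_uedge[OF wf])

lemma uedge_image_eq: "A \<subseteq> set es \<Longrightarrow> B \<subseteq> set es \<Longrightarrow> uedge ` A = uedge ` B \<longleftrightarrow> A = B"
  by (rule inj_on_image_eq_iff[OF inj_uedge])

lemma S_subset: "M \<in> S \<Longrightarrow> M \<subseteq> uedge ` set es"
  unfolding S_def using sols_iff[OF simple(1)] mcut_subset by blast

lemma T_subset: "s \<in> T \<Longrightarrow> s \<subseteq> EH lab"
  by (rule liftsD(2)[OF lift])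

lemma lab_Lab: "t \<in> set lab \<Longrightarrow> Lab lab (uedge (fst t)) = uedge ` set (snd t)"
  using Lab_eq[OF wfs] by simp

lemma lab_subset: "t \<in> set lab \<Longrightarrow> set (snd t) \<subseteq> set es"
  using inv by (auto simp: invar_def)

lemma Lab_disjoint: "f \<in> EH lab \<Longrightarrow> g \<in> EH lab \<Longrightarrow> x \<in> Lab lab f \<Longrightarrow> x \<in> Lab lab g \<Longrightarrow> f = g"
  using liftsD(1)[OF lift] unfolding disjoint_family_on_def by blast

lemma lab_disjoint:
  assumes "t \<in> set lab" "t' \<in> set lab" "x \<in> uedge ` set (snd t)" "x \<in> uedge ` set (snd t')" shows "t = t'"
proof -
  have "uedge (fst t) \<in> EH lab" "uedge (fst t') \<in> EH lab" using assms(1,2) unfolding EH_def by blast+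
  then have "uedge (fst t) = uedge (fst t')"
    using Lab_disjoint[of "uedge (fst t)" "uedge (fst t')" x] assms by (simp add: lab_Lab)
  then show ?thesis using wf_state_ust_eq[OF wfs] assms(1,2) by simp
qed

lemma lab_uedge_inj: "t \<in> set lab \<Longrightarrow> t' \<in> set lab \<Longrightarrow> uedge (fst t) = uedge (fst t') \<longleftrightarrow> t = t'"
  using wf_state_ust_eq[OF wfs] by simp

text \<open>A lifted solution determines the solution \<open>s\<close> it comes from:
  \<open>s\<close> consists of the edges whose labels it meets. Both the disjointness of the blocks
  and the correctness of \<open>lifted\<close> rest on this.\<close>

lemma choice_meets:
  assumes s: "s \<subseteq> EH lab" "c \<in> Pi s (Lab lab)" and f: "f \<in> EH lab"
  shows "Lab lab f \<inter> c ` s \<noteq> {} \<longleftrightarrow> f \<in> s"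
proof
  assume "Lab lab f \<inter> c ` s \<noteq> {}"
  then obtain g where g: "g \<in> s" "c g \<in> Lab lab f" by blast
  then have "c g \<in> Lab lab g" "g \<in> EH lab" using s by auto
  then have "f = g" using Lab_disjoint[OF f _ g(2)] by blast
  then show "f \<in> s" using g(1) by simp
next
  assume "f \<in> s"
  then show "Lab lab f \<inter> c ` s \<noteq> {}" using s(2) by auto
qed

lemma distinct_lab: "distinct (map fst lab)"
  using wfs by (simp add: wf_state_def)

lemma selected_iff:
  assumes "set M \<subseteq> set es" "t \<in> set lab"
  shows "t \<in> set (selected lab M) \<longleftrightarrow> Lab lab (uedge (fst t)) \<inter> uedge ` set M \<noteq> {}"
proof -
  have "Lab lab (uedge (fst t)) \<inter> uedge ` set M = uedge ` (set (snd t) \<inter> set M)"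
    unfolding lab_Lab[OF assms(2)] by (rule inj_on_image_Int[OF inj_uedge lab_subset[OF assms(2)] assms(1), symmetric])
  then show ?thesis using assms(2) by (auto simp: selected_def)
qed

text \<open>By \<open>choice_meets\<close>, the set \<open>s0\<close> of edges whose labels meet
  \<open>M\<close> is the only candidate for \<open>s\<close>. If it has as many elements as
  \<open>M\<close>, choosing an edge of \<open>M\<close> from each label exhausts
  \<open>M\<close>.\<close>

lemma lifted_iff:
  assumes M: "set M \<subseteq> set es" "distinct M"
  shows "lifted N lab M \<longleftrightarrow> (\<exists>s\<in>T. \<exists>c\<in>Pi s (Lab lab). uedge ` set M = c ` s)"
proof -
  define s0 where "s0 = (\<lambda>t. uedge (fst t)) ` set (selected lab M)"
  have sub: "set (selected lab M) \<subseteq> set lab" by (auto simp: selected_def)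
  have s0E: "s0 \<subseteq> EH lab" using sub by (auto simp: s0_def EH_def)
  have "distinct (selected lab M)" using distinct_lab by (auto simp: selected_def distinct_map)
  moreover have "inj_on (\<lambda>t. uedge (fst t)) (set (selected lab M))"
  proof (rule inj_onI)
    fix t t' assume "t \<in> set (selected lab M)" "t' \<in> set (selected lab M)" "uedge (fst t) = uedge (fst t')"
    then show "t = t'" using lab_uedge_inj[of t t'] sub by blast
  qed
  ultimately have card_s0: "card s0 = length (selected lab M)" by (simp add: s0_def card_image distinct_card)
  have card_M: "card (uedge ` set M) = length M"
    using M inj_uedge by (simp add: card_image inj_on_subset distinct_card)
  have "is_sol [0..<N] (map fst lab) (map fst (selected lab M)) \<longleftrightarrow> s0 \<in> T"
  proof -
    have "wf_edges (set [0..<N]) (set (map fst lab))" using wfs by (simp add: wf_state_def)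
    moreover have "set (map fst (selected lab M)) \<subseteq> set (map fst lab)" using sub by auto
    ultimately show ?thesis
      using is_sol_iff[of "[0..<N]" "map fst lab" "map fst (selected lab M)"]
      unfolding T_def EH_def s0_def set_upt0 by (simp add: image_image)
  qed
  then have lifted: "lifted N lab M \<longleftrightarrow> card s0 = card (uedge ` set M) \<and> s0 \<in> T"
    by (simp add: lifted_def card_s0 card_M)
  have mem: "f \<in> s0 \<longleftrightarrow> Lab lab f \<inter> uedge ` set M \<noteq> {}" if "f \<in> EH lab" for f
  proof -
    obtain t where t: "t \<in> set lab" "f = uedge (fst t)" using \<open>f \<in> EH lab\<close> by (rule EHE)
    have "f \<in> s0 \<longleftrightarrow> t \<in> set (selected lab M)"
      unfolding s0_def using lab_uedge_inj[OF t(1)] sub t(2) by (auto simp: image_iff)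
    then show ?thesis using selected_iff[OF M(1) t(1)] t(2) by simp
  qed
  show ?thesis
  proof
    assume "lifted N lab M"
    then have c: "card s0 = card (uedge ` set M)" and s0T: "s0 \<in> T" using lifted by auto
    have "\<forall>f\<in>s0. \<exists>x. x \<in> Lab lab f \<and> x \<in> uedge ` set M" using mem s0E by blast
    then obtain c where c': "\<forall>f\<in>s0. c f \<in> Lab lab f \<and> c f \<in> uedge ` set M" using bchoice[of s0] by meson
    then have Pi: "c \<in> Pi s0 (Lab lab)" by simp
    have "card (c ` s0) = card (uedge ` set M)"
      using inj_on_choice[OF liftsD(1)[OF lift] s0E Pi] c by (simp add: card_image)
    moreover have "c ` s0 \<subseteq> uedge ` set M" using c' by blast
    ultimately have "uedge ` set M = c ` s0" by (metis List.finite_set card_subset_eq finite_imageI)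
    then show "\<exists>s\<in>T. \<exists>c\<in>Pi s (Lab lab). uedge ` set M = c ` s" using s0T Pi by blast
  next
    assume "\<exists>s\<in>T. \<exists>c\<in>Pi s (Lab lab). uedge ` set M = c ` s"
    then obtain s c where s: "s \<in> T" "c \<in> Pi s (Lab lab)" "uedge ` set M = c ` s" by blast
    have "f \<in> s0 \<longleftrightarrow> f \<in> s" if "f \<in> EH lab" for f
      using mem[OF that] choice_meets[OF T_subset[OF s(1)] s(2) that] s(3) by simp
    then have "s0 = s" using s0E T_subset[OF s(1)] by blast
    moreover have "card (c ` s) = card s"
      by (rule card_image[OF inj_on_choice[OF liftsD(1)[OF lift] T_subset[OF s(1)] s(2)]])
    ultimately show "lifted N lab M" using lifted s by simp
  qed
qed

lemma small_props:
  assumes "M \<in> set (small es)"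
  shows "set M \<subseteq> set es" "distinct M" "M = filter (\<lambda>g. g \<in> set M) es"
proof -
  obtain e f where ef: "e \<in> set es" "f \<in> set es" "M = filter (\<lambda>g. g = e \<or> g = f) es"
    using assms by (auto simp: small_iff)
  then show "set M \<subseteq> set es" "distinct M" using dist by auto
  have "set M = {e, f}" using ef by auto
  then show "M = filter (\<lambda>g. g \<in> set M) es" using ef(3) by simp
qed

lemma missed_iff:
  "M \<in> set R \<longleftrightarrow> M \<in> set (small es) \<and> uedge ` set M \<in> S \<and> \<not> (\<exists>s\<in>T. \<exists>c\<in>Pi s (Lab lab). uedge ` set M = c ` s)"
proof (cases "M \<in> set (small es)")
  case True
  have wf': "wf_edges (set [0..<n]) (set es)" using wf by (simp add: lessThan_atLeast0)
  have "is_sol [0..<n] es M \<longleftrightarrow> uedge ` set M \<in> S"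
    using is_sol_iff[OF wf' small_props(1)[OF True]] unfolding S_def set_upt0 .
  then show ?thesis
    unfolding R_def missed_def N_def[symmetric] lab_def[symmetric]
    using lifted_iff[OF small_props(1,2)[OF True]] True by auto
qed (auto simp: R_def missed_def)

lemma inj_on_R: "inj_on (\<lambda>M. uedge ` set M) (set R)"
proof (rule inj_onI)
  fix M M' assume M: "M \<in> set R" "M' \<in> set R" "uedge ` set M = uedge ` set M'"
  then have *: "M \<in> set (small es)" "M' \<in> set (small es)" by (auto simp: missed_iff)
  then have "set M = set M'" using M(3) uedge_image_eq[OF small_props(1)[OF *(1)] small_props(1)[OF *(2)]] by simp
  then show "M = M'" using small_props(3)[OF *(1)] small_props(3)[OF *(2)] by simp
qed

lemma N_pos: "R \<noteq> [] \<Longrightarrow> 0 < N"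
proof -
  assume "R \<noteq> []"
  then have "es \<noteq> []" by (auto simp: R_def missed_def small_def nub_def)
  then have "0 < n" using wf by (cases es) (auto simp: wf_edges_def)
  let ?st = "\<lambda>m. (red_step ^^ m) ([0..<n], map (\<lambda>e. (e, [e])) es)"
  have "invar n es (?st m) \<and> set (fst (?st m)) \<noteq> {}" for m
  proof (induction m)
    case 0
    then show ?case using invar_init[OF wf dist] \<open>0 < n\<close> by simp
  next
    case (Suc m)
    then show ?case using invar_red_step[of n es "?st m"] red_step_nonempty[of "?st m"] by (auto simp: invar_def)
  qed
  from this[of n] show "0 < N" by (auto simp: N_def reduced_def rename_def)
qed

definition "LE = snd (kern n es)"
definition "NK = fst (kern n es)"
definition "TK = sols {..<NK} ((\<lambda>t. uedge (fst t)) ` set LE)"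

lemma conn_es: "conn [0..<n] es"
  using conn_iff[of "[0..<n]" es] wf conn by (simp add: lessThan_atLeast0)

lemma LE_eq: "LE = map (\<lambda>t. (fst t, map (\<lambda>e. [e]) (snd t))) lab @ (if R = [] then [] else [((0, N), R)])"
  and NK_eq: "NK = (if R = [] then N else Suc N)"
  by (simp_all add: LE_def NK_def kern_def conn_es R_def N_def lab_def)

lemma lab_props:
  assumes "t \<in> set lab"
  shows "fst (fst t) < snd (fst t)" "fst (fst t) < N" "snd (fst t) < N" "snd t \<noteq> []" "distinct (snd t)"
proof -
  show "fst (fst t) < snd (fst t)" "fst (fst t) < N" "snd (fst t) < N" "snd t \<noteq> []"
    using wf_stateD[OF wfs, of t] assms by auto
  have "distinct (concat (map snd lab))" using wfs by (simp add: wf_state_def)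
  then show "distinct (snd t)" using assms by (auto simp: distinct_concat_iff)
qed

lemma LE_cases:
  assumes "t \<in> set LE"
  obtains t' where "t' \<in> set lab" "t = (fst t', map (\<lambda>e. [e]) (snd t'))" | "R \<noteq> []" "t = ((0, N), R)"
  using assms unfolding LE_eq by (cases "R = []") fastforce+

lemma LE_props:
  assumes "t \<in> set LE"
  shows "fst (fst t) < snd (fst t)" "snd (fst t) < NK" "snd t \<noteq> []" "distinct (snd t)"
    "M \<in> set (snd t) \<Longrightarrow> set M \<subseteq> set es"
proof -
  have "fst (fst t) < snd (fst t) \<and> snd (fst t) < NK \<and> snd t \<noteq> [] \<and> distinct (snd t) \<and>
    (\<forall>M\<in>set (snd t). set M \<subseteq> set es)"
    using assms
  proof (cases rule: LE_cases)
    case (1 t')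
    have "set M \<subseteq> set es" if "M \<in> set (snd t)" for M
      using that lab_subset[OF 1(1)] unfolding 1(2) by auto
    moreover have "distinct (snd t)" using lab_props(5)[OF 1(1)] unfolding 1(2) by (simp add: distinct_map inj_on_def)
    ultimately show ?thesis using lab_props(1,3,4)[OF 1(1)] unfolding 1(2) NK_eq by simp
  next
    case 2
    have "distinct R" unfolding R_def missed_def small_def by simp
    moreover have "set M \<subseteq> set es" if "M \<in> set R" for M using that small_props(1) by (simp add: missed_iff)
    ultimately show ?thesis using 2(1) N_pos unfolding 2(2) NK_eq by simp
  qed
  then show "fst (fst t) < snd (fst t)" "snd (fst t) < NK" "snd t \<noteq> []" "distinct (snd t)"
    "M \<in> set (snd t) \<Longrightarrow> set M \<subseteq> set es" by auto
qed

lemma distinct_LE: "distinct (map fst LE)"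
proof -
  have "(0, N) \<notin> fst ` set lab" using lab_props(3) by force
  then show ?thesis using distinct_lab by (simp add: LE_eq o_def)
qed

lemma EH_LE: "(\<lambda>t. uedge (fst t)) ` set LE = (if R = [] then EH lab else insert {0, N} (EH lab))"
  by (auto simp: LE_eq EH_def image_image uedge_def)

lemma pendant_notin: "{0, N} \<notin> EH lab"
  using simple(2) by (auto simp: simple_graph_def)

lemma TK_eq: "TK = (if R = [] then T else insert {{0, N}} T)"
proof (cases "R = []")
  case False
  have ins: "insert N {..<N} = {..<NK}" "insert {N, 0} (EH lab) = insert {0, N} (EH lab)"
    using False by (auto simp: NK_eq insert_commute)
  have "sols (insert N {..<N}) (insert {N, 0} (EH lab)) = insert {{N, 0}} T"
    unfolding T_def by (rule pendant_sols(2)[OF simple(2) conn']) (use N_pos[OF False] in auto)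
  then show ?thesis unfolding TK_def EH_LE ins using False by (simp add: insert_commute)
qed (simp add: TK_def EH_LE NK_eq T_def)

definition "dg s = map snd (filter (\<lambda>t. uedge (fst t) \<in> s) LE)"
definition "union_of cs = uedge ` set (concat cs)"

lemma dg_T: "s \<in> T \<Longrightarrow> dg s = map (\<lambda>t. map (\<lambda>e. [e]) (snd t)) (filter (\<lambda>t. uedge (fst t) \<in> s) lab)"
  using T_subset[of s] pendant_notin by (auto simp: dg_def LE_eq filter_map o_def uedge_def)

lemma dg_pendant: "R \<noteq> [] \<Longrightarrow> dg {{0, N}} = [R]"
proof -
  assume "R \<noteq> []"
  moreover have "uedge (fst t) \<noteq> {0, N}" if "t \<in> set lab" for t
    using pendant_notin that by (auto simp: EH_def)
  ultimately show ?thesis by (auto simp: dg_def LE_eq filter_map o_def uedge_def filter_empty_conv)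
qed

lemma choices_T:
  assumes s: "s \<in> T"
  shows "cs \<in> set (choices (dg s)) \<longleftrightarrow> (\<exists>h. cs = map (\<lambda>t. [h t]) (filter (\<lambda>t. uedge (fst t) \<in> s) lab) \<and>
    (\<forall>t\<in>set lab. uedge (fst t) \<in> s \<longrightarrow> h t \<in> set (snd t)))" (is "?l \<longleftrightarrow> ?r")
proof
  let ?F = "filter (\<lambda>t. uedge (fst t) \<in> s) lab"
  have "distinct ?F" using distinct_lab by (auto simp: distinct_map)
  assume ?l
  then have "list_all2 (\<lambda>c t. c \<in> set (map (\<lambda>e. [e]) (snd t))) cs ?F"
    unfolding set_choices dg_T[OF s] list_all2_map2 .
  from list_all2_map_ex[OF this \<open>distinct ?F\<close>]
  obtain g where g: "cs = map g ?F" "\<forall>t\<in>set ?F. g t \<in> set (map (\<lambda>e. [e]) (snd t))" by blast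
  have "\<forall>t\<in>set ?F. \<exists>e. e \<in> set (snd t) \<and> g t = [e]"
  proof
    fix t assume "t \<in> set ?F"
    then have "g t \<in> (\<lambda>e. [e]) ` set (snd t)" using g(2) unfolding set_map by blast
    then show "\<exists>e. e \<in> set (snd t) \<and> g t = [e]" by blast
  qed
  then obtain h where h: "\<forall>t\<in>set ?F. h t \<in> set (snd t) \<and> g t = [h t]" using bchoice[of "set ?F"] by meson
  then have "cs = map (\<lambda>t. [h t]) ?F" unfolding g(1) by (intro map_cong) auto
  then show ?r using h by (intro exI[of _ h]) auto
next
  assume ?r
  then obtain h where h: "cs = map (\<lambda>t. [h t]) (filter (\<lambda>t. uedge (fst t) \<in> s) lab)"
    "\<forall>t\<in>set lab. uedge (fst t) \<in> s \<longrightarrow> h t \<in> set (snd t)" by blast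
  show ?l unfolding set_choices dg_T[OF s] h(1) list_all2_map1 list_all2_map2 list_all2_same
    using h(2) by auto
qed

lemma union_of_map: "union_of (map (\<lambda>t. [h t]) F) = uedge ` h ` set F"
  by (auto simp: union_of_def)

lemma union_of_T:
  assumes s: "s \<in> T"
  shows "union_of ` set (choices (dg s)) = {c ` s | c. c \<in> Pi s (Lab lab)}"
proof (intro set_eqI iffI)
  let ?F = "filter (\<lambda>t. uedge (fst t) \<in> s) lab"
  fix U assume "U \<in> union_of ` set (choices (dg s))"
  then obtain cs where cs: "cs \<in> set (choices (dg s))" "U = union_of cs" by blast
  then obtain h where h1: "cs = map (\<lambda>t. [h t]) ?F" and h2: "\<forall>t\<in>set lab. uedge (fst t) \<in> s \<longrightarrow> h t \<in> set (snd t)"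
    using choices_T[OF s] by blast
  have h: "U = uedge ` h ` set ?F" using cs(2) unfolding h1 union_of_map .
  \<comment> \<open>Different entries of \<open>lab\<close> have different edges, so the description
    selects the unique entry belonging to \<open>f\<close>, and \<open>c\<close> is the choice
    function that corresponds to \<open>h\<close>.\<close>
  define c where "c f = uedge (h (SOME t. t \<in> set lab \<and> uedge (fst t) = f))" for f
  have c: "c (uedge (fst t)) = uedge (h t)" if "t \<in> set lab" for t
  proof -
    have "(SOME t'. t' \<in> set lab \<and> uedge (fst t') = uedge (fst t)) = t"
    proof (rule some_equality)
      fix t' assume "t' \<in> set lab \<and> uedge (fst t') = uedge (fst t)"
      then show "t' = t" using lab_uedge_inj[of t' t] that by simp
    qed (use that in simp)
    then show ?thesis by (simp add: c_def)
  qed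
  have s_eq: "s = (\<lambda>t. uedge (fst t)) ` set ?F" using T_subset[OF s] by (auto simp: EH_def)
  have "c f \<in> Lab lab f" if f: "f \<in> s" for f
  proof -
    have "f \<in> EH lab" using T_subset[OF s] f by blast
    then obtain t where t: "t \<in> set lab" "f = uedge (fst t)" by (rule EHE)
    then have "h t \<in> set (snd t)" using h2 f by blast
    then show ?thesis using t(2) c[OF t(1)] lab_Lab[OF t(1)] by simp
  qed
  moreover have "U = c ` s"
  proof -
    have "c ` s = c ` (\<lambda>t. uedge (fst t)) ` set ?F" by (rule arg_cong[OF s_eq])
    also have "\<dots> = (\<lambda>t. c (uedge (fst t))) ` set ?F" by (rule image_image)
    also have "\<dots> = (\<lambda>t. uedge (h t)) ` set ?F" by (rule image_cong) (auto simp: c)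
    finally show ?thesis unfolding h by (simp add: image_image)
  qed
  ultimately show "U \<in> {c ` s | c. c \<in> Pi s (Lab lab)}" by blast
next
  let ?F = "filter (\<lambda>t. uedge (fst t) \<in> s) lab"
  fix U assume "U \<in> {c ` s | c. c \<in> Pi s (Lab lab)}"
  then obtain c where c: "c \<in> Pi s (Lab lab)" "U = c ` s" by blast
  have "\<forall>t\<in>set ?F. \<exists>e. e \<in> set (snd t) \<and> uedge e = c (uedge (fst t))"
  proof
    fix t assume "t \<in> set ?F"
    then have "t \<in> set lab" "c (uedge (fst t)) \<in> Lab lab (uedge (fst t))" using c(1) by auto
    then have "c (uedge (fst t)) \<in> uedge ` set (snd t)" using lab_Lab by simp
    then obtain e where "c (uedge (fst t)) = uedge e" "e \<in> set (snd t)" by (rule imageE)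
    then show "\<exists>e. e \<in> set (snd t) \<and> uedge e = c (uedge (fst t))" by (intro exI[of _ e]) simp
  qed
  then obtain h where h: "\<forall>t\<in>set ?F. h t \<in> set (snd t) \<and> uedge (h t) = c (uedge (fst t))"
    using bchoice[of "set ?F"] by meson
  have s_eq: "s = (\<lambda>t. uedge (fst t)) ` set ?F" using T_subset[OF s] by (auto simp: EH_def)
  have "c ` s = c ` (\<lambda>t. uedge (fst t)) ` set ?F" by (rule arg_cong[OF s_eq])
  also have "\<dots> = (\<lambda>t. c (uedge (fst t))) ` set ?F" by (rule image_image)
  also have "\<dots> = (\<lambda>t. uedge (h t)) ` set ?F" by (rule image_cong) (use h in auto)
  also have "\<dots> = union_of (map (\<lambda>t. [h t]) ?F)" by (simp add: union_of_map image_image)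
  finally have "U = union_of (map (\<lambda>t. [h t]) ?F)" using c(2) by simp
  moreover have "map (\<lambda>t. [h t]) ?F \<in> set (choices (dg s))" unfolding choices_T[OF s] using h by auto
  ultimately show "U \<in> union_of ` set (choices (dg s))" by blast
qed

lemma union_of_T_iff:
  assumes "s \<in> T" shows "U \<in> union_of ` set (choices (dg s)) \<longleftrightarrow> (\<exists>c\<in>Pi s (Lab lab). U = c ` s)"
  unfolding union_of_T[OF assms] by blast

text \<open>An original edge lies in the label of only one kernel edge, so equal unions force equal
  choices. Consequently the enumeration of a block repeats nothing.\<close>

lemma inj_union_of_T:
  assumes s: "s \<in> T" shows "inj_on union_of (set (choices (dg s)))"
proof (rule inj_onI)
  let ?F = "filter (\<lambda>t. uedge (fst t) \<in> s) lab"
  fix cs cs' assume "cs \<in> set (choices (dg s))" "cs' \<in> set (choices (dg s))" and eq: "union_of cs = union_of cs'"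
  then obtain h h' where h: "cs = map (\<lambda>t. [h t]) ?F" "\<forall>t\<in>set lab. uedge (fst t) \<in> s \<longrightarrow> h t \<in> set (snd t)"
    and h': "cs' = map (\<lambda>t. [h' t]) ?F" "\<forall>t\<in>set lab. uedge (fst t) \<in> s \<longrightarrow> h' t \<in> set (snd t)"
    unfolding choices_T[OF s] by blast
  have "h t = h' t" if t: "t \<in> set ?F" for t
  proof -
    have "uedge (h t) \<in> uedge ` h' ` set ?F" using eq t unfolding h(1) h'(1) union_of_map by blast
    then obtain t' where t': "t' \<in> set ?F" "uedge (h t) = uedge (h' t')" by blast
    have "h t \<in> set (snd t)" "h' t' \<in> set (snd t')" "t \<in> set lab" "t' \<in> set lab"
      using t t' h(2) h'(2) by auto
    moreover have "t = t'"
      by (rule lab_disjoint[of t t' "uedge (h t)"]) (use calculation t'(2) in auto)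
    ultimately show ?thesis using t'(2) lab_subset inj_onD[OF inj_uedge, of "h t" "h' t'"] by blast
  qed
  then show "cs = cs'" unfolding h(1) h'(1) by (intro map_cong) auto
qed

lemma union_of_pendant: "choices [R] = map (\<lambda>M. [M]) R" "union_of [M] = uedge ` set M"
  by (simp_all add: union_of_def)

lemma TK_cases:
  assumes "s \<in> TK" obtains "s \<in> T" | "R \<noteq> []" "s = {{0, N}}"
  using assms by (auto simp: TK_eq split: if_splits)

lemma kern_sound: "s \<in> TK \<Longrightarrow> cs \<in> set (choices (dg s)) \<Longrightarrow> union_of cs \<in> S"
proof (erule TK_cases)
  assume cs: "cs \<in> set (choices (dg s))" and "s \<in> T"
  from imageI[OF cs, of union_of] obtain c where "c \<in> Pi s (Lab lab)" "union_of cs = c ` s"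
    unfolding union_of_T_iff[OF \<open>s \<in> T\<close>] by (rule bexE)
  then show ?thesis using liftsD(3)[OF lift \<open>s \<in> T\<close>] by simp
next
  assume cs: "cs \<in> set (choices (dg s))" and R: "R \<noteq> []" "s = {{0, N}}"
  obtain M where "M \<in> set R" "cs = [M]" using cs unfolding R(2) dg_pendant[OF R(1)] union_of_pendant by auto
  then show ?thesis using union_of_pendant(2) missed_iff by simp
qed

text \<open>A solution that no choice produces has at most two edges by \<open>lifts\<close>, and at
  least one since the graph is connected. So it occurs in \<open>small\<close> and hence among the
  missed ones.\<close>

lemma kern_complete:
  assumes M: "M \<in> S" shows "\<exists>s\<in>TK. M \<in> union_of ` set (choices (dg s))"
proof (cases "\<exists>s\<in>T. \<exists>c\<in>Pi s (Lab lab). M = c ` s")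
  case True
  then obtain s c where s: "s \<in> T" "c \<in> Pi s (Lab lab)" "M = c ` s" by blast
  then have "M \<in> union_of ` set (choices (dg s))" unfolding union_of_T_iff[OF s(1)] by blast
  moreover have "s \<in> TK" using s(1) by (simp add: TK_eq)
  ultimately show ?thesis by blast
next
  case False
  then have card: "card M \<le> 2" using liftsD(4)[OF lift M] by linarith
  obtain A where A: "A \<subseteq> set es" "M = uedge ` A" using S_subset[OF M] by (auto simp: subset_image_iff)
  have "M \<noteq> {}" using M conn empty_mcut_iff sols_iff[OF simple(1)] unfolding S_def by blast
  have finA: "finite A" using A(1) finite_subset by blast
  have "card A \<le> 2" using card A card_image[OF inj_on_subset[OF inj_uedge A(1)]] by simp
  moreover have "card A \<noteq> 0" using \<open>M \<noteq> {}\<close> A(2) finA by auto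
  ultimately consider "card A = 1" | "card A = 2" by linarith
  then obtain e f where ef: "A = {e, f}" by cases (auto simp: card_1_singleton_iff card_2_iff)
  define m where "m = filter (\<lambda>g. g = e \<or> g = f) es"
  have m: "m \<in> set (small es)" "set m = A" using ef A(1) by (auto simp: small_iff m_def)
  then have mR: "m \<in> set R" using missed_iff False M A(2) by simp
  then have ne: "R \<noteq> []" by auto
  have "[m] \<in> set (choices (dg {{0, N}}))" unfolding dg_pendant[OF ne] union_of_pendant using mR by simp
  moreover have "M = union_of [m]" unfolding union_of_pendant using m A by simp
  moreover have "{{0, N}} \<in> TK" using ne by (simp add: TK_eq)
  ultimately show ?thesis by blast
qed

text \<open>Between solutions of the reduced graph, \<open>choice_meets\<close> recovers the origin.
  The block of the pendant edge consists of solutions with no origin in \<open>T\<close>, so it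
  meets no other block.\<close>

lemma kern_disjoint:
  assumes "s \<in> TK" "s' \<in> TK" "U \<in> union_of ` set (choices (dg s))" "U \<in> union_of ` set (choices (dg s'))"
  shows "s = s'"
proof -
  have R: "\<not> (\<exists>s\<in>T. \<exists>c\<in>Pi s (Lab lab). U = c ` s)" if R: "R \<noteq> []" and U: "U \<in> union_of ` set (choices (dg {{0, N}}))" for U
  proof -
    obtain M where "M \<in> set R" "U = uedge ` set M"
      using U unfolding dg_pendant[OF R] union_of_pendant(1) by (auto simp: union_of_pendant(2))
    then show ?thesis by (simp add: missed_iff)
  qed
  have TT: "s = s'" if s: "s \<in> T" "s' \<in> T"
    and U: "U \<in> union_of ` set (choices (dg s))" "U \<in> union_of ` set (choices (dg s'))" for s s'
  proof -
    obtain c c' where c: "c \<in> Pi s (Lab lab)" "U = c ` s" "c' \<in> Pi s' (Lab lab)" "U = c' ` s'"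
      using U unfolding union_of_T_iff[OF s(1)] union_of_T_iff[OF s(2)] by (elim bexE)
    have "f \<in> s \<longleftrightarrow> f \<in> s'" if "f \<in> EH lab" for f
      using choice_meets[OF T_subset[OF s(1)] c(1) that] choice_meets[OF T_subset[OF s(2)] c(3) that] c(2,4) by simp
    then show ?thesis using T_subset[OF s(1)] T_subset[OF s(2)] by blast
  qed
  from assms(1) show ?thesis
  proof (cases rule: TK_cases)
    case 1
    from assms(2) show ?thesis
    proof (cases rule: TK_cases)
      case 1
      then show ?thesis using TT[OF \<open>s \<in> T\<close> 1 assms(3,4)] by simp
    next
      case 2
      then show ?thesis using R[of U] assms(3,4) union_of_T_iff[OF \<open>s \<in> T\<close>, of U] \<open>s \<in> T\<close> by blast
    qed
  next
    case 2
    note s = this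
    from assms(2) show ?thesis
    proof (cases rule: TK_cases)
      case 1
      then show ?thesis using R[of U] assms(3,4) union_of_T_iff[OF 1, of U] s 1 by blast
    qed (use s in simp)
  qed
qed

lemma inj_union_of: "s \<in> TK \<Longrightarrow> inj_on union_of (set (choices (dg s)))"
proof (erule TK_cases)
  assume R: "R \<noteq> []" "s = {{0, N}}"
  show "inj_on union_of (set (choices (dg s)))"
    unfolding R(2) dg_pendant[OF R(1)] union_of_pendant(1)
    using inj_on_R by (auto simp: inj_on_def union_of_pendant(2))
qed (rule inj_union_of_T)

lemma dg_props: "D \<in> set (dg s) \<Longrightarrow> D \<noteq> [] \<and> distinct D"
  using LE_props(3,4) by (auto simp: dg_def)

lemma choices_subset:
  assumes "cs \<in> set (choices (dg s))" shows "set (concat cs) \<subseteq> set es"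
proof -
  have "\<exists>D\<in>set Ds. c \<in> set D" if "c \<in> set cs" "list_all2 (\<lambda>c D. c \<in> set D) cs Ds" for c :: "edge list" and cs Ds
    using that(2,1) by (induction rule: list_all2_induct) auto
  then have "\<exists>t\<in>set LE. c \<in> set (snd t)" if "c \<in> set cs" for c
    using that assms unfolding set_choices by (fastforce simp: dg_def)
  then show ?thesis using LE_props(5) by fastforce
qed

end

section \<open>A spanning tree by deleting dispensable edges\<close>

lemma separated_mono: "separated V F \<Longrightarrow> F' \<subseteq> F \<Longrightarrow> separated V F'"
  unfolding separated_def by blast

text \<open>One pass suffices: an edge that was indispensable when it was visited remains so,
  because later edge sets are smaller.\<close>

lemma spanning_fold:
  assumes "conn [0..<n] T"
  defines "g \<equiv> \<lambda>e T. if conn [0..<n] (filter (\<lambda>f. f \<noteq> e) T) then filter (\<lambda>f. f \<noteq> e) T else T"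
  shows "set (fold g ys T) \<subseteq> set T \<and> conn [0..<n] (fold g ys T) \<and>
    (\<forall>e\<in>set ys. e \<in> set (fold g ys T) \<longrightarrow> \<not> conn [0..<n] (filter (\<lambda>f. f \<noteq> e) (fold g ys T)))"
  using assms(1)
proof (induction ys arbitrary: T)
  case (Cons e ys)
  have "conn [0..<n] (g e T)" "set (g e T) \<subseteq> set T" using Cons.prems by (auto simp: g_def)
  then have IH: "set (fold g ys (g e T)) \<subseteq> set (g e T)" "conn [0..<n] (fold g ys (g e T))"
    "\<forall>f\<in>set ys. f \<in> set (fold g ys (g e T)) \<longrightarrow> \<not> conn [0..<n] (filter (\<lambda>h. h \<noteq> f) (fold g ys (g e T)))"
    using Cons.IH by blast+
  have "\<not> conn [0..<n] (filter (\<lambda>h. h \<noteq> e) (fold g ys (g e T)))" if e: "e \<in> set (fold g ys (g e T))"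
  proof -
    have "e \<in> set (g e T)" using IH(1) e by blast
    then have ge: "g e T = T" "\<not> conn [0..<n] (filter (\<lambda>h. h \<noteq> e) T)" by (auto simp: g_def split: if_splits)
    have "set (filter (\<lambda>h. h \<noteq> e) (fold g ys (g e T))) \<subseteq> set (filter (\<lambda>h. h \<noteq> e) T)" using IH(1) ge(1) by auto
    then show ?thesis using ge(2) separated_mono unfolding conn_iff_separated by blast
  qed
  then show ?case using IH \<open>set (g e T) \<subseteq> set T\<close> by auto
qed simp

text \<open>A cycle would contain an edge whose deletion keeps the graph connected, but every edge
  that is left is indispensable.\<close>

lemma spanning_tree:
  assumes wf: "wf_edges {..<n} (set es)" and c: "conn [0..<n] es"
  shows "set (spanning n es) \<subseteq> set es" "forest (uedge ` set (spanning n es))"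
    "\<not> disconnected {..<n} (uedge ` set (spanning n es))"
proof -
  let ?T = "spanning n es"
  have T: "set ?T \<subseteq> set es" "conn [0..<n] ?T"
    "\<And>e. e \<in> set es \<Longrightarrow> e \<in> set ?T \<Longrightarrow> \<not> conn [0..<n] (filter (\<lambda>f. f \<noteq> e) ?T)"
    using spanning_fold[OF c, of es] unfolding spanning_def by blast+
  then show "set ?T \<subseteq> set es" by simp
  have cn: "conn [0..<n] ys \<longleftrightarrow> \<not> disconnected {..<n} (uedge ` set ys)" if "set ys \<subseteq> set es" for ys
  proof -
    have "wf_edges (set [0..<n]) (set ys)" using wf that by (auto simp: wf_edges_def)
    from conn_iff[OF this] show ?thesis by (simp add: lessThan_atLeast0)
  qed
  show conn: "\<not> disconnected {..<n} (uedge ` set ?T)" using T(2) cn[OF T(1)] by simp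
  show "forest (uedge ` set ?T)"
    unfolding forest_def
  proof
    assume "\<exists>vs. is_cycle (uedge ` set ?T) vs"
    then obtain e where e: "e \<in> uedge ` set ?T" "\<not> disconnected {..<n} (uedge ` set ?T - {e})"
      using connected_cycle_edge[OF conn] by blast
    then obtain f where f: "f \<in> set ?T" "e = uedge f" by blast
    have inj: "inj_on uedge (set ?T)" using inj_on_uedge[OF wf] T(1) by (rule inj_on_subset)
    have "uedge ` set (filter (\<lambda>h. h \<noteq> f) ?T) = uedge ` (set ?T - {f})" by (rule arg_cong[of _ _ "image uedge"]) auto
    also have "\<dots> = uedge ` set ?T - {e}" using inj_on_image_set_diff[OF inj, of "set ?T" "{f}"] f by simp
    finally have "conn [0..<n] (filter (\<lambda>h. h \<noteq> f) ?T)" using e(2) cn[of "filter (\<lambda>h. h \<noteq> f) ?T"] T(1) by auto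
    then show False using T(1,3) f(1) by blast
  qed
qed

section \<open>Instances of the enumeration problem\<close>

lemma edge_set_uedge: "edge_set es = uedge ` set es"
  by (force simp: edge_set_def uedge_def)

lemma mc_instanceD:
  assumes "(n, es, fs) \<in> mc_instances"
  shows "wf_edges {..<n} (set es)" "distinct es" "feedback_edge_set (uedge ` set es) (uedge ` set fs)"
    "card (uedge ` set fs) = feedback_edge_number (uedge ` set es)"
proof -
  have *: "\<forall>(u, v)\<in>set es. u < v" "distinct es" "simple_graph {..<n} (uedge ` set es)"
    "feedback_edge_set (uedge ` set es) (uedge ` set fs)" "card (uedge ` set fs) = feedback_edge_number (uedge ` set es)"
    using assms by (auto simp: mc_instances_def edge_set_uedge)
  then show "distinct es" "feedback_edge_set (uedge ` set es) (uedge ` set fs)"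
    "card (uedge ` set fs) = feedback_edge_number (uedge ` set es)" by auto
  show "wf_edges {..<n} (set es)"
    unfolding wf_edges_def
  proof
    fix e assume e: "e \<in> set es"
    then have "uedge e \<subseteq> {..<n}" using *(3) by (auto simp: simple_graph_def)
    then show "fst e < snd e \<and> fst e \<in> {..<n} \<and> snd e \<in> {..<n}" using *(1) e by (auto simp: uedge_def)
  qed
qed

lemma forest_empty: "forest {}"
  unfolding forest_def
proof
  assume "\<exists>vs. is_cycle {} (vs :: 'a list)"
  then obtain vs :: "'a list" where vs: "is_cycle {} vs" by blast
  have "3 \<le> length vs" using vs unfolding is_cycle_def by (rule conjunct1)
  then have "0 < length vs" by linarith
  then show False using vs unfolding is_cycle_def by blast
qed

text \<open>The alternative \<open>es = []\<close> serves the kernel with two isolated vertices,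
  which is disconnected; its minimum feedback edge set is empty.\<close>

lemma mc_instanceI:
  assumes wf: "wf_edges {..<n} (set es)" and "distinct es" and c: "es = [] \<or> conn [0..<n] es"
  shows "(n, es, filter (\<lambda>e. e \<notin> set (spanning n es)) es) \<in> mc_instances"
proof -
  let ?fs = "filter (\<lambda>e. e \<notin> set (spanning n es)) es" and ?E = "uedge ` set es"
  have simple: "simple_graph {..<n} ?E" by (rule simple_graph_uedge[OF _ wf]) simp
  have "feedback_edge_set ?E (uedge ` set ?fs) \<and> feedback_edge_number ?E = card (uedge ` set ?fs)"
  proof (cases "es = []")
    case True
    have fes: "feedback_edge_set ({} :: nat set set) {}" by (simp add: feedback_edge_set_def forest_empty)
    have "feedback_edge_number ({} :: nat set set) = 0" by (rule feedback_edge_number_eqI[OF fes]) simp_all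
    with fes show ?thesis unfolding True by simp
  next
    case False
    then have c: "conn [0..<n] es" using c by simp
    note T = spanning_tree[OF wf c]
    have "uedge ` set ?fs = ?E - uedge ` set (spanning n es)"
      using inj_on_image_set_diff[OF inj_on_uedge[OF wf], of "set es" "set (spanning n es)"] T(1)
      by (simp add: set_diff_eq)
    moreover have "uedge ` set (spanning n es) \<subseteq> ?E" using T(1) by blast
    ultimately show ?thesis using spanning_tree_feedback[OF simple _ T(2,3)] by simp
  qed
  moreover have "\<forall>(u, v)\<in>set es. u < v" using wf by (auto simp: wf_edges_def)
  ultimately show ?thesis using assms(2) simple by (simp add: mc_instances_def edge_set_uedge)
qed

definition sol_list :: "mc_instance \<Rightarrow> nat set set \<Rightarrow> edge list" where
  "sol_list x M = filter (\<lambda>e. uedge e \<in> M) (fst (snd x))"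

lemma enum_minimal_mc_simps:
  "instances enum_minimal_mc = mc_instances"
  "Sol enum_minimal_mc (n, es, fs) = sols {..<n} (uedge ` set es)"
  "param enum_minimal_mc (n, es, fs) = feedback_edge_number (uedge ` set es)"
  "enc_inst enum_minimal_mc x = enc x"
  "enc_sol enum_minimal_mc x M = enc (sol_list x M)"
  "inst_size enum_minimal_mc x = esize x"
proof -
  have edges: "enc_edges es = enc es" for es
  proof -
    have "(\<lambda>(u, v). Node (enc_nat u) (enc_nat v)) = (enc :: edge \<Rightarrow> tree)" by (auto simp: enc_nat')
    then show ?thesis by (simp add: enc_edges_def enc_list')
  qed
  show "instances enum_minimal_mc = mc_instances" by (simp add: enum_minimal_mc_def)
  show "Sol enum_minimal_mc (n, es, fs) = sols {..<n} (uedge ` set es)"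
    "param enum_minimal_mc (n, es, fs) = feedback_edge_number (uedge ` set es)"
    by (simp_all add: enum_minimal_mc_def verts_def edges_def edge_set_uedge sols_def)
  show inst: "enc_inst enum_minimal_mc x = enc x" for x
    by (cases x) (simp add: enum_minimal_mc_def edges enc_nat')
  have "(\<lambda>(u, v). {u, v} \<in> M) = (\<lambda>e. uedge e \<in> M)" for M by (auto simp: uedge_def)
  then show "enc_sol enum_minimal_mc x M = enc (sol_list x M)"
    by (cases x) (simp add: enum_minimal_mc_def edges sol_list_def)
  show "inst_size enum_minimal_mc x = esize x" by (simp add: inst_size_def inst)
qed

section \<open>The partition of the solutions into blocks\<close>

definition block :: "mc_instance \<Rightarrow> nat set set \<Rightarrow> nat set set set" where
  "block x s = (\<lambda>cs. uedge ` set (concat cs)) ` set (choices (digits (x, sol_list (mc_kernel x) s)))"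

lemma kernel_eq: "mc_kernel (n, es, fs) = (fst (kern n es), map fst (snd (kern n es)),
    filter (\<lambda>e. e \<notin> set (spanning (fst (kern n es)) (map fst (snd (kern n es))))) (map fst (snd (kern n es))))"
  by (simp add: mc_kernel_def Let_def)

lemma digits_eq: "digits ((n, es, fs), sol_list (mc_kernel (n, es, fs)) s) =
    map snd (filter (\<lambda>t. uedge (fst t) \<in> s) (snd (kern n es)))"
  unfolding digits_def by (intro arg_cong[of _ _ "map snd"] filter_cong) (auto simp: sol_list_def kernel_eq)

text \<open>In a disconnected graph the empty cut lies below every other cut. Given graph and kernel
  each have one solution, and the empty product of labels yields exactly one choice.\<close>

lemma kernel_disconnected:
  assumes x: "(n, es, fs) \<in> mc_instances" and d: "disconnected {..<n} (uedge ` set es)"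
  shows "kern n es = (2, [])" "Sol enum_minimal_mc (n, es, fs) = {{}}"
    "Sol enum_minimal_mc (mc_kernel (n, es, fs)) = {{}}"
proof -
  have wf: "wf_edges {..<n} (set es)" using mc_instanceD[OF x] by simp
  have "\<not> conn [0..<n] es" using conn_iff[of "[0..<n]" es] wf d by (simp add: lessThan_atLeast0)
  then show k: "kern n es = (2, [])" by (simp add: kern_def)
  have only: "sols V E = {{}}" if "simple_graph V E" "disconnected V E" for V :: "nat set" and E
  proof -
    have "M = {}" if "mcut V E M" for M
      using that \<open>disconnected V E\<close> unfolding mcut_def disconnected_def by blast
    then show ?thesis using sols_iff[OF that(1)] empty_mcut_iff that(2) by blast
  qed
  have "simple_graph {..<n} (uedge ` set es)" by (rule simple_graph_uedge[OF _ wf]) simp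
  then show "Sol enum_minimal_mc (n, es, fs) = {{}}" using only d by (simp add: enum_minimal_mc_simps)
  have "disconnected {..<2} ({} :: nat set set)"
    unfolding disconnected_def
  proof (intro exI conjI)
    have "(1 :: nat) \<in> {..<2}" "(1 :: nat) \<notin> {0}" by simp_all
    then have "{0} \<noteq> {..<2 :: nat}" by metis
    then show "{0} \<subset> {..<2 :: nat}" by (intro psubsetI) simp_all
  qed (simp_all add: bd_def)
  moreover have "simple_graph {..<2} ({} :: nat set set)" by (simp add: simple_graph_def)
  ultimately have "sols {..<2} ({} :: nat set set) = {{}}" using only by blast
  then show "Sol enum_minimal_mc (mc_kernel (n, es, fs)) = {{}}" by (simp add: kernel_eq k enum_minimal_mc_simps)
qed

lemma kernel_connected:
  assumes x: "(n, es, fs) \<in> mc_instances" and d: "\<not> disconnected {..<n} (uedge ` set es)"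
  shows "connected_instance n es" "Sol enum_minimal_mc (n, es, fs) = connected_instance.S n es"
    "Sol enum_minimal_mc (mc_kernel (n, es, fs)) = connected_instance.TK n es"
    "digits ((n, es, fs), sol_list (mc_kernel (n, es, fs)) s) = connected_instance.dg n es s"
    "block (n, es, fs) s = connected_instance.union_of ` set (choices (connected_instance.dg n es s))"
proof -
  show "connected_instance n es" using mc_instanceD[OF x] d by unfold_locales
  then interpret connected_instance n es .
  show "Sol enum_minimal_mc (n, es, fs) = S" by (simp add: enum_minimal_mc_simps S_def)
  show "Sol enum_minimal_mc (mc_kernel (n, es, fs)) = TK"
    by (simp add: kernel_eq enum_minimal_mc_simps TK_def NK_def LE_def image_image)
  show dg: "digits ((n, es, fs), sol_list (mc_kernel (n, es, fs)) s) = dg s"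
    unfolding digits_eq dg_def LE_def ..
  show "block (n, es, fs) s = union_of ` set (choices (dg s))"
    unfolding block_def dg by (simp add: union_of_def)
qed

lemma kernel_instance:
  assumes x: "(n, es, fs) \<in> mc_instances" shows "mc_kernel (n, es, fs) \<in> mc_instances"
proof (cases "disconnected {..<n} (uedge ` set es)")
  case True
  show ?thesis unfolding kernel_eq kernel_disconnected(1)[OF x True]
    using mc_instanceI[of 2 "[]"] by (simp add: wf_edges_def)
next
  case False
  interpret connected_instance n es by (rule kernel_connected(1)[OF x False])
  have wfk: "wf_edges {..<NK} (set (map fst LE))"
    unfolding wf_edges_def using LE_props(1,2) by (fastforce intro: less_trans)
  have "\<not> disconnected {..<NK} (uedge ` set (map fst LE))"
  proof (cases "R = []")
    case True
    then show ?thesis using conn' EH_LE by (simp add: NK_eq image_image)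
  next
    case False
    have ins: "insert N {..<N} = {..<NK}" "insert {N, 0} (EH lab) = insert {0, N} (EH lab)"
      using False by (auto simp: NK_eq insert_commute)
    have "\<not> disconnected (insert N {..<N}) (insert {N, 0} (EH lab))"
      by (rule pendant_sols(3)[OF simple(2) conn']) (use N_pos[OF False] in auto)
    then show ?thesis unfolding ins using EH_LE False by (simp add: image_image)
  qed
  then have "conn [0..<NK] (map fst LE)" using conn_iff[of "[0..<NK]" "map fst LE"] wfk by (simp add: lessThan_atLeast0)
  from mc_instanceI[OF wfk distinct_LE disjI2[OF this]]
  show ?thesis unfolding kernel_eq LE_def NK_def .
qed

text \<open>The reduced graph contributes 8k + 3 vertices and the pendant vertex one more. The empty
  graph is treated apart because \<open>forest_card\<close> speaks of a nonempty vertex set.\<close>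

lemma kernel_vertices:
  assumes x: "(n, es, fs) \<in> mc_instances"
  shows "fst (kern n es) \<le> 8 * feedback_edge_number (uedge ` set es) + 4"
proof (cases "disconnected {..<n} (uedge ` set es)")
  case True
  then show ?thesis using kernel_disconnected(1)[OF x] by simp
next
  case False
  interpret connected_instance n es by (rule kernel_connected(1)[OF x False])
  have "N \<le> 8 * feedback_edge_number (uedge ` set es) + 3"
  proof (cases "n = 0")
    case True
    have "N = fst (reduced n es)" by (rule N_def)
    also have "\<dots> = 0" using True by (simp add: reduced_def rename_def)
    finally show ?thesis by simp
  next
    case False
    let ?E = "uedge ` set es" and ?F = "uedge ` set fs"
    have F: "feedback_edge_set ?E ?F" "card ?F = feedback_edge_number ?E" using mc_instanceD[OF x] by auto
    have "simple_graph {..<n} (?E - ?F)" using simple(1) unfolding simple_graph_def by blast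
    then have "card (?E - ?F) < card {..<n}" by (rule forest_card) (use F(1) False in \<open>auto simp: feedback_edge_set_def\<close>)
    moreover have "card ?E \<le> card (?E - ?F) + card ?F" using diff_card_le_card_Diff[of ?F ?E] by simp
    ultimately have "card ?E + 1 \<le> n + feedback_edge_number ?E" using F(2) by simp
    then show ?thesis unfolding N_def by (rule reduced_bound[OF wf dist conn])
  qed
  then show ?thesis using NK_eq unfolding NK_def by (simp split: if_splits)
qed

section \<open>The size of the kernel in terms of the parameter\<close>

definition size_bound :: "nat \<Rightarrow> nat" where
  "size_bound k = (8 * k + 4) + 2 * ((8 * k + 4) * (8 * k + 4) * (2 * (8 * k + 4) + 2)) + 2 + (8 * k + 4) * (8 * k + 4)"

lemma size_bound_computable: "computable size_bound"
  unfolding size_bound_def by (intro pt_computable pt_add pt_mult pt_const pt_ident)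

text \<open>With at most \<open>b\<close> vertices there are at most b * b edges. Each has a code of
  size at most 2b + 1 and takes one more node in its list. There are two such lists, two nodes
  joining the triple, and a feedback edge number of at most b * b.\<close>

lemma instance_size:
  assumes x: "(n, es, fs) \<in> mc_instances" and n: "n \<le> b"
  shows "esize (n, es, fs) + feedback_edge_number (uedge ` set es) \<le> b + 2 * (b * b * (2 * b + 2)) + 2 + b * b"
proof -
  note D = mc_instanceD[OF x]
  have fs: "set fs \<subseteq> set es" "distinct fs" using x by (auto simp: mc_instances_def)
  have len: "length ys \<le> b * b" if "distinct ys" "set ys \<subseteq> set es" for ys
  proof -
    have "set ys \<subseteq> {..<n} \<times> {..<n}" using D(1) that(2) by (fastforce simp: wf_edges_def)
    then have "card (set ys) \<le> card ({..<n} \<times> {..<n})" by (intro card_mono) auto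
    then have "length ys \<le> n * n" using distinct_card[OF that(1)] by (simp add: card_cartesian_product)
    also have "\<dots> \<le> b * b" using n by (intro mult_le_mono)
    finally show ?thesis .
  qed
  have size: "esize ys \<le> b * b * (2 * b + 2)" if "distinct ys" "set ys \<subseteq> set es" for ys
  proof -
    have "fst e \<le> b \<and> snd e \<le> b" if "e \<in> set ys" for e
      using D(1) n that \<open>set ys \<subseteq> set es\<close> unfolding wf_edges_def by fastforce
    then have "esize ys \<le> length ys * (2 * b + 2)" by (intro esize_edges_le) blast
    also have "\<dots> \<le> b * b * (2 * b + 2)" using len[OF that] by (rule mult_le_mono1)
    finally show ?thesis .
  qed
  have "feedback_edge_number (uedge ` set es) \<le> length fs"
    unfolding D(4)[symmetric] using card_image_le[of "set fs" uedge] card_length[of fs] by (metis List.finite_set le_trans)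
  then show ?thesis using n size[OF D(2)] size[OF fs(2,1)] len[OF fs(2,1)] by simp
qed

lemma kernel_partition:
  assumes x: "(n, es, fs) \<in> mc_instances"
  defines "x \<equiv> (n, es, fs)"
  shows "s \<in> Sol enum_minimal_mc (mc_kernel x) \<Longrightarrow> block x s \<subseteq> Sol enum_minimal_mc x \<and> block x s \<noteq> {}"
    and "disjoint_family_on (block x) (Sol enum_minimal_mc (mc_kernel x))"
    and "(\<Union>s\<in>Sol enum_minimal_mc (mc_kernel x). block x s) = Sol enum_minimal_mc x"
    and "D \<in> set (digits (x, sol_list (mc_kernel x) s)) \<Longrightarrow> D \<noteq> [] \<and> distinct D"
    and "s \<in> Sol enum_minimal_mc (mc_kernel x) \<Longrightarrow>
      inj_on (\<lambda>cs. uedge ` set (concat cs)) (set (choices (digits (x, sol_list (mc_kernel x) s))))"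
    and "cs \<in> set (choices (digits (x, sol_list (mc_kernel x) s))) \<Longrightarrow> set (concat cs) \<subseteq> set es"
proof -
  have main: "(\<forall>s\<in>Sol enum_minimal_mc (mc_kernel x). block x s \<subseteq> Sol enum_minimal_mc x \<and>
      inj_on (\<lambda>cs. uedge ` set (concat cs)) (set (choices (digits (x, sol_list (mc_kernel x) s))))) \<and>
    disjoint_family_on (block x) (Sol enum_minimal_mc (mc_kernel x)) \<and>
    Sol enum_minimal_mc x \<subseteq> (\<Union>s\<in>Sol enum_minimal_mc (mc_kernel x). block x s) \<and>
    (\<forall>s. \<forall>D\<in>set (digits (x, sol_list (mc_kernel x) s)). D \<noteq> [] \<and> distinct D) \<and>
    (\<forall>s. \<forall>cs\<in>set (choices (digits (x, sol_list (mc_kernel x) s))). set (concat cs) \<subseteq> set es)"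
  proof (cases "disconnected {..<n} (uedge ` set es)")
    case True
    note K = kernel_disconnected[OF x True]
    have dg: "digits (x, sol_list (mc_kernel x) s) = []" for s unfolding x_def digits_eq K(1) by simp
    then have "block x s = {{}}" for s by (simp add: block_def)
    then show ?thesis using K(2,3) unfolding x_def[symmetric] by (simp add: dg disjoint_family_on_def)
  next
    case False
    note K = kernel_connected[OF x False]
    interpret connected_instance n es by (rule K(1))
    have u: "(\<lambda>cs. uedge ` set (concat cs)) = union_of" by (simp add: union_of_def fun_eq_iff)
    show ?thesis
      unfolding x_def K(2-5) u
    proof (intro conjI ballI allI)
      show "union_of ` set (choices (dg s)) \<subseteq> S" if "s \<in> TK" for s using kern_sound[OF that] by blast
      show "inj_on union_of (set (choices (dg s)))" if "s \<in> TK" for s using inj_union_of[OF that] .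
      show "disjoint_family_on (\<lambda>s. union_of ` set (choices (dg s))) TK"
        unfolding disjoint_family_on_def using kern_disjoint by blast
      show "S \<subseteq> (\<Union>s\<in>TK. union_of ` set (choices (dg s)))" using kern_complete by blast
      show "D \<noteq> []" "distinct D" if "D \<in> set (dg s)" for D s using dg_props[OF that] by auto
      show "set (concat cs) \<subseteq> set es" if "cs \<in> set (choices (dg s))" for cs s using choices_subset[OF that] .
    qed
  qed
  note 1 = main[THEN conjunct1] and 2 = main[THEN conjunct2, THEN conjunct1]
    and 3 = main[THEN conjunct2, THEN conjunct2, THEN conjunct1]
    and 4 = main[THEN conjunct2, THEN conjunct2, THEN conjunct2, THEN conjunct1]
    and 5 = main[THEN conjunct2, THEN conjunct2, THEN conjunct2, THEN conjunct2]
  \<comment> \<open>A product of nonempty labels is nonempty, hence so is every block.\<close>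
  have choices_ne: "choices Ds \<noteq> []" if "\<forall>D\<in>set Ds. D \<noteq> []" for Ds :: "edge list list list"
    using that by (induction Ds) (auto simp: concat_eq_Nil_conv neq_Nil_conv)
  then have ne: "block x s \<noteq> {}" for s unfolding block_def using 4 by simp
  show "block x s \<subseteq> Sol enum_minimal_mc x \<and> block x s \<noteq> {}" if "s \<in> Sol enum_minimal_mc (mc_kernel x)"
    using bspec[OF 1 that] ne by simp
  show "(\<Union>s\<in>Sol enum_minimal_mc (mc_kernel x). block x s) = Sol enum_minimal_mc x"
  proof (rule antisym[OF UN_least 3])
    show "block x s \<subseteq> Sol enum_minimal_mc x" if "s \<in> Sol enum_minimal_mc (mc_kernel x)" for s
      using bspec[OF 1 that] by simp
  qed
  show "disjoint_family_on (block x) (Sol enum_minimal_mc (mc_kernel x))" by (rule 2)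
  show "D \<noteq> [] \<and> distinct D" if "D \<in> set (digits (x, sol_list (mc_kernel x) s))"
    using bspec[OF spec[OF 4] that] .
  show "inj_on (\<lambda>cs. uedge ` set (concat cs)) (set (choices (digits (x, sol_list (mc_kernel x) s))))"
    if "s \<in> Sol enum_minimal_mc (mc_kernel x)"
    using bspec[OF 1 that] by simp
  show "set (concat cs) \<subseteq> set es" if "cs \<in> set (choices (digits (x, sol_list (mc_kernel x) s)))"
    using bspec[OF spec[OF 5] that] .
qed

section \<open>The programs\<close>

lemma delay_at_most_mono:
  assumes "delay_at_most tr d" "d \<le> d'" shows "delay_at_most tr d'"
  unfolding delay_at_most_def
proof (intro allI impI)
  fix us m ws assume "tr = us @ replicate m None @ ws"
  then have "m \<le> d" using assms(1) unfolding delay_at_most_def by blast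
  then show "m \<le> d'" using assms(2) by (rule order_trans)
qed

lemma delay_at_most_prefix:
  assumes "delay_at_most tr d" shows "delay_at_most (replicate a None @ tr) (a + d)"
  unfolding delay_at_most_def
proof (intro allI impI)
  fix us m ws assume eq: "replicate a None @ tr = us @ replicate m None @ ws"
  have "tr = drop a (us @ replicate m None @ ws)" unfolding eq[symmetric] by simp
  also have "\<dots> = drop a us @ replicate (m - (a - length us)) None @ drop (a - length us - m) ws" by simp
  finally have "m - (a - length us) \<le> d" using assms unfolding delay_at_most_def by blast
  then show "m \<le> a + d" by linarith
qed

lemma kernel_program:
  "\<exists>A (p :: nat poly). \<forall>x\<in>mc_instances. computes_in_time A [enc x] (enc (mc_kernel x)) (poly p (esize x))"
proof -
  obtain c N p where c: "polytime_by c N p mc_kernel" using pt_kernel unfolding pt_def by blast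
  \<comment> \<open>One \<open>p\<close> pays for the computation, the other for the size of the
    result, which \<open>computes_in_time\<close> charges as well.\<close>
  have "computes_in_time c [enc x] (enc (mc_kernel x)) (poly (p + p) (esize x))" for x
  proof -
    have "init [enc x] 0 = enc x" by (simp add: init_def)
    from polytime_byE[OF c, of "init [enc x]" x, OF this] obtain t \<sigma>' where
      "exec c (init [enc x]) (replicate t None) \<sigma>'" "\<sigma>' 0 = enc (mc_kernel x)" "t \<le> poly p (esize x)" by blast
    then show ?thesis unfolding computes_in_time_def
      using polytime_by_esize[OF c, of x] by (intro exI[of _ "replicate t None"] exI[of _ \<sigma>']) simp
  qed
  then show ?thesis by blast
qed

lemma lift_out_eq:
  assumes x: "(n, es, fs) \<in> mc_instances" and cs: "set (concat cs) \<subseteq> set es"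
  shows "lift_out ((n, es, fs), sl) cs = sol_list (n, es, fs) (uedge ` set (concat cs))"
  unfolding lift_out_def sol_list_def fst_conv snd_conv
proof (rule filter_cong[OF refl])
  fix e assume "e \<in> set es"
  then show "e \<in> set (concat cs) \<longleftrightarrow> uedge e \<in> uedge ` set (concat cs)"
    using inj_on_image_mem_iff[OF inj_on_uedge[OF mc_instanceD(1)[OF x]] _ cs] by simp
qed

lemma lifting_program:
  "\<exists>A' (q :: nat poly). \<forall>x\<in>mc_instances. \<forall>s\<in>Sol enum_minimal_mc (mc_kernel x).
     enumerates_with_delay A' [enc x, enc (mc_kernel x), enc (sol_list (mc_kernel x) s)]
       (\<lambda>M. enc (sol_list x M)) (block x s) (poly q (esize x + esize (mc_kernel x)))"
proof -
  define D where "D = {(x, sol_list (mc_kernel x) s) | x s. x \<in> mc_instances}"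
  have "\<forall>ds\<in>set (digits z). ds \<noteq> []" if "z \<in> D" for z
  proof
    fix ds assume ds: "ds \<in> set (digits z)"
    obtain n es fs s where z: "z = ((n, es, fs), sol_list (mc_kernel (n, es, fs)) s)" "(n, es, fs) \<in> mc_instances"
      using \<open>z \<in> D\<close> unfolding D_def by auto
    show "ds \<noteq> []" using kernel_partition(4)[OF z(2) ds[unfolded z(1)]] by simp
  qed
  from product_enumeration[where D = D, OF pt_digits pt_lift_out this]
  obtain c q where c: "\<forall>z\<in>D. \<forall>\<sigma>. \<sigma> 0 = enc z \<longrightarrow> (\<exists>tr \<sigma>'. exec c \<sigma> tr \<sigma>' \<and>
    delay_at_most tr (poly q (esize z)) \<and> outputs tr = map (\<lambda>cs. enc (lift_out z cs)) (choices (digits z)))"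
    by blast
  \<comment> \<open>The enumeration runs on the pair of the instance (variable 0) and the kernel
    solution (variable 2).\<close>
  let ?A = "Seq (Assign 0 (Pair (Var 0) (Var 2))) c"
  have "enumerates_with_delay ?A [enc x, enc (mc_kernel x), enc (sol_list (mc_kernel x) s)]
       (\<lambda>M. enc (sol_list x M)) (block x s) (poly (pcompose q (pvar + pconst 1) + pconst 3) (esize x + esize (mc_kernel x)))"
    if x: "x \<in> mc_instances" and s: "s \<in> Sol enum_minimal_mc (mc_kernel x)" for x s
  proof -
    let ?ts = "[enc x, enc (mc_kernel x), enc (sol_list (mc_kernel x) s)]"
    let ?z = "(x, sol_list (mc_kernel x) s)"
    obtain n es fs where xx: "x = (n, es, fs)" by (cases x)
    note K = kernel_partition[OF x[unfolded xx]]
    define \<sigma> where "\<sigma> = (init ?ts)(0 := enc ?z)"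
    have e: "exec (Assign 0 (Pair (Var 0) (Var 2))) (init ?ts) (replicate 3 None) \<sigma>"
      by (rule exec_Assign') (simp_all add: \<sigma>_def init_def)
    have "?z \<in> D" using x unfolding D_def by blast
    moreover have "\<sigma> 0 = enc ?z" by (simp add: \<sigma>_def)
    ultimately obtain tr \<sigma>' where tr: "exec c \<sigma> tr \<sigma>'" "delay_at_most tr (poly q (esize ?z))"
      "outputs tr = map (\<lambda>cs. enc (lift_out ?z cs)) (choices (digits ?z))" using c by blast
    let ?ms = "map (\<lambda>cs. uedge ` set (concat cs)) (choices (digits ?z))"
    have "esize (sol_list (mc_kernel x) s) \<le> esize (fst (snd (mc_kernel x)))"
      unfolding sol_list_def by (rule esize_filter)
    also have "\<dots> \<le> esize (mc_kernel x)" by (simp add: size_enc_prod[of "mc_kernel x"] size_enc_prod[of "snd (mc_kernel x)"])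
    finally have "poly q (esize ?z) \<le> poly q (esize x + esize (mc_kernel x) + 1)" by (intro poly_nat_mono) simp
    moreover have "delay_at_most (replicate 3 None @ tr) (3 + poly q (esize ?z))"
      by (rule delay_at_most_prefix[OF tr(2)])
    ultimately have delay: "delay_at_most (replicate 3 None @ tr)
        (poly (pcompose q (pvar + pconst 1) + pconst 3) (esize x + esize (mc_kernel x)))"
      by (elim delay_at_most_mono) (simp add: poly_pcompose)
    have "distinct ?ms"
      using K(5)[OF s[unfolded xx]] K(4) distinct_choices[of "digits ?z"] unfolding xx distinct_map by blast
    moreover have "set ?ms = block x s" by (simp add: block_def)
    moreover have "map (\<lambda>cs. enc (lift_out ?z cs)) (choices (digits ?z)) = map (\<lambda>M. enc (sol_list x M)) ?ms"
      unfolding xx map_map o_def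
    proof (rule map_cong[OF refl])
      fix cs assume "cs \<in> set (choices (digits ((n, es, fs), sol_list (mc_kernel (n, es, fs)) s)))"
      from lift_out_eq[OF x[unfolded xx] K(6)[OF this]]
      show "enc (lift_out ((n, es, fs), sol_list (mc_kernel (n, es, fs)) s) cs) = enc (sol_list (n, es, fs) (uedge ` set (concat cs)))"
        by simp
    qed
    moreover have "exec ?A (init ?ts) (replicate 3 None @ tr) \<sigma>'" by (rule exec.Seq[OF e tr(1)])
    ultimately show ?thesis unfolding enumerates_with_delay_def using delay tr(3)
      by (intro exI[of _ "replicate 3 None @ tr"] exI[of _ \<sigma>'] exI[of _ ?ms]) simp
  qed
  then show ?thesis by blast
qed

theorem theorem27:
  "\<exists>A A' K (g :: nat \<Rightarrow> real).
     pd_enum_kernel enum_minimal_mc A A' K \<and>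
     g \<in> O(\<lambda>k. real k) \<and>
     (\<forall>x \<in> instances enum_minimal_mc. real (card (verts (K x))) \<le> g (param enum_minimal_mc x))"
proof -
  let ?P = enum_minimal_mc
  obtain A p where A: "\<forall>x\<in>mc_instances. computes_in_time A [enc x] (enc (mc_kernel x)) (poly p (esize x))"
    using kernel_program by blast
  obtain A' q where A': "\<forall>x\<in>mc_instances. \<forall>s\<in>Sol ?P (mc_kernel x).
     enumerates_with_delay A' [enc x, enc (mc_kernel x), enc (sol_list (mc_kernel x) s)]
       (\<lambda>M. enc (sol_list x M)) (block x s) (poly q (esize x + esize (mc_kernel x)))"
    using lifting_program by blast
  have inst: "mc_kernel x \<in> mc_instances" if "x \<in> mc_instances" for x
    using kernel_instance that by (cases x) auto
  have time: "computes_in_time A [enc x] (enc (mc_kernel x)) (poly p (esize x + k))" if "x \<in> mc_instances" for x k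
    using bspec[OF A that] poly_nat_mono[of "esize x" "esize x + k" p] unfolding computes_in_time_def
    by (meson le_add1 order_trans)
  have size: "esize (mc_kernel x) + param ?P (mc_kernel x) \<le> size_bound (param ?P x)" if x: "x \<in> mc_instances" for x
  proof -
    obtain n es fs where xx: "x = (n, es, fs)" by (cases x)
    obtain n' es' fs' where k: "mc_kernel x = (n', es', fs')" by (cases "mc_kernel x")
    have "n' \<le> 8 * param ?P x + 4"
      using kernel_vertices[OF x[unfolded xx]] k unfolding xx enum_minimal_mc_simps kernel_eq by simp
    from instance_size[OF inst[OF x, unfolded k] this]
    show ?thesis unfolding k size_bound_def by (simp only: enum_minimal_mc_simps)
  qed
  have delay: "enumerates_with_delay A' [enc x, enc (mc_kernel x), enc (sol_list (mc_kernel x) s)]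
       (\<lambda>M. enc (sol_list x M)) (block x s) (poly q (esize x + esize (mc_kernel x) + k + l))"
    if "x \<in> mc_instances" "s \<in> Sol ?P (mc_kernel x)" for x s k l
  proof -
    have le: "poly q (esize x + esize (mc_kernel x)) \<le> poly q (esize x + esize (mc_kernel x) + k + l)"
      by (rule poly_nat_mono) simp
    have "delay_at_most tr (poly q (esize x + esize (mc_kernel x) + k + l))"
      if "delay_at_most tr (poly q (esize x + esize (mc_kernel x)))" for tr
      using that le by (rule delay_at_most_mono)
    then show ?thesis using bspec[OF bspec[OF A' that(1)] that(2)] unfolding enumerates_with_delay_def by blast
  qed
  have part: "(\<forall>s\<in>Sol ?P (mc_kernel x). block x s \<subseteq> Sol ?P x \<and> block x s \<noteq> {}) \<and>
      disjoint_family_on (block x) (Sol ?P (mc_kernel x)) \<and> (\<Union>s\<in>Sol ?P (mc_kernel x). block x s) = Sol ?P x"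
    if x: "x \<in> mc_instances" for x
  proof -
    obtain n es fs where xx: "x = (n, es, fs)" by (cases x)
    note K = kernel_partition[OF x[unfolded xx]]
    show ?thesis unfolding xx using K(1) by (intro conjI ballI K(2,3)) blast+
  qed
  have "pd_enum_kernel ?P A A' mc_kernel"
    unfolding pd_enum_kernel_def enum_minimal_mc_simps(1,4,5,6)
  proof (intro conjI)
    show "\<exists>p :: nat poly. \<forall>x\<in>mc_instances. mc_kernel x \<in> mc_instances \<and>
        computes_in_time A [enc x] (enc (mc_kernel x)) (poly p (esize x + param ?P x))"
      by (intro exI[of _ p] ballI conjI inst time)
    show "\<exists>f. computable f \<and> (\<forall>x\<in>mc_instances. esize (mc_kernel x) + param ?P (mc_kernel x) \<le> f (param ?P x))"
      by (intro exI[of _ size_bound] conjI ballI size size_bound_computable)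
    show "\<exists>q :: nat poly. \<forall>x\<in>mc_instances. \<exists>S.
        (\<forall>s\<in>Sol ?P (mc_kernel x). S s \<subseteq> Sol ?P x \<and> S s \<noteq> {} \<and>
           enumerates_with_delay A' [enc x, enc (mc_kernel x), enc (sol_list (mc_kernel x) s)]
             (\<lambda>M. enc (sol_list x M)) (S s)
             (poly q (esize x + esize (mc_kernel x) + param ?P x + param ?P (mc_kernel x)))) \<and>
        disjoint_family_on S (Sol ?P (mc_kernel x)) \<and> (\<Union>s\<in>Sol ?P (mc_kernel x). S s) = Sol ?P x"
    proof (intro exI[of _ q] ballI)
      fix x assume x: "x \<in> mc_instances"
      show "\<exists>S. (\<forall>s\<in>Sol ?P (mc_kernel x). S s \<subseteq> Sol ?P x \<and> S s \<noteq> {} \<and>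
           enumerates_with_delay A' [enc x, enc (mc_kernel x), enc (sol_list (mc_kernel x) s)]
             (\<lambda>M. enc (sol_list x M)) (S s)
             (poly q (esize x + esize (mc_kernel x) + param ?P x + param ?P (mc_kernel x)))) \<and>
        disjoint_family_on S (Sol ?P (mc_kernel x)) \<and> (\<Union>s\<in>Sol ?P (mc_kernel x). S s) = Sol ?P x"
      proof (intro exI[of _ "block x"] conjI ballI delay[OF x])
        show "block x s \<subseteq> Sol ?P x" "block x s \<noteq> {}" if "s \<in> Sol ?P (mc_kernel x)" for s
          using bspec[OF conjunct1[OF part[OF x]] that] by simp_all
      qed (use part[OF x] in simp_all)
    qed
  qed
  moreover have "(\<lambda>k. real (8 * k + 4)) \<in> O(\<lambda>k. real k)"
  \<comment> \<open>8k + 4 <= 12k holds from k = 1 on.\<close>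
  proof (rule landau_o.bigI[where c = 12])
    show "eventually (\<lambda>k. norm (real (8 * k + 4)) \<le> 12 * norm (real k)) at_top"
      using eventually_ge_at_top[of 1] by eventually_elim simp
  qed simp
  moreover have "real (card (verts (mc_kernel x))) \<le> real (8 * param ?P x + 4)" if x: "x \<in> instances ?P" for x
  proof -
    obtain n es fs where xx: "x = (n, es, fs)" by (cases x)
    have "card (verts (mc_kernel x)) = fst (kern n es)" unfolding xx kernel_eq by (simp add: verts_def)
    moreover have "fst (kern n es) \<le> 8 * param ?P x + 4"
      using kernel_vertices[of n es fs] x unfolding xx enum_minimal_mc_simps by simp
    ultimately show ?thesis by (simp only: of_nat_le_iff)
  qed
  ultimately show ?thesis by (intro exI conjI ballI)
qed

end
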